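(* Let $n\ge1$ be an integer, let $D\subset\mathbb R^n$ be an open set with $0\in D$, let $d>1$ be a real number, and let $u,v:D\to[0,\infty)$ be nonnegative subharmonic functions of class $C^2$ satisfying $$|v(0)|\le|u(0)|,\qquad |\nabla v(x)|\le|\nabla u(x)|\quad\text{for all }x\in D,$$ $$u(x)\Delta u(x)\ge(d-1)|\nabla u(x)|^2\quad\text{and}\quad v(x)\Delta v(x)\le(d-1)|\nabla v(x)|^2\quad\text{for all }x\in D.$$ Then for any $(2-d)_+<p<\infty$, $$\|v\|_p\le C_{p,d}\,\|u\|_p .$$
   Context: Here $\|u\|_p=\sup\left[\int_{\partial D_0}|u(x)|^p\,\mu_{D_0}(\mathrm{d}x)\right]^{1/p}$, where the supremum is over all bounded subdomains $D_0$ of $D$ with $0\in D_0$ and $\partial D_0\subset D$, and $\mu_{D_0}$ is the harmonic measure on $\partial D_0$ with respect to $0$. $(r)_+=\max\{r,0\}$. For $p>0$, $d>1$ let $g=g_{p,d}:[-1,1)\to\mathbb R$ be given by $g(s)=\sum_{m\ge0}a_m(1+s)^m$ with $a_0=-1$ and $$a_{m+1}=-\prod_{k=0}^m\frac{k(k-1)+2(d-1)k-p(d-1)}{2(k+1)(k+d-1)},\qquad m\ge0 .$$ It is continuous on $[-1,1)$, $g(-1)=-1$, and solves $(1-s^2)g''(s)-2(d-1)sg'(s)+p(d-1)g(s)=0$ on $(-1,1)$. For $p+d>2$ let $z_0=z_0(p,d)$ be the smallest root of $g_{p,d}$ in $[-1,1)$, and set $$C_{p,d}=\frac{1+z_0}{1-z_0}\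 \text{ if }(2-d)_+<p\le2,\qquad C_{p,d}=\frac{1-z_0}{1+z_0}\ \text{ if }2<p<\infty .$$ *)

theory Defs
  imports "HOL-Probability.Probability_Measure"
begin

section \<open>Functions of class \<open>C\<^sup>2\<close>\<close>

text \<open>All notions below are used only on open sets, so the unrestricted filter \<open>at x\<close> is the
  right one and values of \<open>f\<close> outside the set are irrelevant.\<close>

definition partial_deriv :: "'a::euclidean_space \<Rightarrow> ('a \<Rightarrow> real) \<Rightarrow> 'a \<Rightarrow> real" where
  "partial_deriv b f x = frechet_derivative f (at x) b"

definition C1_on :: "'a::euclidean_space set \<Rightarrow> ('a \<Rightarrow> real) \<Rightarrow> bool" where
  "C1_on S f \<longleftrightarrow> (\<forall>x\<in>S. f differentiable (at x)) \<and>
                 (\<forall>b\<in>Basis. continuous_on S (partial_deriv b f))"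

definition C2_on :: "'a::euclidean_space set \<Rightarrow> ('a \<Rightarrow> real) \<Rightarrow> bool" where
  "C2_on S f \<longleftrightarrow> C1_on S f \<and> (\<forall>b\<in>Basis. C1_on S (partial_deriv b f))"

definition gradient :: "('a::euclidean_space \<Rightarrow> real) \<Rightarrow> 'a \<Rightarrow> 'a" where
  "gradient f x = (THE g. GDERIV f x :> g)"

definition laplacian :: "('a::euclidean_space \<Rightarrow> real) \<Rightarrow> 'a \<Rightarrow> real" where
  "laplacian f x = (\<Sum>b\<in>Basis. partial_deriv b (partial_deriv b f) x)"


section \<open>Subharmonic functions\<close>

definition harmonic_on :: "'a::euclidean_space set \<Rightarrow> ('a \<Rightarrow> real) \<Rightarrow> bool" where
  "harmonic_on S h \<longleftrightarrow> C2_on S h \<and> (\<forall>x\<in>S. laplacian h x = 0)"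

text \<open>Continuous subharmonic functions on an open set, defined as in Gilbarg and Trudinger,
  Section 2.8, by comparison with harmonic functions on balls whose closure lies in the set.\<close>

definition subharmonic_on :: "'a::euclidean_space set \<Rightarrow> ('a \<Rightarrow> real) \<Rightarrow> bool" where
  "subharmonic_on S w \<longleftrightarrow> continuous_on S w \<and>
     (\<forall>y r h. 0 < r \<longrightarrow> cball y r \<subseteq> S \<longrightarrow>
        continuous_on (cball y r) h \<longrightarrow> harmonic_on (ball y r) h \<longrightarrow>
        (\<forall>x\<in>sphere y r. w x \<le> h x) \<longrightarrow> (\<forall>x\<in>ball y r. w x \<le> h x))"


section \<open>Harmonic measure\<close>

text \<open>The Perron solution, evaluated at \<open>a\<close>, of the Dirichlet problem on a bounded domain \<open>U\<close>
  with boundary data \<open>\<phi>\<close>. For continuous \<open>\<phi>\<close> the family below is nonempty, and it is bounded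
  above by the maximum principle, so the real-valued supremum is a genuine one.\<close>

definition perron_solution ::
    "'a::euclidean_space set \<Rightarrow> ('a \<Rightarrow> real) \<Rightarrow> 'a \<Rightarrow> real" where
  "perron_solution U \<phi> a =
     Sup {w a | w. continuous_on (closure U) w \<and> subharmonic_on U w \<and>
                   (\<forall>x\<in>frontier U. w x \<le> \<phi> x)}"

text \<open>\<open>\<mu>\<close> is the harmonic measure on the boundary of the bounded domain \<open>U\<close> with respect to
  \<open>a \<in> U\<close>: the Borel probability measure on \<open>frontier U\<close> that represents the Perron solution at
  \<open>a\<close> for all continuous boundary data. Classical potential theory provides exactly one such
  measure for every bounded domain, with no regularity assumption on the boundary.\<close>

definition harmonic_measure ::
    "'a::euclidean_space set \<Rightarrow> 'a \<Rightarrow> 'a measure \<Rightarrow> bool" where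
  "harmonic_measure U a \<mu> \<longleftrightarrow>
     prob_space \<mu> \<and> sets \<mu> = sets (restrict_space borel (frontier U)) \<and>
     (\<forall>\<phi>. continuous_on (frontier U) \<phi> \<longrightarrow> (\<integral>x. \<phi> x \<partial>\<mu>) = perron_solution U \<phi> a)"

definition admissible_subdomain ::
    "'a::euclidean_space set \<Rightarrow> 'a set \<Rightarrow> bool" where
  "admissible_subdomain D D0 \<longleftrightarrow>
     open D0 \<and> connected D0 \<and> bounded D0 \<and> 0 \<in> D0 \<and> D0 \<subseteq> D \<and> frontier D0 \<subseteq> D"

text \<open>The norm \<open>\<parallel>u\<parallel>\<^sub>p\<close> of a function that is continuous on \<open>D\<close>. Each single integral is finite,
  because \<open>frontier D0\<close> is a compact subset of \<open>D\<close>; only the supremum may be infinite. As the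
  harmonic measure of \<open>D0\<close> is unique, the supremum over pairs is the supremum over \<open>D0\<close>.\<close>

definition harm_norm ::
    "'a::euclidean_space set \<Rightarrow> real \<Rightarrow> ('a \<Rightarrow> real) \<Rightarrow> ennreal" where
  "harm_norm D p u =
     (SUP (D0, \<mu>) \<in> {(D0, \<mu>). admissible_subdomain D D0 \<and> harmonic_measure D0 0 \<mu>}.
        ennreal ((\<integral>x. \<bar>u x\<bar> powr p \<partial>\<mu>) powr (1 / p)))"


section \<open>The constant \<open>C\<^sub>p\<^sub>,\<^sub>d\<close>\<close>

fun g_coeff :: "real \<Rightarrow> real \<Rightarrow> nat \<Rightarrow> real" where
  "g_coeff p d 0 = - 1"
| "g_coeff p d (Suc m) =
     - (\<Prod>k=0..m. (real k * (real k - 1) + 2 * (d - 1) * real k - p * (d - 1)) /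
                    (2 * (real k + 1) * (real k + d - 1)))"

definition g_fun :: "real \<Rightarrow> real \<Rightarrow> real \<Rightarrow> real" where
  "g_fun p d s = (\<Sum>m. g_coeff p d m * (1 + s) ^ m)"

definition smallest_root :: "real \<Rightarrow> real \<Rightarrow> real" where
  "smallest_root p d = (LEAST z. - 1 \<le> z \<and> z < 1 \<and> g_fun p d z = 0)"

definition C_const :: "real \<Rightarrow> real \<Rightarrow> real" where
  "C_const p d =
     (if p \<le> 2 then (1 + smallest_root p d) / (1 - smallest_root p d) else (1 - smallest_root p d) / (1 + smallest_root p d))"

end

theory Submission
  imports Defs "HOL-Library.Landau_Symbols"
begin

text \<open>Burkholder's method. The function
  \<open>\<alpha> (x + y)\<^sup>p g ((y - x) / (x + y))\<close> is degenerate along the lines \<open>x + y = const\<close>,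
  which is the differential equation of \<open>g\<close>. Taken for \<open>y \<le> C x\<close> and continued by a multiple of
  \<open>y\<^sup>p - C\<^sup>p x\<^sup>p\<close> for \<open>y \<ge> C x\<close> (for \<open>p > 2\<close> the roles of \<open>x\<close> and \<open>y\<close> and the sign are
  reversed), it becomes a function \<open>B\<close> that is at least the same multiple of
  \<open>y\<^sup>p - C\<^sup>p x\<^sup>p\<close>, that is nonpositive for \<open>y \<le> x\<close>, and for which
  \<open>B (u + h, v)\<close> with \<open>h > 0\<close> is superharmonic. Hence the integral of \<open>v\<^sup>p - C\<^sup>p (u + h)\<^sup>p\<close> against
  harmonic measure is nonpositive, and \<open>h\<close> tends to \<open>0\<close>. The shift by \<open>h\<close> preserves the
  hypotheses and removes the zeros of \<open>u\<close>.

  Since \<open>B\<close> is not \<open>C\<^sup>2\<close>, superharmonicity is used in the viscosity sense, which also suits the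
  definition of harmonic measure through Perron solutions: all that is needed is the comparison
  of a subharmonic function with a function that is touched from above, at every point, by some
  function with a second-order expansion and nonpositive Laplacian.\<close>

section \<open>Second-order expansions\<close>

text \<open>Homogeneity reduces superharmonicity of \<open>B\<close> to signs of one-variable
  quantities. \<open>B\<close> must be nonincreasing in \<open>x\<close> and nondecreasing in
  \<open>y\<close>, so that the bounds on \<open>u\<close> and \<open>v\<close> times their
  Laplacians can be inserted. A quadratic form in the two gradients remains; it is nonpositive once
  the mixed second derivative is, and the equation of \<open>g\<close> makes it vanish for opposite
  gradients of equal length. The sign of \<open>g\<close> is known only before its first root. Hence
  each sign comes from an integrating factor that makes the quantity monotone up to that root,
  starting from \<open>-1\<close>. The root fixes the constant: \<open>s = z0\<close> is the line
  \<open>y = K x\<close> with \<open>K = (1 + z0) / (1 - z0)\<close> (roles reversed for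
  \<open>p > 2\<close>). Both branches vanish there, and \<alpha> is the ratio of their slopes.
  Their second derivatives need not match; the touching argument survives because near this line the
  \<open>g\<close> branch of \<open>B\<close> lies above \<open>B\<close> on both sides. That
  comparison is settled by the sign of a Wronskian.\<close>

text \<open>\<open>f\<close> has at \<open>x\<close> a second-order expansion with gradient \<open>b\<close> and Laplacian \<open>l\<close>. The linear map
  \<open>A\<close> need not be symmetric; only its trace matters. The filter is \<open>nhds 0\<close> rather than \<open>at 0\<close>, so
  that an inner function may take the value \<open>f x\<close> again near \<open>x\<close>.\<close>

definition jet :: "('a::euclidean_space \<Rightarrow> real) \<Rightarrow> 'a \<Rightarrow> 'a \<Rightarrow> real \<Rightarrow> bool" where
  "jet f x b l \<longleftrightarrow> (\<exists>A. linear A \<and> (\<Sum>i\<in>Basis. i \<bullet> A i) = l \<and>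
     (\<lambda>z. f (x + z) - f x - b \<bullet> z - (z \<bullet> A z) / 2) \<in> o[nhds 0](\<lambda>z. (norm z)\<^sup>2))"

lemma jetI:
  assumes "linear A" "(\<Sum>i\<in>Basis. i \<bullet> A i) = l"
    "(\<lambda>z. f (x + z) - f x - b \<bullet> z - (z \<bullet> A z) / 2) \<in> o[nhds 0](\<lambda>z. (norm z)\<^sup>2)"
  shows "jet f x b l"
  using assms unfolding jet_def by blast

lemma jetE:
  assumes "jet f x b l"
  obtains A where "linear A" "(\<Sum>i\<in>Basis. i \<bullet> A i) = l"
    "(\<lambda>z. f (x + z) - f x - b \<bullet> z - (z \<bullet> A z) / 2) \<in> o[nhds 0](\<lambda>z. (norm z)\<^sup>2)"
  using assms unfolding jet_def by blast

lemma jet_const: "jet (\<lambda>_. c) x 0 0"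
  by (rule jetI[where A = "\<lambda>_. 0"]) (auto simp: linear_zero)

lemma jet_add:
  assumes "jet f x b l" "jet g x c m"
  shows "jet (\<lambda>y. f y + g y) x (b + c) (l + m)"
proof -
  obtain A where A: "linear A" "(\<Sum>i\<in>Basis. i \<bullet> A i) = l"
    "(\<lambda>z. f (x + z) - f x - b \<bullet> z - (z \<bullet> A z) / 2) \<in> o[nhds 0](\<lambda>z. (norm z)\<^sup>2)"
    using assms(1) by (rule jetE)
  obtain B where B: "linear B" "(\<Sum>i\<in>Basis. i \<bullet> B i) = m"
    "(\<lambda>z. g (x + z) - g x - c \<bullet> z - (z \<bullet> B z) / 2) \<in> o[nhds 0](\<lambda>z. (norm z)\<^sup>2)"
    using assms(2) by (rule jetE)
  show ?thesis
  proof (rule jetI[where A = "\<lambda>z. A z + B z"])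
    show "linear (\<lambda>z. A z + B z)" using A(1) B(1) by (rule linear_compose_add)
    show "(\<Sum>i\<in>Basis. i \<bullet> (A i + B i)) = l + m"
      using A(2) B(2) by (simp add: inner_add_right sum.distrib)
    have "(\<lambda>z. (f (x + z) - f x - b \<bullet> z - (z \<bullet> A z) / 2) + (g (x + z) - g x - c \<bullet> z - (z \<bullet> B z) / 2))
       \<in> o[nhds 0](\<lambda>z. (norm z)\<^sup>2)"
      using A(3) B(3) by (rule sum_in_smallo)
    then show "(\<lambda>z. f (x + z) + g (x + z) - (f x + g x) - (b + c) \<bullet> z - (z \<bullet> (A z + B z)) / 2)
       \<in> o[nhds 0](\<lambda>z. (norm z)\<^sup>2)"
      by (simp add: inner_add_left inner_add_right add_divide_distrib algebra_simps)
  qed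
qed

lemma jet_scale:
  assumes "jet f x b l"
  shows "jet (\<lambda>y. r * f y) x (r *\<^sub>R b) (r * l)"
proof -
  obtain A where A: "linear A" "(\<Sum>i\<in>Basis. i \<bullet> A i) = l"
    "(\<lambda>z. f (x + z) - f x - b \<bullet> z - (z \<bullet> A z) / 2) \<in> o[nhds 0](\<lambda>z. (norm z)\<^sup>2)"
    using assms(1) by (rule jetE)
  show ?thesis
  proof (rule jetI[where A = "\<lambda>z. r *\<^sub>R A z"])
    show "linear (\<lambda>z. r *\<^sub>R A z)" using A(1) by (rule linear_compose_scale_right)
    show "(\<Sum>i\<in>Basis. i \<bullet> (r *\<^sub>R A i)) = r * l"
      by (simp add: A(2)[symmetric] sum_distrib_left)
    have "(\<lambda>z. r * (f (x + z) - f x - b \<bullet> z - (z \<bullet> A z) / 2)) \<in> o[nhds 0](\<lambda>z. (norm z)\<^sup>2)"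
      using A(3) by (cases "r = 0") auto
    then show "(\<lambda>z. r * f (x + z) - r * f x - (r *\<^sub>R b) \<bullet> z - (z \<bullet> (r *\<^sub>R A z)) / 2)
       \<in> o[nhds 0](\<lambda>z. (norm z)\<^sup>2)"
      by (simp add: algebra_simps)
  qed
qed

lemma inner_linear_bigo:
  fixes A :: "'a::euclidean_space \<Rightarrow> 'a"
  assumes "linear A"
  shows "(\<lambda>z. z \<bullet> A z) \<in> O[F](\<lambda>z. (norm z)\<^sup>2)"
proof -
  obtain B where B: "\<And>x. norm (A x) \<le> B * norm x"
    using linear_bounded[OF assms] by blast
  show ?thesis
  proof (rule bigoI[where c = B], rule always_eventually, rule allI)
    fix z
    have "\<bar>z \<bullet> A z\<bar> \<le> norm z * norm (A z)" by (rule Cauchy_Schwarz_ineq2)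
    also have "\<dots> \<le> norm z * (B * norm z)" by (intro mult_left_mono B) auto
    finally show "norm (z \<bullet> A z) \<le> B * norm ((norm z)\<^sup>2)"
      by (simp add: power2_eq_square algebra_simps)
  qed
qed

lemma inner_bigo: "(\<lambda>z. b \<bullet> z) \<in> O[F](\<lambda>z. norm (z::'a::real_inner))"
  by (rule bigoI[where c = "norm b"]) (auto intro!: always_eventually simp: Cauchy_Schwarz_ineq2)

lemma norm_sq_bigo: "(\<lambda>z. (norm z)\<^sup>2) \<in> o[nhds 0](\<lambda>z. norm (z::'a::real_normed_vector))"
proof (rule landau_o.smallI)
  fix c :: real assume c: "c > 0"
  have "\<forall>\<^sub>F z in nhds (0::'a). norm z < c"
    using c eventually_nhds_metric[of "\<lambda>z. norm z < c" "0::'a"] by (auto simp: dist_norm)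
  then show "\<forall>\<^sub>F z in nhds (0::'a). norm ((norm z)\<^sup>2) \<le> c * norm (norm z)"
    by eventually_elim (simp add: power2_eq_square mult_right_mono)
qed

lemma jet_increment:
  fixes A :: "'a::euclidean_space \<Rightarrow> 'a"
  assumes "linear A" "(\<lambda>z. f (x + z) - f x - b \<bullet> z - (z \<bullet> A z) / 2) \<in> o[nhds 0](\<lambda>z. (norm z)\<^sup>2)"
  shows "(\<lambda>z. f (x + z) - f x - b \<bullet> z) \<in> O[nhds 0](\<lambda>z. (norm z)\<^sup>2)"
    and "(\<lambda>z. f (x + z) - f x) \<in> O[nhds 0](\<lambda>z. norm z)"
proof -
  have "(\<lambda>z. (f (x + z) - f x - b \<bullet> z - (z \<bullet> A z) / 2) + (z \<bullet> A z) / 2) \<in> O[nhds 0](\<lambda>z. (norm z)\<^sup>2)"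
    using inner_linear_bigo[OF assms(1), of "nhds 0"]
    by (intro sum_in_bigo landau_o.small_imp_big[OF assms(2)]) simp
  then show 1: "(\<lambda>z. f (x + z) - f x - b \<bullet> z) \<in> O[nhds 0](\<lambda>z. (norm z)\<^sup>2)" by simp
  have "(\<lambda>z. (f (x + z) - f x - b \<bullet> z) + b \<bullet> z) \<in> O[nhds 0](\<lambda>z. norm z)"
    by (intro sum_in_bigo landau_o.big_trans[OF 1 landau_o.small_imp_big[OF norm_sq_bigo]] inner_bigo)
  then show "(\<lambda>z. f (x + z) - f x) \<in> O[nhds 0](\<lambda>z. norm z)" by simp
qed

lemma jet_continuous:
  assumes "jet f x b l"
  shows "isCont f x"
proof -
  obtain A where A: "linear A"
    "(\<lambda>z. f (x + z) - f x - b \<bullet> z - (z \<bullet> A z) / 2) \<in> o[nhds 0](\<lambda>z. (norm z)\<^sup>2)"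
    using assms(1) by (rule jetE)
  obtain c where "\<forall>\<^sub>F z in nhds 0. norm (f (x + z) - f x) \<le> c * norm (norm z)"
    using jet_increment(2)[OF A] by (elim landau_o.bigE)
  then have "\<forall>\<^sub>F z in at 0. norm (f (x + z) - f x) \<le> c * norm (norm z)"
    unfolding eventually_at_filter by (rule eventually_mono) simp
  then have "((\<lambda>z. f (x + z) - f x) \<longlongrightarrow> 0) (at 0)"
    by (rule Lim_null_comparison) (auto intro!: tendsto_eq_intros)
  then show ?thesis
    by (simp add: isCont_iff LIM_zero_iff)
qed

text \<open>With \<open>h\<close> the increment of \<open>f\<close>, the quadratic term of
  \<open>\<psi>\<close> contains \<open>(h z)\<^sup>2\<close>. The difference
  \<open>(h z)\<^sup>2 - (b \<bullet> z)\<^sup>2\<close> factors into a second-order and a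
  first-order quantity, so it is of third order. What is left is a rank-one map built from
  \<open>b\<close>, of trace \<open>b \<bullet> b\<close>.\<close>

lemma jet_compose:
  assumes "jet f x b l" and "jet \<psi> (f x) \<psi>1 \<psi>2"
  shows "jet (\<lambda>y. \<psi> (f y)) x (\<psi>1 *\<^sub>R b) (\<psi>1 * l + \<psi>2 * (b \<bullet> b))"
proof -
  obtain A where A: "linear A" "(\<Sum>i\<in>Basis. i \<bullet> A i) = l"
    "(\<lambda>z. f (x + z) - f x - b \<bullet> z - (z \<bullet> A z) / 2) \<in> o[nhds 0](\<lambda>z. (norm z)\<^sup>2)"
    using assms(1) by (rule jetE)
  obtain P where P: "linear P" "P 1 = \<psi>2"
    "(\<lambda>h. \<psi> (f x + h) - \<psi> (f x) - \<psi>1 * h - (h * P h) / 2) \<in> o[nhds 0](\<lambda>h::real. (norm h)\<^sup>2)"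
    using assms(2) by (auto elim!: jetE)
  have P': "P h = \<psi>2 * h" for h
    using linear_cmul[OF P(1), of h 1] P(2) by (simp add: mult.commute)
  define h where "h = (\<lambda>z. f (x + z) - f x)"
  have hO: "h \<in> O[nhds 0](\<lambda>z. norm z)" "(\<lambda>z. h z - b \<bullet> z) \<in> O[nhds 0](\<lambda>z. (norm z)\<^sup>2)"
    using jet_increment[OF A(1,3)] by (auto simp: h_def)
  have "filterlim h (nhds 0) (nhds 0)"
  proof -
    have "(\<lambda>z. f (x + z)) \<midarrow>0\<rightarrow> f x"
      using jet_continuous[OF assms(1)] by (simp add: isCont_iff)
    then have "h \<midarrow>0\<rightarrow> h 0" by (simp add: h_def LIM_zero)
    then have "(h \<longlongrightarrow> h 0) (nhds 0)" by (simp only: tendsto_at_iff_tendsto_nhds)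
    then show ?thesis by (simp add: h_def)
  qed
  from landau_o.small.compose[OF P(3) this]
  have "(\<lambda>z. \<psi> (f x + h z) - \<psi> (f x) - \<psi>1 * h z - \<psi>2 * (h z)\<^sup>2 / 2) \<in> o[nhds 0](\<lambda>z. (h z)\<^sup>2)"
    by (simp add: P' power2_eq_square algebra_simps)
  also have "(\<lambda>z. (h z)\<^sup>2) \<in> O[nhds 0](\<lambda>z. (norm z)\<^sup>2)"
    using landau_o.big.mult[OF hO(1) hO(1)] by (simp add: power2_eq_square)
  finally have 1: "(\<lambda>z. \<psi> (f x + h z) - \<psi> (f x) - \<psi>1 * h z - \<psi>2 * (h z)\<^sup>2 / 2) \<in> o[nhds 0](\<lambda>z. (norm z)\<^sup>2)" .
  have 2: "(\<lambda>z. \<psi>1 * (h z - b \<bullet> z - (z \<bullet> A z) / 2)) \<in> o[nhds 0](\<lambda>z. (norm z)\<^sup>2)"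
    using A(3) by (cases "\<psi>1 = 0") (auto simp: h_def)
  have "(\<lambda>z. h z + b \<bullet> z) \<in> O[nhds 0](\<lambda>z. norm z)"
    using hO(1) inner_bigo by (rule sum_in_bigo)
  from landau_o.big.mult[OF hO(2) this]
  have "(\<lambda>z. (h z)\<^sup>2 - (b \<bullet> z)\<^sup>2) \<in> O[nhds 0](\<lambda>z. (norm z)\<^sup>2 * norm z)"
    by (simp add: power2_eq_square algebra_simps)
  also have "(\<lambda>z::'a. (norm z)\<^sup>2 * norm z) \<in> o[nhds 0](\<lambda>z. (norm z)\<^sup>2)"
  proof (rule landau_o.smallI)
    fix c :: real assume c: "c > 0"
    have "\<forall>\<^sub>F z in nhds (0::'a). norm z < c"
      using c eventually_nhds_metric[of "\<lambda>z. norm z < c" "0::'a"] by (auto simp: dist_norm)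
    then show "\<forall>\<^sub>F z in nhds (0::'a). norm ((norm z)\<^sup>2 * norm z) \<le> c * norm ((norm z)\<^sup>2)"
      by eventually_elim (simp add: mult.commute mult_right_mono)
  qed
  finally have 3: "(\<lambda>z. \<psi>2 / 2 * ((h z)\<^sup>2 - (b \<bullet> z)\<^sup>2)) \<in> o[nhds 0](\<lambda>z. (norm z)\<^sup>2)"
    by (cases "\<psi>2 = 0") auto
  show ?thesis
  proof (rule jetI[where A = "\<lambda>z. \<psi>1 *\<^sub>R A z + (\<psi>2 * (b \<bullet> z)) *\<^sub>R b"])
    show "linear (\<lambda>z. \<psi>1 *\<^sub>R A z + (\<psi>2 * (b \<bullet> z)) *\<^sub>R b)"
      using A(1) by (intro linear_compose_add linear_compose_scale_right)
        (auto intro!: linearI simp: inner_add_right algebra_simps)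
    have "(\<Sum>i\<in>Basis. \<psi>2 * ((b \<bullet> i) * (b \<bullet> i))) = \<psi>2 * (b \<bullet> b)"
      by (simp add: euclidean_inner[of b b] sum_distrib_left)
    then show "(\<Sum>i\<in>Basis. i \<bullet> (\<psi>1 *\<^sub>R A i + (\<psi>2 * (b \<bullet> i)) *\<^sub>R b)) = \<psi>1 * l + \<psi>2 * (b \<bullet> b)"
      by (simp add: A(2)[symmetric] inner_add_right sum.distrib sum_distrib_left inner_commute mult.assoc)
    have eq: "\<psi> (f (x + z)) - \<psi> (f x) - (\<psi>1 *\<^sub>R b) \<bullet> z -
        (z \<bullet> (\<psi>1 *\<^sub>R A z + (\<psi>2 * (b \<bullet> z)) *\<^sub>R b)) / 2 =
        (\<psi> (f x + h z) - \<psi> (f x) - \<psi>1 * h z - \<psi>2 * (h z)\<^sup>2 / 2)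
        + \<psi>1 * (h z - b \<bullet> z - (z \<bullet> A z) / 2) + \<psi>2 / 2 * ((h z)\<^sup>2 - (b \<bullet> z)\<^sup>2)" for z
      by (simp add: h_def inner_add_right inner_commute[of z b] field_simps power2_eq_square)
    show "(\<lambda>z. \<psi> (f (x + z)) - \<psi> (f x) - (\<psi>1 *\<^sub>R b) \<bullet> z -
        (z \<bullet> (\<psi>1 *\<^sub>R A z + (\<psi>2 * (b \<bullet> z)) *\<^sub>R b)) / 2) \<in> o[nhds 0](\<lambda>z. (norm z)\<^sup>2)"
      unfolding eq by (intro sum_in_smallo 1 2 3)
  qed
qed

lemma jet_weaken: "jet f x b l \<Longrightarrow> b = b' \<Longrightarrow> l = l' \<Longrightarrow> jet f x b' l'"
  by simp

text \<open>\<open>G\<close> is differentiated at the single point \<open>x\<close>. The remainder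
  is therefore restricted to the segment from \<open>x\<close> to \<open>x + z\<close>, where the
  mean value theorem turns it into the first-order remainder of \<open>G\<close> at
  \<open>t *\<^sub>R z\<close>, paired with \<open>z\<close>.\<close>

lemma jet_taylor:
  fixes f :: "'a::euclidean_space \<Rightarrow> real"
  assumes f: "\<forall>\<^sub>F y in nhds x. GDERIV f y :> G y" and G: "(G has_derivative A) (at x)"
  shows "jet f x (G x) (\<Sum>i\<in>Basis. i \<bullet> A i)"
proof (rule jetI[where A = A])
  show "(\<Sum>i\<in>Basis. i \<bullet> A i) = (\<Sum>i\<in>Basis. i \<bullet> A i)" by simp
  show lin: "linear A" using G by (rule has_derivative_linear)
  show "(\<lambda>z. f (x + z) - f x - G x \<bullet> z - (z \<bullet> A z) / 2) \<in> o[nhds 0](\<lambda>z. (norm z)\<^sup>2)"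
  proof (rule landau_o.smallI)
    fix c :: real assume c: "c > 0"
    obtain d1 where d1: "d1 > 0" "\<And>y. dist y x < d1 \<Longrightarrow> GDERIV f y :> G y"
      using f by (auto simp: eventually_nhds_metric)
    obtain d2 where d2: "d2 > 0" "\<And>y. norm (y - x) < d2 \<Longrightarrow> norm (G y - G x - A (y - x)) \<le> c * norm (y - x)"
      using G c by (metis has_derivative_at_alt)
    have "norm (f (x + z) - f x - G x \<bullet> z - (z \<bullet> A z) / 2) \<le> c * norm ((norm z)\<^sup>2)"
      if z: "norm z < min d1 d2" for z
    proof -
      define \<phi> where "\<phi> t = f (x + t *\<^sub>R z) - t * (G x \<bullet> z) - t\<^sup>2 * (z \<bullet> A z) / 2" for t
      define \<phi>' where "\<phi>' t = (G (x + t *\<^sub>R z) - G x - A (t *\<^sub>R z)) \<bullet> z" for t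
      have small: "norm (t *\<^sub>R z) \<le> norm z" if "t \<in> {0..1}" for t
        using that by (simp add: mult_left_le_one_le)
      have D: "(\<phi> has_real_derivative \<phi>' t) (at t)" if t: "t \<in> {0..1}" for t
      proof -
        have "dist (x + t *\<^sub>R z) x < d1" using small[OF t] z by (simp add: dist_norm)
        then have "(f has_derivative (\<lambda>h. h \<bullet> G (x + t *\<^sub>R z))) (at (x + t *\<^sub>R z))"
          using d1(2) by (simp add: gderiv_def)
        moreover have "((\<lambda>t. x + t *\<^sub>R z) has_derivative (\<lambda>s. s *\<^sub>R z)) (at t)"
          by (auto intro!: derivative_eq_intros)
        ultimately have "((\<lambda>t. f (x + t *\<^sub>R z)) has_derivative (\<lambda>s. (s *\<^sub>R z) \<bullet> G (x + t *\<^sub>R z))) (at t)"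
          by (rule has_derivative_compose[rotated])
        then have "((\<lambda>t. f (x + t *\<^sub>R z)) has_real_derivative (z \<bullet> G (x + t *\<^sub>R z))) (at t)"
          by (simp add: has_field_derivative_def mult_commute_abs)
        then show ?thesis unfolding \<phi>_def \<phi>'_def
          by (auto intro!: derivative_eq_intros simp: linear_cmul[OF lin] inner_diff_left inner_commute algebra_simps)
      qed
      have "\<exists>t>0. t < 1 \<and> \<phi> 1 - \<phi> 0 = (1 - 0) * \<phi>' t"
        using MVT2[of 0 1 \<phi> \<phi>'] D by auto
      then obtain t where t: "0 < t" "t < 1" "\<phi> 1 - \<phi> 0 = \<phi>' t" by auto
      have tz: "norm (t *\<^sub>R z) \<le> norm z" using small[of t] t by simp
      have "\<bar>\<phi>' t\<bar> \<le> norm (G (x + t *\<^sub>R z) - G x - A (t *\<^sub>R z)) * norm z"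
        unfolding \<phi>'_def by (rule Cauchy_Schwarz_ineq2)
      also have "\<dots> \<le> (c * norm (t *\<^sub>R z)) * norm z"
        using d2(2)[of "x + t *\<^sub>R z"] tz z by (intro mult_right_mono) auto
      also have "\<dots> \<le> (c * norm z) * norm z"
        using tz c by (intro mult_right_mono mult_left_mono) auto
      finally show ?thesis using t(3) by (simp add: \<phi>_def power2_eq_square algebra_simps)
    qed
    moreover have "\<forall>\<^sub>F z in nhds (0::'a). norm z < min d1 d2"
      using d1 d2 eventually_nhds_metric[of "\<lambda>z. norm z < min d1 d2" "0::'a"] by (auto simp: dist_norm intro!: exI[of _ "min d1 d2"])
    ultimately show "\<forall>\<^sub>F z in nhds 0. norm (f (x + z) - f x - G x \<bullet> z - (z \<bullet> A z) / 2) \<le> c * norm ((norm z)\<^sup>2)"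
      by (auto elim: eventually_mono)
  qed
qed

lemma jet_real_taylor:
  fixes f :: "real \<Rightarrow> real"
  assumes "\<forall>\<^sub>F y in nhds x. (f has_real_derivative f' y) (at y)" "(f' has_real_derivative f2) (at x)"
  shows "jet f x (f' x) f2"
proof -
  have "jet f x (f' x) (\<Sum>i\<in>Basis. i \<bullet> (f2 * i))"
    using assms
    by (intro jet_taylor) (auto simp: gderiv_def has_field_derivative_def mult_commute_abs elim!: eventually_mono)
  then show ?thesis by simp
qed

lemma GDERIV_partial_deriv:
  assumes "f differentiable (at x)"
  shows "GDERIV f x :> (\<Sum>b\<in>Basis. partial_deriv b f x *\<^sub>R b)"
proof -
  have D: "(f has_derivative frechet_derivative f (at x)) (at x)"
    using assms by (simp add: frechet_derivative_works)
  then have lin: "linear (frechet_derivative f (at x))" by (rule has_derivative_linear)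
  have "frechet_derivative f (at x) h = h \<bullet> (\<Sum>b\<in>Basis. partial_deriv b f x *\<^sub>R b)" for h
  proof -
    have "frechet_derivative f (at x) h = frechet_derivative f (at x) (\<Sum>b\<in>Basis. (h \<bullet> b) *\<^sub>R b)"
      by (simp add: euclidean_representation)
    also have "\<dots> = (\<Sum>b\<in>Basis. (h \<bullet> b) * partial_deriv b f x)"
      by (simp add: linear_sum[OF lin] linear_cmul[OF lin] partial_deriv_def)
    finally show ?thesis by (simp add: inner_sum_right mult.commute)
  qed
  then have "frechet_derivative f (at x) = (\<lambda>h. h \<bullet> (\<Sum>b\<in>Basis. partial_deriv b f x *\<^sub>R b))" by blast
  with D show ?thesis by (simp add: gderiv_def)
qed

lemma gradient_eq:
  assumes "GDERIV f x :> g"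
  shows "gradient f x = g"
proof -
  have "g' = g" if "GDERIV f x :> g'" for g'
  proof -
    have "(\<lambda>h. h \<bullet> g') = (\<lambda>h. h \<bullet> g)"
      using that assms unfolding gderiv_def by (rule has_derivative_unique)
    then have "h \<bullet> g' = h \<bullet> g" for h by meson
    then show ?thesis using vector_eq_ldot by blast
  qed
  with assms show ?thesis unfolding gradient_def by blast
qed

lemma C2_on_jet:
  assumes "C2_on S f" "open S" "x \<in> S"
  shows "jet f x (gradient f x) (laplacian f x)"
proof -
  define G where "G y = (\<Sum>b\<in>Basis. partial_deriv b f y *\<^sub>R b)" for y
  define A where "A h = (\<Sum>b\<in>Basis. frechet_derivative (partial_deriv b f) (at x) h *\<^sub>R b)" for h
  have G: "GDERIV f y :> G y" if "y \<in> S" for y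
    using assms(1) that GDERIV_partial_deriv unfolding G_def C2_on_def C1_on_def by blast
  have "(G has_derivative A) (at x)"
  proof -
    have "(partial_deriv b f has_derivative frechet_derivative (partial_deriv b f) (at x)) (at x)" if "b \<in> Basis" for b
      using assms that unfolding C2_on_def C1_on_def by (metis frechet_derivative_works)
    then show ?thesis unfolding G_def A_def
      by (intro has_derivative_sum has_derivative_scaleR_left) auto
  qed
  moreover have "\<forall>\<^sub>F y in nhds x. GDERIV f y :> G y"
    using eventually_nhds_in_open[OF assms(2,3)] G by (auto elim: eventually_mono)
  ultimately have "jet f x (G x) (\<Sum>i\<in>Basis. i \<bullet> A i)" by (intro jet_taylor)
  moreover have "gradient f x = G x" using G assms(3) by (intro gradient_eq)
  moreover have "(\<Sum>i\<in>Basis. i \<bullet> A i) = laplacian f x"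
    unfolding laplacian_def
  proof (rule sum.cong[OF refl])
    fix i :: 'a assume i: "i \<in> Basis"
    then show "i \<bullet> A i = partial_deriv i (partial_deriv i f) x"
      by (simp add: A_def inner_sum_right inner_Basis if_distrib sum.delta' partial_deriv_def cong: if_cong)
  qed
  ultimately show ?thesis by simp
qed

lemma C2_on_continuous: "C2_on S f \<Longrightarrow> continuous_on S f"
  unfolding C2_on_def C1_on_def
  by (meson continuous_at_imp_continuous_on differentiable_imp_continuous_within)

lemma jet_power2: "jet f x b l \<Longrightarrow> jet (\<lambda>y. (f y)\<^sup>2) x ((2 * f x) *\<^sub>R b) (2 * f x * l + 2 * (b \<bullet> b))"
proof (erule jet_compose)
  show "jet (\<lambda>t. t\<^sup>2) (f x) (2 * f x) (2::real)"
    by (rule jet_real_taylor[where f' = "\<lambda>t. 2 * t"])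
       (auto intro!: derivative_eq_intros always_eventually)
qed

text \<open>Polarisation, \<open>f g = ((f + g)\<^sup>2 - f\<^sup>2 - g\<^sup>2) / 2\<close>,
  reduces the product rule to the chain rule for the square.\<close>

lemma jet_mult:
  assumes f: "jet f x b l" and g: "jet g x c m"
  shows "jet (\<lambda>y. f y * g y) x (f x *\<^sub>R c + g x *\<^sub>R b) (f x * m + g x * l + 2 * (b \<bullet> c))"
proof -
  have "jet (\<lambda>y. 1/2 * (f y + g y)\<^sup>2 + ((-1/2) * (f y)\<^sup>2 + (-1/2) * (g y)\<^sup>2)) x
    ((1/2) *\<^sub>R ((2 * (f x + g x)) *\<^sub>R (b + c)) + ((-1/2) *\<^sub>R ((2 * f x) *\<^sub>R b) + (-1/2) *\<^sub>R ((2 * g x) *\<^sub>R c)))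
    (1/2 * (2 * (f x + g x) * (l + m) + 2 * ((b + c) \<bullet> (b + c))) +
     ((-1/2) * (2 * f x * l + 2 * (b \<bullet> b)) + (-1/2) * (2 * g x * m + 2 * (c \<bullet> c))))"
    by (intro jet_add[OF jet_scale jet_add] jet_scale jet_power2 jet_add f g)
  also have "(\<lambda>y. 1/2 * (f y + g y)\<^sup>2 + ((-1/2) * (f y)\<^sup>2 + (-1/2) * (g y)\<^sup>2)) = (\<lambda>y. f y * g y)"
    by (auto simp: power2_eq_square field_simps)
  finally show ?thesis
    by (rule jet_weaken)
       (simp_all add: algebra_simps inner_add_left inner_add_right inner_commute)
qed

lemma eventually_nhds_shift:
  "(\<forall>\<^sub>F y in nhds x. P (y - x)) \<longleftrightarrow> (\<forall>\<^sub>F z in nhds (0::'a::real_normed_vector). P z)"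
proof -
  have "filtermap (\<lambda>y. y - x) (nhds x) = nhds (0::'a)"
    using filtermap_nhds_shift[of x x] by simp
  then show ?thesis by (metis eventually_filtermap)
qed

section \<open>Viscosity sub- and supersolutions\<close>

text \<open>Subharmonicity in the viscosity sense: at every contact point, a function that touches
  \<open>w\<close> from above has nonnegative Laplacian.\<close>

definition visc_sub :: "('a::euclidean_space \<Rightarrow> real) \<Rightarrow> 'a \<Rightarrow> bool" where
  "visc_sub w x \<longleftrightarrow> (\<forall>\<phi> b l. jet \<phi> x b l \<longrightarrow> \<phi> x = w x \<longrightarrow> (\<forall>\<^sub>F y in nhds x. w y \<le> \<phi> y) \<longrightarrow> 0 \<le> l)"

text \<open>Existential where \<open>visc_sub\<close> is universal: a single touching function from
  above with nonpositive Laplacian is exhibited at each point, and it can be passed on as a test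
  function for the subharmonic side.\<close>

definition visc_super :: "('a::euclidean_space \<Rightarrow> real) \<Rightarrow> 'a \<Rightarrow> bool" where
  "visc_super F x \<longleftrightarrow> (\<exists>\<phi> b l. jet \<phi> x b l \<and> \<phi> x = F x \<and> (\<forall>\<^sub>F y in nhds x. F y \<le> \<phi> y) \<and> l \<le> 0)"

lemma visc_superI:
  "jet \<phi> x b l \<Longrightarrow> \<phi> x = F x \<Longrightarrow> \<forall>\<^sub>F y in nhds x. F y \<le> \<phi> y \<Longrightarrow> l \<le> 0 \<Longrightarrow> visc_super F x"
  unfolding visc_super_def by blast

lemma jet_upper_bound:
  assumes "jet f x b l" "e > 0"
  obtains A where "linear A" "(\<Sum>i\<in>Basis. i \<bullet> A i) = l"
    "\<forall>\<^sub>F y in nhds x. f y \<le> f x + b \<bullet> (y - x) + ((y - x) \<bullet> A (y - x)) / 2 + e * (norm (y - x))\<^sup>2"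
proof -
  obtain A where A: "linear A" "(\<Sum>i\<in>Basis. i \<bullet> A i) = l"
    "(\<lambda>z. f (x + z) - f x - b \<bullet> z - (z \<bullet> A z) / 2) \<in> o[nhds 0](\<lambda>z. (norm z)\<^sup>2)"
    using assms(1) by (rule jetE)
  have "\<forall>\<^sub>F z in nhds 0. norm (f (x + z) - f x - b \<bullet> z - (z \<bullet> A z) / 2) \<le> e * norm ((norm z)\<^sup>2)"
    using A(3) assms(2) by (rule landau_o.smallD)
  then have "\<forall>\<^sub>F y in nhds x. norm (f y - f x - b \<bullet> (y - x) - ((y - x) \<bullet> A (y - x)) / 2) \<le> e * norm ((norm (y - x))\<^sup>2)"
    by (simp flip: eventually_nhds_shift[of _ x])
  then have "\<forall>\<^sub>F y in nhds x. f y \<le> f x + b \<bullet> (y - x) + ((y - x) \<bullet> A (y - x)) / 2 + e * (norm (y - x))\<^sup>2"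
    by eventually_elim (simp add: abs_le_iff)
  with A(1,2) show ?thesis by (rule that)
qed

lemma quadratic_has_derivative:
  fixes B :: "'a::euclidean_space \<Rightarrow> 'a"
  assumes "linear B"
  shows "((\<lambda>y. c + b \<bullet> (y - x) + ((y - x) \<bullet> B (y - x)) / 2) has_derivative
     (\<lambda>h. b \<bullet> h + (h \<bullet> B (y - x) + (y - x) \<bullet> B h) / 2)) (at y)"
proof -
  have B: "bounded_linear B" using assms by (simp add: linear_conv_bounded_linear)
  have 1: "((\<lambda>y. B (y - x)) has_derivative (\<lambda>h. B h)) (at y)"
    by (rule bounded_linear.has_derivative[OF B]) (auto intro!: derivative_eq_intros)
  show ?thesis by (auto intro!: derivative_eq_intros 1)
qed

text \<open>Trace-free quadratic polynomials supply the harmonic majorants on small balls. As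
  \<open>B\<close> may be nonsymmetric, both \<open>i \<bullet> B j\<close> and
  \<open>j \<bullet> B i\<close> occur in the second derivatives.\<close>

lemma quadratic_harmonic:
  fixes B :: "'a::euclidean_space \<Rightarrow> 'a"
  assumes B: "linear B" and trace: "(\<Sum>i\<in>Basis. i \<bullet> B i) = 0"
  shows "harmonic_on S (\<lambda>y. c + b \<bullet> (y - x) + ((y - x) \<bullet> B (y - x)) / 2)" (is "harmonic_on S ?q")
proof -
  have p1: "partial_deriv i ?q = (\<lambda>y. b \<bullet> i + (i \<bullet> B (y - x) + (y - x) \<bullet> B i) / 2)" for i
    by (rule ext) (simp add: partial_deriv_def frechet_derivative_at[OF quadratic_has_derivative[OF B], symmetric])
  have blB: "bounded_linear B" using B by (simp add: linear_conv_bounded_linear)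
  have d2: "((\<lambda>y. b \<bullet> i + (i \<bullet> B (y - x) + (y - x) \<bullet> B i) / 2) has_derivative
      (\<lambda>h. (i \<bullet> B h + h \<bullet> B i) / 2)) (at y)" for i y
  proof -
    have 1: "((\<lambda>y. B (y - x)) has_derivative (\<lambda>h. B h)) (at y)"
      by (rule bounded_linear.has_derivative[OF blB]) (auto intro!: derivative_eq_intros)
    show ?thesis by (auto intro!: derivative_eq_intros 1)
  qed
  have p2: "partial_deriv j (\<lambda>y. b \<bullet> i + (i \<bullet> B (y - x) + (y - x) \<bullet> B i) / 2) = (\<lambda>y. (i \<bullet> B j + j \<bullet> B i) / 2)" for i j
    by (rule ext) (simp add: partial_deriv_def frechet_derivative_at[OF d2, symmetric])
  have cont: "continuous_on S (\<lambda>y. b \<bullet> i + (i \<bullet> B (y - x) + (y - x) \<bullet> B i) / 2)" for i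
    using d2 by (meson continuous_at_imp_continuous_on has_derivative_continuous)
  have "C2_on S ?q"
    unfolding C2_on_def C1_on_def p1 p2
    by (intro conjI ballI cont continuous_on_const differentiableI[OF quadratic_has_derivative[OF B]] differentiableI[OF d2])
  moreover have "laplacian ?q y = 0" for y
    unfolding laplacian_def p1 p2 using trace by simp
  ultimately show ?thesis by (simp add: harmonic_on_def)
qed

text \<open>If a function touching \<open>w\<close> from above had negative Laplacian, its Taylor polynomial plus a
  multiple of \<open>r\<^sup>2 - norm (y - x)\<^sup>2\<close> would be a harmonic majorant of \<open>w\<close> on a small sphere
  that lies below \<open>w\<close> at the centre.\<close>

lemma subharmonic_imp_visc_sub:
  fixes w :: "'a::euclidean_space \<Rightarrow> real"
  assumes "subharmonic_on S w" "open S" "x \<in> S"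
  shows "visc_sub w x"
  unfolding visc_sub_def
proof (intro allI impI, rule ccontr)
  fix \<phi> b l
  assume jet: "jet \<phi> x b l" and eq: "\<phi> x = w x" and ev: "\<forall>\<^sub>F y in nhds x. w y \<le> \<phi> y" and "\<not> 0 \<le> l"
  then have l: "l < 0" by simp
  define n where "n = real DIM('a)"
  have n: "n > 0" by (simp add: n_def)
  \<comment> \<open>Since \<open>l / n = - 4 * e\<close>, removing the trace of \<open>A\<close>
    gains \<open>2 * e * r\<^sup>2\<close> on the sphere of radius \<open>r\<close>. One half pays
    for the slack in the upper bound of \<open>\<phi>\<close>, the other half lowers the value at
    the centre.\<close>
  define e where "e = - l / (4 * n)"
  have e: "e > 0" using l n by (simp add: e_def field_simps)
  obtain A where A: "linear A" "(\<Sum>i\<in>Basis. i \<bullet> A i) = l"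
    "\<forall>\<^sub>F y in nhds x. \<phi> y \<le> \<phi> x + b \<bullet> (y - x) + ((y - x) \<bullet> A (y - x)) / 2 + e * (norm (y - x))\<^sup>2"
    using jet_upper_bound[OF jet e] .
  have "\<forall>\<^sub>F y in nhds x. y \<in> S \<and> w y \<le> \<phi> x + b \<bullet> (y - x) + ((y - x) \<bullet> A (y - x)) / 2 + e * (norm (y - x))\<^sup>2"
    using eventually_nhds_in_open[OF assms(2,3)] ev A(3) by eventually_elim auto
  then obtain r' where r': "r' > 0"
    "\<And>y. dist y x < r' \<Longrightarrow> y \<in> S \<and> w y \<le> \<phi> x + b \<bullet> (y - x) + ((y - x) \<bullet> A (y - x)) / 2 + e * (norm (y - x))\<^sup>2"
    by (auto simp: eventually_nhds_metric)
  define r where "r = r' / 2"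
  have r: "r > 0" "r < r'" using r' by (auto simp: r_def)
  define B where "B z = A z - (l / n) *\<^sub>R z" for z
  define h where "h y = (\<phi> x - e * r\<^sup>2) + b \<bullet> (y - x) + ((y - x) \<bullet> B (y - x)) / 2" for y
  have B: "linear B" unfolding B_def using A(1)
    by (intro linear_compose_sub linear_compose_scale_right) (auto simp: linear_iff)
  have "(\<Sum>i\<in>Basis. i \<bullet> B i) = l - (\<Sum>i::'a\<in>Basis. l / n)"
    using A(2) by (simp add: B_def inner_diff_right sum_subtractf)
  also have "\<dots> = 0" using n by (simp add: n_def)
  finally have trace: "(\<Sum>i\<in>Basis. i \<bullet> B i) = 0" .
  have harm: "harmonic_on T h" for T
    unfolding h_def using B trace by (rule quadratic_harmonic)
  have "cball x r \<subseteq> S" using r r' by (auto simp: dist_commute)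
  moreover have "continuous_on (cball x r) h"
    using harm[of "cball x r"] by (auto simp: harmonic_on_def intro: C2_on_continuous)
  moreover have "w y \<le> h y" if "y \<in> sphere x r" for y
  proof -
    have d: "norm (y - x) = r" using that by (simp add: dist_norm norm_minus_commute)
    have "w y \<le> \<phi> x + b \<bullet> (y - x) + ((y - x) \<bullet> A (y - x)) / 2 + e * (norm (y - x))\<^sup>2"
      using r'(2)[of y] d r by (simp add: dist_norm)
    also have "\<dots> = h y"
    proof -
      have "(y - x) \<bullet> B (y - x) = (y - x) \<bullet> A (y - x) - l / n * r\<^sup>2"
        unfolding B_def by (subst inner_diff_right) (simp add: dot_square_norm d)
      moreover have "l / n = - 4 * e" using n by (simp add: e_def)
      ultimately have "(y - x) \<bullet> B (y - x) = (y - x) \<bullet> A (y - x) + 4 * e * r\<^sup>2" by simp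
      then show ?thesis unfolding h_def d by (simp add: field_simps)
    qed
    finally show ?thesis .
  qed
  ultimately have "\<forall>y\<in>ball x r. w y \<le> h y"
    using assms(1) r(1) harm[of "ball x r"] unfolding subharmonic_on_def by blast
  then have "w x \<le> h x" using r by auto
  also have "h x < w x" using eq e r by (simp add: h_def linear_0[OF B])
  finally show False by simp
qed

text \<open>If \<open>w\<close> exceeded \<open>F\<close> at \<open>a\<close>, adding a small
  multiple of \<open>(norm y)\<^sup>2\<close> to \<open>w - F\<close> would still leave the maximum
  in the interior: the term is at most half of the gap. At the maximum point, the function touching
  \<open>F\<close>, minus this term and up to a constant, touches \<open>w\<close> from above with
  strictly negative Laplacian.\<close>

lemma visc_comparison:
  fixes w F :: "'a::euclidean_space \<Rightarrow> real"
  assumes U: "open U" "bounded U"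
    and w: "continuous_on (closure U) w" "\<And>x. x \<in> U \<Longrightarrow> visc_sub w x"
    and F: "continuous_on (closure U) F" "\<And>x. x \<in> U \<Longrightarrow> visc_super F x"
    and le: "\<And>x. x \<in> frontier U \<Longrightarrow> w x \<le> F x"
    and "a \<in> U"
  shows "w a \<le> F a"
proof (rule ccontr)
  assume "\<not> w a \<le> F a"
  then have gap: "w a - F a > 0" by simp
  obtain M where M: "M > 0" "\<And>x. x \<in> closure U \<Longrightarrow> norm x \<le> M"
    using bounded_closure[OF U(2)] by (auto simp: bounded_pos)
  define e where "e = (w a - F a) / (2 * M\<^sup>2)"
  have e: "e > 0" "e * M\<^sup>2 < w a - F a" using gap M(1) by (simp_all add: e_def field_simps)
  define k where "k y = w y - F y + e * (norm y)\<^sup>2" for y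
  have "compact (closure U)" using U(2) by (simp add: compact_closure)
  moreover have "closure U \<noteq> {}" using \<open>a \<in> U\<close> closure_subset by blast
  moreover have "continuous_on (closure U) k"
    unfolding k_def by (intro continuous_intros w F)
  ultimately obtain x where x: "x \<in> closure U" "\<And>y. y \<in> closure U \<Longrightarrow> k y \<le> k x"
    using continuous_attains_sup by metis
  have xU: "x \<in> U"
  proof (rule ccontr)
    assume "x \<notin> U"
    then have "x \<in> frontier U" using x(1) U(1) by (simp add: frontier_def interior_open)
    then have "k x \<le> e * (norm x)\<^sup>2" using le by (force simp: k_def)
    also have "\<dots> \<le> e * M\<^sup>2" using M x(1) e by (intro mult_left_mono power_mono) auto
    also have "\<dots> < w a - F a" by (rule e)
    also have "\<dots> \<le> k a" using e by (simp add: k_def)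
    also have "\<dots> \<le> k x" using x(2) \<open>a \<in> U\<close> closure_subset by blast
    finally show False by simp
  qed
  obtain \<phi> b l where \<phi>: "jet \<phi> x b l" "\<phi> x = F x" "\<forall>\<^sub>F y in nhds x. F y \<le> \<phi> y" "l \<le> 0"
    using F(2)[OF xU] unfolding visc_super_def by blast
  have "jet (\<lambda>y::'a. (norm y)\<^sup>2) x (2 *\<^sub>R x) (\<Sum>i\<in>Basis. i \<bullet> (2 *\<^sub>R i :: 'a))"
    by (rule jet_taylor[where G = "\<lambda>y. 2 *\<^sub>R y"])
       (auto intro!: always_eventually derivative_eq_intros simp: gderiv_def power2_norm_eq_inner inner_commute algebra_simps)
  then have "jet (\<lambda>y::'a. (norm y)\<^sup>2) x (2 *\<^sub>R x) (2 * real DIM('a))"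
    by (simp add: sum_distrib_left[symmetric] mult.commute)
  then have "jet (\<lambda>y. (\<phi> y + (- e) * (norm y)\<^sup>2) + k x) x ((b + (-e) *\<^sub>R (2 *\<^sub>R x)) + 0) ((l + (-e) * (2 * real DIM('a))) + 0)"
    by (intro jet_add jet_scale jet_const \<phi>)
  moreover have "(\<phi> x + (- e) * (norm x)\<^sup>2) + k x = w x" by (simp add: k_def \<phi>)
  moreover have "\<forall>\<^sub>F y in nhds x. w y \<le> (\<phi> y + (- e) * (norm y)\<^sup>2) + k x"
    using \<phi>(3) eventually_nhds_in_open[OF U(1) xU]
  proof eventually_elim
    case (elim y)
    then show ?case using x(2)[of y] closure_subset[of U] by (auto simp: k_def)
  qed
  ultimately have "0 \<le> (l + (-e) * (2 * real DIM('a))) + 0"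
    using w(2)[OF xU] unfolding visc_sub_def by blast
  moreover have "e * (2 * real DIM('a)) > 0" using e by simp
  ultimately show False using \<phi>(4) by simp
qed

text \<open>For a small step along \<open>- b\<close> the linear term dominates, so
  \<open>b = 0\<close>; then the quadratic form is nonnegative in every direction, and so is its
  trace. Applied at zeros of the nonnegative functions \<open>u\<close> and \<open>v\<close>, where
  the bounds on \<open>u\<close> and \<open>v\<close> times their Laplacians say nothing about the
  Laplacians.\<close>

lemma jet_local_min:
  assumes "jet f x b l" "\<forall>\<^sub>F y in nhds x. f x \<le> f y"
  shows "b = 0" "0 \<le> l"
proof -
  obtain A where A: "linear A" "(\<Sum>i\<in>Basis. i \<bullet> A i) = l"
    "(\<lambda>z. f (x + z) - f x - b \<bullet> z - (z \<bullet> A z) / 2) \<in> o[nhds 0](\<lambda>z. (norm z)\<^sup>2)"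
    using assms(1) by (rule jetE)
  have key: "0 \<le> t * (b \<bullet> v) + t\<^sup>2 * ((v \<bullet> A v) / 2 + e * (norm v)\<^sup>2)" if "\<bar>t\<bar> * norm v < r"
      and r: "\<And>y. dist y x < r \<Longrightarrow> f x \<le> f y \<and> f y \<le> f x + b \<bullet> (y - x) + ((y - x) \<bullet> A (y - x)) / 2 + e * (norm (y - x))\<^sup>2"
    for t v r e
  proof -
    have "(norm (t *\<^sub>R v))\<^sup>2 = t\<^sup>2 * (norm v)\<^sup>2" by (simp add: power_mult_distrib)
    moreover have "(t *\<^sub>R v) \<bullet> A (t *\<^sub>R v) = t\<^sup>2 * (v \<bullet> A v)"
      by (simp add: linear_cmul[OF A(1)] power2_eq_square)
    ultimately show ?thesis
      using r[of "x + t *\<^sub>R v"] that(1) by (simp add: dist_norm algebra_simps)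
  qed
  have ex: "\<exists>r>0. \<forall>y. dist y x < r \<longrightarrow> f x \<le> f y \<and> f y \<le> f x + b \<bullet> (y - x) + ((y - x) \<bullet> A (y - x)) / 2 + e * (norm (y - x))\<^sup>2"
    if "e > 0" for e
  proof -
    have "\<forall>\<^sub>F z in nhds 0. norm (f (x + z) - f x - b \<bullet> z - (z \<bullet> A z) / 2) \<le> e * norm ((norm z)\<^sup>2)"
      using A(3) that by (rule landau_o.smallD)
    then have "\<forall>\<^sub>F y in nhds x. norm (f y - f x - b \<bullet> (y - x) - ((y - x) \<bullet> A (y - x)) / 2) \<le> e * norm ((norm (y - x))\<^sup>2)"
      by (simp flip: eventually_nhds_shift[of _ x])
    with assms(2) have "\<forall>\<^sub>F y in nhds x. f x \<le> f y \<and> f y \<le> f x + b \<bullet> (y - x) + ((y - x) \<bullet> A (y - x)) / 2 + e * (norm (y - x))\<^sup>2"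
      by eventually_elim (simp add: abs_le_iff)
    then show ?thesis by (simp add: eventually_nhds_metric)
  qed
  show b: "b = 0"
  proof (rule ccontr)
    assume "b \<noteq> 0"
    obtain r where r: "r > 0" "\<And>y. dist y x < r \<Longrightarrow> f x \<le> f y \<and> f y \<le> f x + b \<bullet> (y - x) + ((y - x) \<bullet> A (y - x)) / 2 + 1 * (norm (y - x))\<^sup>2"
      using ex[of 1] by auto
    define K where "K = \<bar>(b \<bullet> A b) / 2 + (norm b)\<^sup>2\<bar> + 1"
    \<comment> \<open>The first bound keeps the point \<open>x - t *\<^sub>R b\<close> in the ball,
      the second makes the quadratic term at most half of the linear one.\<close>
    define t where "t = min (r / (2 * norm b)) ((norm b)\<^sup>2 / (2 * K))"
    have K: "K > 0" by (simp add: K_def)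
    have t: "t > 0" "t \<le> r / (2 * norm b)" "t \<le> (norm b)\<^sup>2 / (2 * K)"
      using \<open>b \<noteq> 0\<close> r(1) K by (auto simp: t_def)
    have "\<bar>-t\<bar> * norm b < r"
    proof -
      have "t * norm b \<le> r / 2" using t(2) \<open>b \<noteq> 0\<close> by (simp add: field_simps)
      then show ?thesis using t(1) r(1) by simp
    qed
    from key[OF this r(2)] have "0 \<le> t * (t * ((b \<bullet> A b) / 2 + (norm b)\<^sup>2) - (norm b)\<^sup>2)"
      by (simp add: power2_eq_square dot_square_norm algebra_simps)
    then have "(norm b)\<^sup>2 \<le> t * ((b \<bullet> A b) / 2 + (norm b)\<^sup>2)"
      using t(1) by (simp add: zero_le_mult_iff)
    also have "\<dots> \<le> t * K" using t(1) by (intro mult_left_mono) (auto simp: K_def)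
    also have "\<dots> \<le> (norm b)\<^sup>2 / 2" using t(3) K by (simp add: field_simps)
    finally show False using \<open>b \<noteq> 0\<close> by simp
  qed
  have "0 \<le> v \<bullet> A v" for v
  proof (rule ccontr)
    assume neg: "\<not> 0 \<le> v \<bullet> A v"
    then have "v \<noteq> 0" by auto
    define e where "e = - (v \<bullet> A v) / (4 * (norm v)\<^sup>2)"
    have e: "e > 0" using neg \<open>v \<noteq> 0\<close> by (simp add: e_def field_simps)
    obtain r where r: "r > 0" "\<And>y. dist y x < r \<Longrightarrow> f x \<le> f y \<and> f y \<le> f x + b \<bullet> (y - x) + ((y - x) \<bullet> A (y - x)) / 2 + e * (norm (y - x))\<^sup>2"
      using ex[OF e] by auto
    define t where "t = r / (2 * norm v)"
    have t: "t > 0" "\<bar>t\<bar> * norm v < r" using r(1) \<open>v \<noteq> 0\<close> by (auto simp: t_def)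
    have "0 \<le> t\<^sup>2 * ((v \<bullet> A v) / 2 + e * (norm v)\<^sup>2)"
      using key[OF t(2) r(2)] b by simp
    then have "0 \<le> (v \<bullet> A v) / 2 + e * (norm v)\<^sup>2"
      using t(1) by (simp add: zero_le_mult_iff)
    also have "\<dots> = (v \<bullet> A v) / 4" using \<open>v \<noteq> 0\<close> by (simp add: e_def)
    finally show False using neg by simp
  qed
  then show "0 \<le> l" using A(2) by (metis sum_nonneg)
qed

text \<open>This is the minimum principle for harmonic functions, itself a case of the comparison: a
  harmonic function touches itself from above with Laplacian \<open>0\<close>. It supplies members
  of the Perron family.\<close>

lemma const_subharmonic: "subharmonic_on (S :: 'a::euclidean_space set) (\<lambda>_. c)"
  unfolding subharmonic_on_def
proof (intro conjI allI impI ballI)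
  fix y :: 'a and r h x
  assume r: "0 < r" and h: "continuous_on (cball y r) h" "harmonic_on (ball y r) h"
    "\<forall>x\<in>sphere y r. c \<le> h x" and x: "x \<in> ball y r"
  show "c \<le> h x"
  proof (rule visc_comparison[where U = "ball y r" and w = "\<lambda>_. c" and F = h and a = x])
    show "visc_sub (\<lambda>_. c) z" for z :: 'a
      unfolding visc_sub_def
    proof (intro allI impI)
      fix \<phi> b l
      assume "jet \<phi> z b l" "\<phi> z = c" "\<forall>\<^sub>F y in nhds z. c \<le> \<phi> y"
      then show "0 \<le> l" using jet_local_min(2)[of \<phi> z b l] by simp
    qed
    show "visc_super h z" if "z \<in> ball y r" for z
      using C2_on_jet[of "ball y r" h z] h(2) that
      by (intro visc_superI[of h z "gradient h z" 0]) (auto simp: harmonic_on_def)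
  qed (use r h x in auto)
qed auto

text \<open>A real supremum inherits an upper bound only if the family is nonempty; a constant below
  the minimum of \<open>F\<close> on the compact frontier is a member. Each member is handled by the
  comparison.\<close>

lemma perron_solution_le:
  fixes F :: "'a::euclidean_space \<Rightarrow> real"
  assumes U: "open U" "bounded U" "a \<in> U"
    and F: "continuous_on (closure U) F" "\<And>x. x \<in> U \<Longrightarrow> visc_super F x"
  shows "perron_solution U F a \<le> F a"
  unfolding perron_solution_def
proof (rule cSup_least)
  have "compact (F ` frontier U)"
    using F(1) U(2) by (intro compact_continuous_image compact_frontier_bounded)
      (auto simp: frontier_def elim: continuous_on_subset)
  then obtain B where "\<And>x. x \<in> frontier U \<Longrightarrow> \<bar>F x\<bar> \<le> B"
    by (metis bounded_real compact_imp_bounded imageI)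
  then have "\<And>x. x \<in> frontier U \<Longrightarrow> - B \<le> F x" by (metis abs_le_D2 minus_le_iff)
  then show "{w a |w. continuous_on (closure U) w \<and> subharmonic_on U w \<and> (\<forall>x\<in>frontier U. w x \<le> F x)} \<noteq> {}"
    using const_subharmonic[of U "- B"] by (auto intro!: exI[of _ "\<lambda>_. - B"])
  fix t assume "t \<in> {w a |w. continuous_on (closure U) w \<and> subharmonic_on U w \<and> (\<forall>x\<in>frontier U. w x \<le> F x)}"
  then obtain w where w: "t = w a" "continuous_on (closure U) w" "subharmonic_on U w" "\<And>x. x \<in> frontier U \<Longrightarrow> w x \<le> F x"
    by blast
  show "t \<le> F a"
    unfolding w(1)
    by (rule visc_comparison[OF U(1,2) w(2) subharmonic_imp_visc_sub[OF w(3) U(1)] F w(4) U(3)])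
qed

section \<open>The differential equation\<close>

locale bessel_ode =
  fixes p d :: real
  assumes d_gt_1: "d > 1" and p_pos: "p > 0" and pd: "p + d > 2"
begin

lemma g_coeff_rec:
  "2 * (real m + 1) * (real m + d - 1) * g_coeff p d (Suc m) =
   (real m * (real m - 1) + 2 * (d - 1) * real m - p * (d - 1)) * g_coeff p d m"
proof -
  define r where "r k = (real k * (real k - 1) + 2 * (d - 1) * real k - p * (d - 1)) /
                    (2 * (real k + 1) * (real k + d - 1))" for k
  have "g_coeff p d (Suc m) = r m * g_coeff p d m"
  proof (cases m)
    case (Suc n)
    have "g_coeff p d (Suc m) = - (\<Prod>k=0..Suc n. r k)" using Suc by (simp add: r_def)
    also have "\<dots> = r m * g_coeff p d m" using Suc by (simp add: r_def)
    finally show ?thesis .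
  qed (simp add: r_def)
  moreover have "2 * (real m + 1) * (real m + d - 1) \<noteq> 0" using d_gt_1 by (simp add: add_pos_nonneg)
  ultimately show ?thesis by (simp add: r_def)
qed

text \<open>The ratio of consecutive coefficients is at most \<open>1/2 + K / (2 * (n + 1))\<close>
  in modulus, so the series converges up to radius \<open>2\<close>, the distance from
  \<open>-1\<close> to the singular point \<open>1\<close>. The ratio test uses \<open>c\<close>,
  the midpoint of \<open>\<bar>x\<bar> / 2\<close> and \<open>1\<close>.\<close>

lemma g_coeff_summable:
  assumes x: "norm (x::real) < 2"
  shows "summable (\<lambda>m. g_coeff p d m * x ^ m)"
proof -
  define K where "K = \<bar>d - 3\<bar> + (p + 1)"
  define c where "c = (\<bar>x\<bar> / 2 + 1) / 2"
  have c: "\<bar>x\<bar> / 2 < c" "c < 1" using x by (auto simp: c_def)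
  have K: "K > 0" using p_pos by (simp add: K_def add_nonneg_pos)
  obtain N :: nat where N: "K / (c - \<bar>x\<bar> / 2) < real N" using reals_Archimedean2 by blast
  have "norm (g_coeff p d (Suc n) * x ^ Suc n) \<le> c * norm (g_coeff p d n * x ^ n)" if "n \<ge> N" for n
  proof -
    define B where "B = 2 * (real n + 1) * (real n + d - 1)"
    have pos: "real n + d - 1 > 0" using d_gt_1 by simp
    then have B: "B > 0" by (simp add: B_def add_nonneg_pos)
    define r where "r = real n * (real n - 1) + 2 * (d - 1) * real n - p * (d - 1)"
    have "r = (real n + 1) * (real n + d - 1) + ((d - 3) * real n - (p + 1) * (d - 1))"
      by (simp add: r_def algebra_simps)
    also have "\<bar>\<dots>\<bar> \<le> (real n + 1) * (real n + d - 1) + (\<bar>d - 3\<bar> * real n + (p + 1) * (d - 1))"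
      using pos p_pos d_gt_1 abs_mult[of "d - 3" "real n"] by (simp add: abs_le_iff) (smt (verit) abs_ge_self abs_ge_minus_self mult_nonneg_nonneg of_nat_0_le_iff mult_minus_left)
    also have "\<dots> \<le> (real n + 1) * (real n + d - 1) + K * (real n + d - 1)"
    proof -
      have "\<bar>d - 3\<bar> * real n \<le> \<bar>d - 3\<bar> * (real n + d - 1)" using d_gt_1 by (intro mult_left_mono) auto
      moreover have "(p + 1) * (d - 1) \<le> (p + 1) * (real n + d - 1)" using p_pos by (intro mult_left_mono) auto
      ultimately show ?thesis by (simp add: K_def algebra_simps)
    qed
    finally have r: "\<bar>r\<bar> \<le> (real n + 1 + K) * (real n + d - 1)" by (simp add: algebra_simps)
    have "\<bar>r\<bar> * \<bar>x\<bar> \<le> (real n + 1 + K) * (real n + d - 1) * \<bar>x\<bar>"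
      by (intro mult_right_mono r) auto
    also have "\<dots> = ((real n + 1) * \<bar>x\<bar> + K * \<bar>x\<bar>) * (real n + d - 1)" by (simp add: algebra_simps)
    also have "\<dots> \<le> (2 * (real n + 1) * c) * (real n + d - 1)"
    proof (rule mult_right_mono)
      have "K < (c - \<bar>x\<bar> / 2) * real N" using N c by (simp add: field_simps)
      also have "\<dots> \<le> (c - \<bar>x\<bar> / 2) * (real n + 1)" using c that by (intro mult_left_mono) auto
      also have "\<dots> = (2 * (real n + 1) * c - (real n + 1) * \<bar>x\<bar>) / 2" by (simp add: field_simps)
      finally have "2 * K + (real n + 1) * \<bar>x\<bar> \<le> 2 * (real n + 1) * c" by simp
      moreover have "K * \<bar>x\<bar> \<le> K * 2" using x K by (intro mult_left_mono) auto
      ultimately show "(real n + 1) * \<bar>x\<bar> + K * \<bar>x\<bar> \<le> 2 * (real n + 1) * c" by simp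
    qed (use pos in auto)
    finally have *: "\<bar>r\<bar> * \<bar>x\<bar> \<le> c * B" by (simp add: B_def algebra_simps)
    have rec: "B * g_coeff p d (Suc n) = r * g_coeff p d n"
      using g_coeff_rec[of n] by (simp add: B_def r_def)
    have "B * norm (g_coeff p d (Suc n) * x ^ Suc n) = \<bar>B * g_coeff p d (Suc n)\<bar> * \<bar>x ^ Suc n\<bar>"
      using B by (simp add: abs_mult)
    also have "\<dots> = (\<bar>r\<bar> * \<bar>x\<bar>) * norm (g_coeff p d n * x ^ n)"
      unfolding rec by (simp add: abs_mult)
    also have "\<dots> \<le> (c * B) * norm (g_coeff p d n * x ^ n)" by (intro mult_right_mono *) auto
    finally show ?thesis using B by (simp add: mult.assoc mult.left_commute[of c])
  qed
  then show ?thesis using c by (intro summable_ratio_test[of c N]) auto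
qed

definition g1 :: "real \<Rightarrow> real" where
  "g1 s = (\<Sum>m. diffs (g_coeff p d) m * (1 + s) ^ m)"

definition g2 :: "real \<Rightarrow> real" where
  "g2 s = (\<Sum>m. diffs (diffs (g_coeff p d)) m * (1 + s) ^ m)"

abbreviation "g \<equiv> g_fun p d"

lemma g1_summable: "norm (x::real) < 2 \<Longrightarrow> summable (\<lambda>m. diffs (g_coeff p d) m * x ^ m)"
  by (rule termdiff_converges[where K = 2]) (use g_coeff_summable in auto)

lemma g2_summable: "norm (x::real) < 2 \<Longrightarrow> summable (\<lambda>m. diffs (diffs (g_coeff p d)) m * x ^ m)"
  by (rule termdiff_converges[where K = 2]) (use g1_summable in auto)

text \<open>The series about \<open>-1\<close> converges on \<open>(-3, 1)\<close>, which makes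
  \<open>-1\<close> an interior point. Derivatives there are two-sided, as the expansions at zeros
  of \<open>v\<close> require, where the ratio \<open>s\<close> equals \<open>-1\<close>.\<close>

lemma g_deriv:
  assumes "-3 < s" "s < 1"
  shows "(g has_real_derivative g1 s) (at s)"
proof -
  have "((\<lambda>z. \<Sum>m. g_coeff p d m * z ^ m) has_real_derivative g1 s) (at (1 + s))"
    unfolding g1_def using assms by (intro termdiffs_strong'[where K = 2] g_coeff_summable) auto
  then have "(((\<lambda>z. \<Sum>m. g_coeff p d m * z ^ m) \<circ> (\<lambda>s. 1 + s)) has_real_derivative g1 s * 1) (at s)"
    by (rule DERIV_chain) (auto intro!: derivative_eq_intros)
  then show ?thesis
    by (simp add: g_fun_def[abs_def] o_def)
qed

lemma g1_deriv:
  assumes "-3 < s" "s < 1"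
  shows "(g1 has_real_derivative g2 s) (at s)"
proof -
  have "((\<lambda>z. \<Sum>m. diffs (g_coeff p d) m * z ^ m) has_real_derivative g2 s) (at (1 + s))"
    unfolding g2_def using assms by (intro termdiffs_strong'[where K = 2] g1_summable) auto
  then have "(((\<lambda>z. \<Sum>m. diffs (g_coeff p d) m * z ^ m) \<circ> (\<lambda>s. 1 + s)) has_real_derivative g2 s * 1) (at s)"
    by (rule DERIV_chain) (auto intro!: derivative_eq_intros)
  then show ?thesis
    by (simp add: g1_def[abs_def] o_def)
qed

lemma g_continuous: "A \<subseteq> {-3<..<1} \<Longrightarrow> continuous_on A g"
  by (intro continuous_at_imp_continuous_on ballI DERIV_isCont[OF g_deriv]) auto

lemma g1_continuous: "A \<subseteq> {-3<..<1} \<Longrightarrow> continuous_on A g1"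
  by (intro continuous_at_imp_continuous_on ballI DERIV_isCont[OF g1_deriv]) auto

text \<open>In \<open>t = 1 + s\<close> one has \<open>1 - s\<^sup>2 = 2 * t - t\<^sup>2\<close>,
  and comparing coefficients of \<open>t ^ m\<close> gives the recursion. Multiplication by
  \<open>t\<close> is an index shift whose new term at \<open>0\<close> vanishes because of a factor
  \<open>m\<close>.\<close>

lemma g_ode:
  assumes "-3 < s" "s < 1"
  shows "(1 - s\<^sup>2) * g2 s - 2 * (d - 1) * s * g1 s + p * (d - 1) * g s = 0"
proof -
  define t where "t = 1 + s"
  have t: "norm t < 2" using assms by (auto simp: t_def)
  define a where "a = g_coeff p d"
  have S0: "(\<lambda>m. a m * t ^ m) sums g s"
    using summable_sums[OF g_coeff_summable[OF t]] by (simp add: g_fun_def a_def t_def)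
  have S1: "(\<lambda>m. (real m + 1) * a (Suc m) * t ^ m) sums g1 s"
    using summable_sums[OF g1_summable[OF t]] by (simp add: g1_def a_def t_def diffs_def add.commute del: g_coeff.simps)
  have S2: "(\<lambda>m. (real m + 1) * (real m + 2) * a (Suc (Suc m)) * t ^ m) sums g2 s"
    using summable_sums[OF g2_summable[OF t]] by (simp add: g2_def a_def t_def diffs_def algebra_simps del: g_coeff.simps)
  have shift: "f sums l" if "(\<lambda>n. f (Suc n)) sums l" "f 0 = 0" for f :: "nat \<Rightarrow> real" and l
    using that sums_Suc_iff[of f l] by simp
  have tS1: "(\<lambda>m. real m * a m * t ^ m) sums (t * g1 s)"
    by (rule shift) (use sums_mult[OF S1, of t] in \<open>simp_all add: ac_simps\<close>)
  have tS2: "(\<lambda>m. (real m + 1) * real m * a (Suc m) * t ^ m) sums (t * g2 s)"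
    by (rule shift) (use sums_mult[OF S2, of t] in \<open>simp_all add: ac_simps\<close>)
  have ttS2: "(\<lambda>m. real m * (real m - 1) * a m * t ^ m) sums (t * (t * g2 s))"
    by (rule shift) (use sums_mult[OF tS2, of t] in \<open>simp_all add: ac_simps\<close>)
  have "(\<lambda>m. 2 * ((real m + 1) * real m * a (Suc m) * t ^ m) - real m * (real m - 1) * a m * t ^ m
      - 2 * (d - 1) * (real m * a m * t ^ m) + 2 * (d - 1) * ((real m + 1) * a (Suc m) * t ^ m)
      + p * (d - 1) * (a m * t ^ m)) sums
    (2 * (t * g2 s) - t * (t * g2 s) - 2 * (d - 1) * (t * g1 s) + 2 * (d - 1) * g1 s + p * (d - 1) * g s)"
    by (intro sums_add sums_diff sums_mult S0 S1 tS1 tS2 ttS2)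
  also have "(\<lambda>m. 2 * ((real m + 1) * real m * a (Suc m) * t ^ m) - real m * (real m - 1) * a m * t ^ m
      - 2 * (d - 1) * (real m * a m * t ^ m) + 2 * (d - 1) * ((real m + 1) * a (Suc m) * t ^ m)
      + p * (d - 1) * (a m * t ^ m)) = (\<lambda>m. 0)"
  proof
    fix m
    have "2 * ((real m + 1) * real m * a (Suc m) * t ^ m) - real m * (real m - 1) * a m * t ^ m
      - 2 * (d - 1) * (real m * a m * t ^ m) + 2 * (d - 1) * ((real m + 1) * a (Suc m) * t ^ m)
      + p * (d - 1) * (a m * t ^ m) =
      (2 * (real m + 1) * (real m + d - 1) * a (Suc m) -
       (real m * (real m - 1) + 2 * (d - 1) * real m - p * (d - 1)) * a m) * t ^ m"
      by (simp add: algebra_simps)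
    also have "\<dots> = 0" unfolding a_def g_coeff_rec by simp
    finally show "2 * ((real m + 1) * real m * a (Suc m) * t ^ m) - real m * (real m - 1) * a m * t ^ m
      - 2 * (d - 1) * (real m * a m * t ^ m) + 2 * (d - 1) * ((real m + 1) * a (Suc m) * t ^ m)
      + p * (d - 1) * (a m * t ^ m) = 0" .
  qed
  finally have "2 * (t * g2 s) - t * (t * g2 s) - 2 * (d - 1) * (t * g1 s) + 2 * (d - 1) * g1 s + p * (d - 1) * g s = 0"
    using sums_unique2 sums_zero by blast
  then show ?thesis by (simp add: t_def power2_eq_square algebra_simps)
qed

text \<open>By these values both \<open>2 * s * g1 s - p * g s\<close> and
  \<open>p * g s + (1 - s) * g1 s\<close>, whose signs are studied below, vanish at
  \<open>-1\<close>.\<close>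

lemma g_at_m1: "g (-1) = -1" "g1 (-1) = p / 2"
proof -
  show "g (-1) = -1" by (simp add: g_fun_def)
  have "g1 (-1) = diffs (g_coeff p d) 0" by (simp add: g1_def)
  also have "\<dots> = p / 2" using d_gt_1 by (simp add: diffs_def field_simps)
  finally show "g1 (-1) = p / 2" .
qed

text \<open>For \<open>r = d - 1\<close> the bracket, taken at \<open>f = g1\<close>, consists of
  the first two terms of the equation: \<open>(1 - s\<^sup>2) powr (d - 1)\<close> is its
  integrating factor.\<close>

lemma DERIV_weight_sq:
  assumes "-1 < s" "s < 1" "(f has_real_derivative f') (at s)"
  shows "((\<lambda>s. (1 - s\<^sup>2) powr r * f s) has_real_derivative
     (1 - s\<^sup>2) powr (r - 1) * ((1 - s\<^sup>2) * f' - 2 * r * s * f s)) (at s)"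
proof -
  have pos: "1 - s\<^sup>2 > 0" using assms(1,2) by (simp add: power2_less_1_iff abs_less_iff)
  have "((\<lambda>s. (1 - s\<^sup>2) powr r) has_real_derivative r * (1 - s\<^sup>2) powr (r - of_nat 1) * (- (2 * s))) (at s)"
    using pos by (intro DERIV_fun_powr) (auto intro!: derivative_eq_intros)
  note D = DERIV_mult[OF this assms(3)]
  have pw: "(1 - s\<^sup>2) powr r = (1 - s\<^sup>2) powr (r - 1) * (1 - s\<^sup>2)"
    using pos powr_add[of "1 - s\<^sup>2" "r - 1" 1] by simp
  show ?thesis
    by (rule DERIV_cong[OF D], unfold pw) (simp add: algebra_simps)
qed

lemma DERIV_weight:
  assumes "-1 < s" "(f has_real_derivative f') (at s)"
  shows "((\<lambda>s. (1 + s) powr r * f s) has_real_derivative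
     (1 + s) powr (r - 1) * ((1 + s) * f' + r * f s)) (at s)"
proof -
  have pos: "1 + s > 0" using assms(1) by simp
  have "((\<lambda>s. (1 + s) powr r) has_real_derivative r * (1 + s) powr (r - of_nat 1) * 1) (at s)"
    using pos by (intro DERIV_fun_powr) (auto intro!: derivative_eq_intros)
  note D = DERIV_mult[OF this assms(2)]
  have pw: "(1 + s) powr r = (1 + s) powr (r - 1) * (1 + s)"
    using pos powr_add[of "1 + s" "r - 1" 1] by simp
  show ?thesis
    by (rule DERIV_cong[OF D], unfold pw) (simp add: algebra_simps)
qed

lemma continuous_weight_sq:
  fixes A :: "real set" and f :: "real \<Rightarrow> real"
  assumes "r > 0" "A \<subseteq> {-1..1}" "continuous_on A f"
  shows "continuous_on A (\<lambda>s. (1 - s\<^sup>2) powr r * f s)"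
proof -
  have "1 - s\<^sup>2 \<ge> 0" if "s \<in> A" for s
    using assms(2) that abs_square_le_1[of s] by (auto simp: abs_le_iff)
  then show ?thesis using assms by (intro continuous_on_mult continuous_on_powr' continuous_intros) auto
qed

lemma continuous_weight:
  fixes A :: "real set" and f :: "real \<Rightarrow> real"
  assumes "r > 0" "A \<subseteq> {-1..}" "continuous_on A f"
  shows "continuous_on A (\<lambda>s. (1 + s) powr r * f s)"
  using assms by (intro continuous_on_mult continuous_on_powr' continuous_intros) auto

section \<open>Signs of the derivatives up to the first root\<close>

context
  fixes t :: real
  assumes t: "-1 \<le> t" "t < 1" and neg: "\<And>s. -1 \<le> s \<Longrightarrow> s < t \<Longrightarrow> g s < 0"
begin

text \<open>In divergence form the equation says that the weighted \<open>g1\<close> has derivative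
  a positive factor times \<open>- g\<close>, which is positive before \<open>t\<close>; the weight
  vanishes at \<open>-1\<close>. As \<open>g\<close> is assumed negative only strictly before
  \<open>t\<close>, the first root itself is allowed as \<open>t\<close>.\<close>

lemma g1_pos: "0 < g1 t"
proof (cases "t = -1")
  case False
  with t have t': "-1 < t" by simp
  have "(1 - (-1)\<^sup>2) powr (d - 1) * g1 (-1) < (1 - t\<^sup>2) powr (d - 1) * g1 t"
  proof (rule DERIV_pos_imp_increasing_open[OF t', where f = "\<lambda>s. (1 - s\<^sup>2) powr (d - 1) * g1 s"])
    fix s assume s: "-1 < s" "s < t"
    have pos: "1 - s\<^sup>2 > 0" using s t by (simp add: power2_less_1_iff abs_less_iff)
    have "((\<lambda>s. (1 - s\<^sup>2) powr (d - 1) * g1 s) has_real_derivative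
       (1 - s\<^sup>2) powr (d - 1 - 1) * ((1 - s\<^sup>2) * g2 s - 2 * (d - 1) * s * g1 s)) (at s)"
      using s t by (intro DERIV_weight_sq g1_deriv) auto
    moreover have "(1 - s\<^sup>2) * g2 s - 2 * (d - 1) * s * g1 s = - (p * (d - 1)) * g s"
      using g_ode[of s] s t by simp
    moreover have "- (p * (d - 1)) * g s > 0"
      using neg[of s] s p_pos d_gt_1 by (simp add: mult_pos_neg)
    moreover have "(1 - s\<^sup>2) powr (d - 1 - 1) > 0" using pos by simp
    ultimately show "\<exists>y. ((\<lambda>s. (1 - s\<^sup>2) powr (d - 1) * g1 s) has_real_derivative y) (at s) \<and> 0 < y"
      by - (rule exI, rule conjI, assumption, rule mult_pos_pos, assumption, simp only:)
  next
    show "continuous_on {-1..t} (\<lambda>s. (1 - s\<^sup>2) powr (d - 1) * g1 s)"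
      using t d_gt_1 by (intro continuous_weight_sq g1_continuous) auto
  qed
  then show ?thesis by (auto simp: zero_less_mult_iff)
qed (use p_pos in \<open>simp add: g_at_m1\<close>)

end

context
  fixes t :: real
  assumes t: "-1 \<le> t" "t < 1" and neg: "\<And>s. -1 \<le> s \<Longrightarrow> s < t \<Longrightarrow> g s < 0"
begin

text \<open>The preceding context was closed so that \<open>g1_pos\<close> can be used with
  \<open>s\<close> in the role of \<open>t\<close>.\<close>

lemma g1_pos': "-1 \<le> s \<Longrightarrow> s \<le> t \<Longrightarrow> 0 < g1 s"
  using t neg by (intro g1_pos) auto

text \<open>On the line \<open>x + y = 1\<close> the mixed second derivative of
  \<open>(x + y)\<^sup>p g ((y - x) / (x + y))\<close> is \<open>(p + d - 2) (p g - 2 s g1)\<close>.\<close>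

lemma g_cross_sign:
  assumes e: "0 \<le> e * (2 - p)"
  shows "0 \<le> e * (2 * t * g1 t - p * g t)"
proof (cases "t = -1")
  case False
  with t have t': "-1 < t" by simp
  define k where "k s = e * (2 * s * g1 s - p * g s)" for s
  have "(1 - (-1)\<^sup>2) powr (d - 1) * k (-1) \<le> (1 - t\<^sup>2) powr (d - 1) * k t"
  proof (rule DERIV_nonneg_imp_increasing_open[OF t(1), where f = "\<lambda>s. (1 - s\<^sup>2) powr (d - 1) * k s"])
    fix s assume s: "-1 < s" "s < t"
    have pos: "1 - s\<^sup>2 > 0" using s t by (simp add: power2_less_1_iff abs_less_iff)
    define k' where "k' = e * (2 * g1 s + 2 * s * g2 s - p * g1 s)"
    have "(k has_real_derivative k') (at s)"
      unfolding k_def k'_def using s t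
      by (auto intro!: derivative_eq_intros g_deriv g1_deriv simp: algebra_simps)
    then have "((\<lambda>s. (1 - s\<^sup>2) powr (d - 1) * k s) has_real_derivative
       (1 - s\<^sup>2) powr (d - 1 - 1) * ((1 - s\<^sup>2) * k' - 2 * (d - 1) * s * k s)) (at s)"
      using s t by (intro DERIV_weight_sq) auto
    \<comment> \<open>Inserting the equation cancels everything that contains \<open>d\<close>; the
      surviving factor \<open>2 - p\<close> is the source of the change of sign at
      \<open>p = 2\<close>.\<close>
    moreover have "(1 - s\<^sup>2) * k' - 2 * (d - 1) * s * k s = e * (2 - p) * ((1 - s\<^sup>2) * g1 s)"
    proof -
      have "(1 - s\<^sup>2) * k' = e * ((2 - p) * (1 - s\<^sup>2) * g1 s + 2 * s * ((1 - s\<^sup>2) * g2 s))"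
        unfolding k'_def by (simp add: algebra_simps)
      also have "(1 - s\<^sup>2) * g2 s = 2 * (d - 1) * s * g1 s - p * (d - 1) * g s"
        using g_ode[of s] s t by simp
      finally have "(1 - s\<^sup>2) * k' = e * ((2 - p) * (1 - s\<^sup>2) * g1 s + 2 * s * (2 * (d - 1) * s * g1 s - p * (d - 1) * g s))" .
      then show ?thesis unfolding k_def by (simp add: power2_eq_square algebra_simps)
    qed
    moreover have "e * (2 - p) * ((1 - s\<^sup>2) * g1 s) \<ge> 0"
      using pos g1_pos'[of s] s e by simp
    ultimately show "\<exists>y. ((\<lambda>s. (1 - s\<^sup>2) powr (d - 1) * k s) has_real_derivative y) (at s) \<and> 0 \<le> y"
      by - (rule exI, rule conjI, assumption, rule mult_nonneg_nonneg, rule powr_ge_zero, simp only:)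
  next
    show "continuous_on {-1..t} (\<lambda>s. (1 - s\<^sup>2) powr (d - 1) * k s)"
      unfolding k_def using t d_gt_1
      by (intro continuous_weight_sq continuous_intros g_continuous g1_continuous) auto
  qed
  moreover have "1 - t\<^sup>2 > 0" using t' t by (simp add: power2_less_1_iff abs_less_iff)
  ultimately have "0 \<le> k t" by (simp add: zero_le_mult_iff)
  then show ?thesis by (simp add: k_def)
qed (simp add: g_at_m1)

text \<open>The parenthesised factor is the derivative in the variable \<open>y\<close> of
  \<open>(x + y)\<^sup>p g ((y - x) / (x + y))\<close> on the line \<open>x + y = 1\<close>.\<close>

lemma g_slope_mono:
  assumes "-1 \<le> s" "s < t"
  shows "(1 + s) powr (d - 1) * (p * g s + (1 - s) * g1 s) < (1 + t) powr (d - 1) * (p * g t + (1 - t) * g1 t)"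
proof (rule DERIV_pos_imp_increasing_open[OF assms(2),
    where f = "\<lambda>s. (1 + s) powr (d - 1) * (p * g s + (1 - s) * g1 s)"])
  fix x assume x: "s < x" "x < t"
  define m where "m s = p * g s + (1 - s) * g1 s" for s
  define m' where "m' = p * g1 x + (1 - x) * g2 x - g1 x"
  have "(m has_real_derivative m') (at x)"
    unfolding m_def m'_def using x t assms
    by (auto intro!: derivative_eq_intros g_deriv g1_deriv simp: algebra_simps)
  then have "((\<lambda>s. (1 + s) powr (d - 1) * m s) has_real_derivative
     (1 + x) powr (d - 1 - 1) * ((1 + x) * m' + (d - 1) * m x)) (at x)"
    using x assms by (intro DERIV_weight) auto
  \<comment> \<open>The equation eliminates \<open>g2\<close>, and all terms in \<open>g\<close>
    cancel. Positivity of what is left rests on \<open>p + d > 2\<close>.\<close>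
  moreover have "(1 + x) * m' + (d - 1) * m x = (p + d - 2) * ((1 + x) * g1 x)"
  proof -
    have "(1 + x) * m' = p * (1 + x) * g1 x + (1 - x\<^sup>2) * g2 x - (1 + x) * g1 x"
      by (simp add: m'_def power2_eq_square algebra_simps)
    also have "(1 - x\<^sup>2) * g2 x = 2 * (d - 1) * x * g1 x - p * (d - 1) * g x"
      using g_ode[of x] x t assms by simp
    finally show ?thesis by (simp add: m_def algebra_simps)
  qed
  moreover have "(p + d - 2) * ((1 + x) * g1 x) > 0"
    using pd x assms g1_pos'[of x] by simp
  moreover have "(1 + x) powr (d - 1 - 1) > 0" using x assms by simp
  ultimately show "\<exists>y. ((\<lambda>s. (1 + s) powr (d - 1) * (p * g s + (1 - s) * g1 s)) has_real_derivative y) (at x) \<and> 0 < y"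
    unfolding m_def by - (rule exI, rule conjI, assumption, rule mult_pos_pos, assumption, simp only:)
next
  show "continuous_on {s..t} (\<lambda>s. (1 + s) powr (d - 1) * (p * g s + (1 - s) * g1 s))"
    using t d_gt_1 assms by (intro continuous_weight continuous_intros g_continuous g1_continuous) auto
qed

lemma g_slope_nonneg: "0 \<le> p * g t + (1 - t) * g1 t"
proof (cases "t = -1")
  case False
  with t have t': "-1 < t" by simp
  show ?thesis using g_slope_mono[of "-1"] t' by (simp add: zero_less_mult_iff)
qed (simp add: g_at_m1)

end

text \<open>Without a root, \<open>p g + (1 - s) g1\<close> would stay above some \<open>p c > 0\<close>, so that
  the quotient of \<open>g - c\<close> by \<open>(1 - s)\<^sup>p\<close> would be nondecreasing, and \<open>g\<close> would become positive near \<open>1\<close>.\<close>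

lemma g_root_exists: "\<exists>s. -1 \<le> s \<and> s < 1 \<and> g s = 0"
proof (rule ccontr)
  assume no: "\<not> ?thesis"
  have neg: "g s < 0" if "-1 \<le> s" "s < 1" for s
  proof (rule ccontr)
    assume "\<not> g s < 0"
    then have "\<exists>x\<ge>-1. x \<le> s \<and> g x = 0"
      using that g_at_m1 by (intro IVT' g_continuous) auto
    then show False using no that by force
  qed
  define m where "m s = p * g s + (1 - s) * g1 s" for s
  \<comment> \<open>Chosen so that \<open>p * c\<close> bounds \<open>m\<close> from below on
    \<open>(0, 1)\<close>: the weighted \<open>m\<close> increases, and its weight is at most
    \<open>2 powr (d - 1)\<close>.\<close>
  define c where "c = m 0 / (2 powr (d - 1) * p)"
  have m0: "m 0 > 0"
    using g_slope_mono[of 0 "-1"] neg by (simp add: m_def)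
  have c: "c > 0" using m0 p_pos by (simp add: c_def)
  have m_ge: "p * c \<le> m s" if "0 < s" "s < 1" for s
  proof -
    have "m 0 \<le> (1 + s) powr (d - 1) * m s"
      using g_slope_mono[of s 0] neg that by (simp add: m_def)
    moreover have "m s > 0"
    proof (rule ccontr)
      assume "\<not> m s > 0"
      then have "(1 + s) powr (d - 1) * m s \<le> 0" by (simp add: mult_nonneg_nonpos)
      then show False using calculation m0 by simp
    qed
    moreover have "(1 + s) powr (d - 1) \<le> 2 powr (d - 1)"
      using that d_gt_1 by (intro powr_mono2) auto
    ultimately have "m 0 \<le> 2 powr (d - 1) * m s" by (smt (verit) mult_right_mono)
    then show ?thesis using p_pos by (simp add: c_def field_simps)
  qed
  \<comment> \<open>The monotone quotient yields
    \<open>g s \<ge> c - (c - g 0) * (1 - s) powr p\<close>; the right-hand side is zero exactly at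
    \<open>s = 1 - x\<close>.\<close>
  define x where "x = (c / (c - g 0)) powr (1 / p)"
  have g0: "g 0 < 0" using neg by simp
  have x: "0 < x" "x < 1" "x powr p = c / (c - g 0)"
  proof -
    have r: "0 < c / (c - g 0)" "c / (c - g 0) < 1" using c g0 by auto
    then have "x powr p = (c / (c - g 0)) powr 1" using p_pos by (simp only: x_def powr_powr) simp
    then show "x powr p = c / (c - g 0)" using r(1) by (subst (asm) powr_one) simp_all
    show "0 < x" using r(1) by (simp only: x_def powr_gt_zero)
    show "x < 1" using r p_pos powr_less_mono2[of "1 / p" "c / (c - g 0)" 1] by (simp add: x_def)
  qed
  define s where "s = 1 - x"
  have s: "0 < s" "s < 1" using x by (auto simp: s_def)
  have "(1 - 0) powr (- p) * (g 0 - c) \<le> (1 - s) powr (- p) * (g s - c)"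
  proof (rule DERIV_nonneg_imp_nondecreasing[where f = "\<lambda>s. (1 - s) powr (- p) * (g s - c)"])
    fix y assume y: "0 \<le> y" "y \<le> s"
    then have y1: "1 - y > 0" using s by simp
    have pw: "(1 - y) powr (- p) = (1 - y) powr (- p - 1) * (1 - y)"
      using y1 powr_add[of "1 - y" "- p - 1" 1] by simp
    have "((\<lambda>s. (1 - s) powr (- p)) has_real_derivative (- p) * (1 - y) powr (- p - of_nat 1) * (- 1)) (at y)"
      using y1 by (intro DERIV_fun_powr) (auto intro!: derivative_eq_intros)
    moreover have "((\<lambda>s. g s - c) has_real_derivative g1 y) (at y)"
      using y s by (auto intro!: derivative_eq_intros g_deriv)
    ultimately have "((\<lambda>s. (1 - s) powr (- p) * (g s - c)) has_real_derivative
        (1 - y) powr (- p - 1) * (m y - p * c)) (at y)"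
      by (rule DERIV_cong[OF DERIV_mult], unfold pw) (simp add: m_def algebra_simps)
    moreover have "m y \<ge> p * c"
    proof (cases "y = 0")
      case True
      have "p * c = m 0 / 2 powr (d - 1)" using p_pos by (simp add: c_def)
      also have "\<dots> \<le> m 0" using m0 d_gt_1 ge_one_powr_ge_zero[of 2 "d - 1"] by (simp add: divide_le_eq)
      finally show ?thesis using True by simp
    qed (use m_ge y s in auto)
    ultimately show "\<exists>z. ((\<lambda>s. (1 - s) powr (- p) * (g s - c)) has_real_derivative z) (at y) \<and> 0 \<le> z"
      by (intro exI[of _ "(1 - y) powr (- p - 1) * (m y - p * c)"]) simp
  qed (use s in auto)
  then have "g 0 - c \<le> x powr (- p) * (g s - c)" by (simp add: s_def)
  then have "(g 0 - c) * x powr p \<le> g s - c"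
    using x(1) by (simp add: powr_minus field_simps)
  moreover have "(g 0 - c) * x powr p = - c" using c g0 by (simp add: x(3) field_simps)
  ultimately have "g s \<ge> 0" by simp
  then show False using neg[of s] s by simp
qed

abbreviation "z0 \<equiv> smallest_root p d"

text \<open>\<open>LEAST\<close> on the reals yields a root only if the minimum is attained. The
  roots up to one known root form a compact set, and the intermediate value theorem excludes
  nonnegative values before the smallest one.\<close>

lemma z0: "-1 < z0" "z0 < 1" "g z0 = 0" "-1 \<le> s \<Longrightarrow> s < z0 \<Longrightarrow> g s < 0"
proof -
  obtain r where r: "-1 \<le> r" "r < 1" "g r = 0" using g_root_exists by blast
  define Z where "Z = {-1..r} \<inter> g -` {0}"
  have "closed Z" unfolding Z_def using r
    by (intro continuous_closed_preimage g_continuous) auto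
  moreover have "Z \<subseteq> {-1..r}" by (auto simp: Z_def)
  ultimately have "compact Z" by (metis bounded_closed_interval bounded_subset compact_eq_bounded_closed)
  moreover have "r \<in> Z" using r by (simp add: Z_def)
  ultimately obtain z where z: "z \<in> Z" "\<And>y. y \<in> Z \<Longrightarrow> z \<le> y"
    using compact_attains_inf by (metis empty_iff)
  have "z0 = z"
    unfolding smallest_root_def
  proof (rule Least_equality)
    show "- 1 \<le> z \<and> z < 1 \<and> g z = 0" using z(1) r by (auto simp: Z_def)
    fix y assume y: "- 1 \<le> y \<and> y < 1 \<and> g y = 0"
    show "z \<le> y"
    proof (cases "y \<le> r")
      case True
      then show ?thesis using y z(2)[of y] by (simp add: Z_def)
    qed (use z(1) in \<open>auto simp: Z_def\<close>)
  qed
  then have z: "z0 \<in> Z" "\<And>y. y \<in> Z \<Longrightarrow> z0 \<le> y" using z by auto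
  show "z0 < 1" "g z0 = 0" using z(1) r by (auto simp: Z_def)
  have "z0 \<noteq> -1" using \<open>g z0 = 0\<close> g_at_m1 by force
  then show "-1 < z0" using z(1) by (auto simp: Z_def)
  show "g s < 0" if s: "-1 \<le> s" "s < z0" for s
  proof (rule ccontr)
    assume "\<not> g s < 0"
    then have "\<exists>x\<ge>-1. x \<le> s \<and> g x = 0"
      using s \<open>z0 < 1\<close> g_at_m1 by (intro IVT' g_continuous) auto
    then obtain x where "-1 \<le> x" "x \<le> s" "g x = 0" by blast
    then have "x \<in> Z" using s z(1) by (auto simp: Z_def)
    then show False using z(2) \<open>x \<le> s\<close> s by force
  qed
qed

text \<open>At the root the term with \<open>g\<close> drops out of \<open>g_cross_sign\<close>.
  Thus \<open>z0\<close> is nonnegative for \<open>p \<le> 2\<close> and nonpositive for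
  \<open>p \<ge> 2\<close>, which makes the constant at least \<open>1\<close> in both
  ranges.\<close>

lemma z0_sign:
  assumes e: "0 \<le> e * (2 - p)"
  shows "0 \<le> e * z0"
proof -
  have "0 < g1 z0" using z0 by (intro g1_pos) auto
  moreover have "0 \<le> e * (2 * z0 * g1 z0 - p * g z0)" using z0 e by (intro g_cross_sign) auto
  then have "0 \<le> (e * z0) * (2 * g1 z0)" using z0(3) by (simp add: algebra_simps)
  ultimately show ?thesis by (simp add: zero_le_mult_iff)
qed


section \<open>Comparison with the powers\<close>

definition K :: real where "K = (1 + z0) / (1 - z0)"

text \<open>The restriction of \<open>y powr p - K powr p * x powr p\<close> to the line
  \<open>x + y = 2\<close>, with \<open>x = 1 - s\<close> and \<open>y = 1 + s\<close>; hence the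
  factor \<open>2 powr p\<close> in \<open>hom_powers\<close>.\<close>

definition vK :: "real \<Rightarrow> real" where
  "vK s = (1 + s) powr p - K powr p * (1 - s) powr p"

definition vK1 :: "real \<Rightarrow> real" where
  "vK1 s = p * ((1 + s) powr (p - 1) + K powr p * (1 - s) powr (p - 1))"

definition vK2 :: "real \<Rightarrow> real" where
  "vK2 s = p * (p - 1) * ((1 + s) powr (p - 2) - K powr p * (1 - s) powr (p - 2))"

text \<open>The sign \<open>e\<close> lets the cases \<open>p \<le> 2\<close> and \<open>p > 2\<close> share one argument: several inequalities
  reverse at \<open>p = 2\<close>.\<close>

definition e where "e = (if p \<le> 2 then 1 else - 1 :: real)"

text \<open>Since \<open>g\<close> and \<open>vK\<close> both vanish at \<open>z0\<close>, this
  factor makes \<open>\<alpha> * g\<close> and \<open>vK\<close> agree there to first order.\<close>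

definition \<alpha> where "\<alpha> = vK1 z0 / g1 z0"

lemma g1_z0: "0 < g1 z0"
  using z0 by (intro g1_pos) auto

lemma K_pos: "K > 0" using z0 by (simp add: K_def)

lemma vK1_pos: "-1 < s \<Longrightarrow> s < 1 \<Longrightarrow> 0 < vK1 s"
  using p_pos K_pos by (simp add: vK1_def add_pos_pos)

lemma alpha_pos: "\<alpha> > 0"
  using vK1_pos[of z0] z0 g1_z0 by (simp add: \<alpha>_def)

lemma vK_z0: "vK z0 = 0"
  using z0 by (simp add: vK_def K_def powr_divide)

lemma DERIV_powr_plus: "-1 < s \<Longrightarrow> ((\<lambda>s. (1 + s) powr r) has_real_derivative r * (1 + s) powr (r - 1)) (at s)"
  using DERIV_fun_powr[of "\<lambda>s. 1 + s" 1 s r] by (auto intro!: derivative_eq_intros)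

lemma DERIV_powr_minus: "s < 1 \<Longrightarrow> ((\<lambda>s. (1 - s) powr r) has_real_derivative - (r * (1 - s) powr (r - 1))) (at s)"
  using DERIV_fun_powr[of "\<lambda>s. 1 - s" "-1" s r] by (auto intro!: derivative_eq_intros)

lemma vK_deriv: "-1 < s \<Longrightarrow> s < 1 \<Longrightarrow> (vK has_real_derivative vK1 s) (at s)"
  unfolding vK_def[abs_def] vK1_def
  by (rule DERIV_cong, rule DERIV_diff[OF DERIV_powr_plus DERIV_cmult[OF DERIV_powr_minus]])
     (auto simp: algebra_simps)

lemma vK1_deriv: "-1 < s \<Longrightarrow> s < 1 \<Longrightarrow> (vK1 has_real_derivative vK2 s) (at s)"
  unfolding vK1_def[abs_def] vK2_def
  by (rule DERIV_cong, rule DERIV_cmult[OF DERIV_add[OF DERIV_powr_plus DERIV_cmult[OF DERIV_powr_minus]]])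
     (auto simp: algebra_simps)

lemma vK_continuous: "A \<subseteq> {-1..1} \<Longrightarrow> continuous_on A vK"
  unfolding vK_def[abs_def] using p_pos
  by (intro continuous_intros continuous_on_powr') auto

text \<open>Up to a positive factor, the defect left when \<open>vK\<close> is inserted into the
  equation of \<open>g\<close>. On the power branch \<open>e * lam s \<le> 0\<close> is the
  inequality between powers asked for in \<open>visc_super_powers\<close>.\<close>

definition lam where "lam s = (1 + s) powr (p - 2) - K powr p * (1 - s) powr (p - 2)"

lemma powr_split: "0 < (x::real) \<Longrightarrow> x powr (r - 1) = x * x powr (r - 2)" "0 < x \<Longrightarrow> x powr r = x * (x * x powr (r - 2))"
  using powr_add[of x 1 "r - 2"] powr_add[of x 2 "r - 2"] by (simp_all add: power2_eq_square)

lemma vK_ode: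
  assumes "-1 < s" "s < 1"
  shows "(1 - s\<^sup>2) * vK2 s - 2 * (d - 1) * s * vK1 s + p * (d - 1) * vK s = p * (p + d - 2) * (1 - s\<^sup>2) * lam s"
proof -
  define X Y L where "X = 1 - s" and "Y = 1 + s" and "L = K powr p"
  define x y where "x = X powr (p - 2)" and "y = Y powr (p - 2)"
  have pos: "X > 0" "Y > 0" using assms by (auto simp: X_def Y_def)
  have *: "vK s = Y * (Y * y) - L * (X * (X * x))" "vK1 s = p * (Y * y + L * (X * x))" "vK2 s = p * (p - 1) * (y - L * x)" "lam s = y - L * x"
    unfolding vK_def vK1_def vK2_def lam_def L_def x_def y_def
    using powr_split[OF pos(1), of p] powr_split[OF pos(2), of p] by (simp_all add: X_def Y_def)
  show ?thesis unfolding * unfolding X_def Y_def by (simp add: power2_eq_square algebra_simps)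
qed

lemma lam_antimono:
  assumes "-1 < s" "s \<le> t" "t < 1"
  shows "e * lam t \<le> e * lam s"
proof (cases "p \<le> 2")
  case True
  have "(1 + t) powr (p - 2) \<le> (1 + s) powr (p - 2)" using True assms by (intro powr_mono2') auto
  moreover have "(1 - s) powr (p - 2) \<le> (1 - t) powr (p - 2)" using True assms by (intro powr_mono2') auto
  then have "K powr p * (1 - s) powr (p - 2) \<le> K powr p * (1 - t) powr (p - 2)" by (rule mult_left_mono) simp
  ultimately show ?thesis using True by (simp add: e_def lam_def)
next
  case False
  have "(1 + s) powr (p - 2) \<le> (1 + t) powr (p - 2)" using False assms by (intro powr_mono2) auto
  moreover have "(1 - t) powr (p - 2) \<le> (1 - s) powr (p - 2)" using False assms by (intro powr_mono2) auto
  then have "K powr p * (1 - t) powr (p - 2) \<le> K powr p * (1 - s) powr (p - 2)" by (rule mult_left_mono) simp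
  ultimately show ?thesis using False by (simp add: e_def lam_def)
qed

lemma K_ge_1: "p \<le> 2 \<Longrightarrow> 1 \<le> K"
  using z0_sign[of 1] z0 by (simp add: K_def)

lemma K_le_1: "2 \<le> p \<Longrightarrow> K \<le> 1"
  using z0_sign[of "-1"] z0 by (simp add: K_def)

text \<open>From \<open>1 + z0 = K * (1 - z0)\<close>, \<open>lam z0\<close> is a positive multiple
  of \<open>1 - K * K\<close>, and the sign of \<open>z0\<close> decides whether \<open>K\<close> is
  above or below \<open>1\<close>.\<close>

lemma lam_z0: "e * lam z0 \<le> 0"
proof -
  define x where "x = (1 - z0) powr (p - 2)"
  have "1 + z0 = K * (1 - z0)" using z0 by (simp add: K_def)
  then have "(1 + z0) powr (p - 2) = K powr (p - 2) * x" using K_pos z0 by (simp add: x_def powr_mult)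
  moreover have "K powr p = K * (K * K powr (p - 2))" using K_pos by (rule powr_split)
  ultimately have "lam z0 = (x * K powr (p - 2)) * (1 - K * K)"
    unfolding lam_def x_def[symmetric] by (simp add: algebra_simps)
  moreover have "e * (1 - K * K) \<le> 0"
  proof (cases "p \<le> 2")
    case True
    then have "1 * 1 \<le> K * K" using K_ge_1 by (intro mult_mono) auto
    then show ?thesis using True by (simp add: e_def)
  next
    case False
    then have "K * K \<le> 1 * 1" using K_le_1 K_pos by (intro mult_mono) auto
    then show ?thesis using False by (simp add: e_def)
  qed
  then have "(x * K powr (p - 2)) * (e * (1 - K * K)) \<le> 0"
    by (rule mult_nonneg_nonpos[rotated]) (auto simp: x_def)
  ultimately show ?thesis by (simp only: ac_simps)
qed

text \<open>The Wronskian of \<open>vK\<close> and \<open>g\<close>, written so that it is continuous at \<open>-1\<close>, where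
  \<open>vK1\<close> may be unbounded.\<close>

definition wr where
  "wr s = p * ((1 - s) powr (d - 1) * ((1 + s) powr (p + d - 2) + K powr p * (1 + s) powr (d - 1) * (1 - s) powr (p - 1))) * g s
     - (1 - s\<^sup>2) powr (d - 1) * (vK s * g1 s)"

lemma wr_eq:
  assumes "-1 < s" "s < 1"
  shows "wr s = (1 - s\<^sup>2) powr (d - 1) * (vK1 s * g s - vK s * g1 s)"
proof -
  have sq: "1 - s\<^sup>2 = (1 - s) * (1 + s)" by (simp add: power2_eq_square algebra_simps)
  have "(1 - s\<^sup>2) powr (d - 1) = (1 - s) powr (d - 1) * (1 + s) powr (d - 1)"
    unfolding sq using assms by (simp add: powr_mult)
  moreover have "(1 + s) powr (p + d - 2) = (1 + s) powr (d - 1) * (1 + s) powr (p - 1)"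
    using powr_add[of "1 + s" "d - 1" "p - 1"] by (simp add: add.commute)
  ultimately show ?thesis by (simp add: wr_def vK1_def algebra_simps)
qed

lemma wr_m1: "wr (-1) = 0"
  by (simp add: wr_def)

lemma wr_z0: "wr z0 = 0"
  using z0 by (simp add: wr_eq vK_z0)

lemma wr_continuous: "A \<subseteq> {-1..<1} \<Longrightarrow> continuous_on A wr"
  unfolding wr_def[abs_def] using pd d_gt_1
  by (intro continuous_on_diff continuous_weight_sq continuous_on_mult continuous_on_add continuous_on_const
      continuous_on_powr' vK_continuous g_continuous g1_continuous continuous_on_id) force+

text \<open>Lagrange's identity: \<open>g\<close> solves the equation and \<open>vK\<close> solves
  it up to the defect, so the derivative of the weighted Wronskian contains only the defect times
  \<open>g\<close>.\<close>

lemma wr_deriv: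
  assumes "-1 < s" "s < 1"
  shows "(wr has_real_derivative ((1 - s\<^sup>2) powr (d - 1) * (p * (p + d - 2))) * (g s * lam s)) (at s)"
proof -
  define f where "f s = vK1 s * g s - vK s * g1 s" for s
  have pos: "1 - s\<^sup>2 > 0" using assms by (simp add: power2_less_1_iff abs_less_iff)
  have "(f has_real_derivative (vK2 s * g s - vK s * g2 s)) (at s)"
    unfolding f_def
    by (rule DERIV_cong[OF DERIV_diff[OF DERIV_mult DERIV_mult]])
       (use assms in \<open>auto intro!: vK_deriv vK1_deriv g_deriv g1_deriv simp: algebra_simps\<close>)
  note D = DERIV_weight_sq[OF assms this, of "d - 1"]
  have "(1 - s\<^sup>2) * (vK2 s * g s - vK s * g2 s) - 2 * (d - 1) * s * f s
     = ((1 - s\<^sup>2) * vK2 s - 2 * (d - 1) * s * vK1 s + p * (d - 1) * vK s) * g s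
       - ((1 - s\<^sup>2) * g2 s - 2 * (d - 1) * s * g1 s + p * (d - 1) * g s) * vK s"
    by (simp add: f_def algebra_simps)
  also have "\<dots> = p * (p + d - 2) * (1 - s\<^sup>2) * lam s * g s"
    using vK_ode[OF assms] g_ode[of s] assms by simp
  finally have E: "(1 - s\<^sup>2) * (vK2 s * g s - vK s * g2 s) - 2 * (d - 1) * s * f s = p * (p + d - 2) * (1 - s\<^sup>2) * lam s * g s" .
  have pw: "(1 - s\<^sup>2) powr (d - 1) = (1 - s\<^sup>2) powr (d - 1 - 1) * (1 - s\<^sup>2)"
    using pos powr_add[of "1 - s\<^sup>2" "d - 1 - 1" 1] by simp
  have "((\<lambda>s. (1 - s\<^sup>2) powr (d - 1) * f s) has_real_derivative
     ((1 - s\<^sup>2) powr (d - 1) * (p * (p + d - 2))) * (g s * lam s)) (at s)"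
    by (rule DERIV_cong[OF D], unfold E pw) (simp add: algebra_simps)
  then show ?thesis
    by (rule has_field_derivative_transform_within_open[where S = "{-1<..<1}"])
       (use assms in \<open>auto simp: wr_eq f_def\<close>)
qed

lemma wr_weight_nonneg: "0 \<le> (1 - s\<^sup>2) powr (d - 1) * (p * (p + d - 2))"
  using p_pos pd by simp

lemma wr_mono:
  assumes "-1 \<le> s" "s \<le> t" "t < 1" and "\<And>x. s < x \<Longrightarrow> x < t \<Longrightarrow> 0 \<le> c * (g x * lam x)"
  shows "c * wr s \<le> c * wr t"
proof (rule DERIV_nonneg_imp_increasing_open[OF assms(2), where f = "\<lambda>x. c * wr x"])
  fix x assume x: "s < x" "x < t"
  have "0 \<le> ((1 - x\<^sup>2) powr (d - 1) * (p * (p + d - 2))) * (c * (g x * lam x))"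
    using assms(4)[OF x] by (rule mult_nonneg_nonneg[OF wr_weight_nonneg])
  then have "0 \<le> c * (((1 - x\<^sup>2) powr (d - 1) * (p * (p + d - 2))) * (g x * lam x))" by (simp only: ac_simps)
  moreover have "((\<lambda>x. c * wr x) has_real_derivative c * (((1 - x\<^sup>2) powr (d - 1) * (p * (p + d - 2))) * (g x * lam x))) (at x)"
    using x assms by (intro DERIV_cmult wr_deriv) auto
  ultimately show "\<exists>y. ((\<lambda>x. c * wr x) has_real_derivative y) (at x) \<and> 0 \<le> y" by blast
qed (use assms in \<open>auto intro!: continuous_intros wr_continuous\<close>)

text \<open>\<open>wr\<close> vanishes at \<open>-1\<close> and at \<open>z0\<close>, and
  \<open>e * lam\<close> changes sign at most once, from plus to minus. As \<open>g < 0\<close>,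
  \<open>e * wr\<close> first falls from \<open>0\<close> and then rises back to
  \<open>0\<close>.\<close>

lemma wr_le_left:
  assumes "-1 < s" "s < z0"
  shows "e * wr s \<le> 0"
proof (cases "0 \<le> e * lam s")
  case True
  have "- e * wr (-1) \<le> - e * wr s"
  proof (rule wr_mono)
    fix x assume x: "-1 < x" "x < s"
    then have "0 \<le> e * lam x" using lam_antimono[of x s] True assms z0 by simp
    moreover have "g x < 0" using z0 x assms by simp
    ultimately have "g x * (e * lam x) \<le> 0" by (simp add: mult_nonpos_nonneg)
    then show "0 \<le> - e * (g x * lam x)" by (simp add: algebra_simps)
  qed (use assms z0 in auto)
  then show ?thesis by (simp add: wr_m1)
next
  case False
  have "e * wr s \<le> e * wr z0"
  proof (rule wr_mono)
    fix x assume x: "s < x" "x < z0"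
    then have "e * lam x \<le> 0" using lam_antimono[of s x] False assms z0 by simp
    moreover have "g x < 0" using z0 x assms by simp
    ultimately have "g x * (e * lam x) \<ge> 0" by (simp add: mult_nonpos_nonpos)
    then show "0 \<le> e * (g x * lam x)" by (simp add: algebra_simps)
  qed (use assms z0 in auto)
  then show ?thesis by (simp add: wr_z0)
qed

lemma wr_le_right:
  assumes "z0 < s" "s < 1" "\<And>x. z0 < x \<Longrightarrow> x < s \<Longrightarrow> 0 < g x"
  shows "e * wr s \<le> 0"
proof -
  have "- e * wr z0 \<le> - e * wr s"
  proof (rule wr_mono)
    fix x assume x: "z0 < x" "x < s"
    then have "e * lam x \<le> 0" using lam_antimono[of z0 x] lam_z0 assms z0 by simp
    moreover have "g x > 0" using assms x by simp
    ultimately have "g x * (e * lam x) \<le> 0" by (simp add: mult_nonneg_nonpos)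
    then show "0 \<le> - e * (g x * lam x)" by (simp add: algebra_simps)
  qed (use assms z0 in auto)
  then show ?thesis by (simp add: wr_z0)
qed

text \<open>The derivative of \<open>vK / g\<close> is the Wronskian over \<open>g\<close>
  squared.\<close>

lemma quotient_antimono:
  assumes "-1 \<le> s" "s \<le> t" "t < 1" and nz: "\<And>x. s \<le> x \<Longrightarrow> x \<le> t \<Longrightarrow> g x \<noteq> 0"
    and w: "\<And>x. s < x \<Longrightarrow> x < t \<Longrightarrow> e * wr x \<le> 0"
  shows "e * (vK t / g t) \<le> e * (vK s / g s)"
proof -
  have "- (e * (vK s / g s)) \<le> - (e * (vK t / g t))"
  proof (rule DERIV_nonneg_imp_increasing_open[OF assms(2), where f = "\<lambda>x. - (e * (vK x / g x))"])
    fix x assume x: "s < x" "x < t"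
    then have x': "-1 < x" "x < 1" "g x \<noteq> 0" using assms(1,3) nz[of x] by auto
    have "1 - x\<^sup>2 > 0" using x' by (simp add: power2_less_1_iff abs_less_iff)
    then have pos: "(1 - x\<^sup>2) powr (d - 1) > 0" by simp
    define y where "y = vK1 x * g x - vK x * g1 x"
    have "(1 - x\<^sup>2) powr (d - 1) * (e * y) \<le> 0"
      using w[OF x] x' by (simp add: wr_eq y_def ac_simps)
    then have "e * y \<le> 0" using pos by (simp add: mult_le_0_iff)
    then have "0 \<le> - (e * (y / (g x * g x)))"
      by (simp add: divide_nonpos_nonneg)
    moreover have "((\<lambda>x. - (e * (vK x / g x))) has_real_derivative - (e * (y / (g x * g x)))) (at x)"
      unfolding y_def using x' by (intro DERIV_minus DERIV_cmult DERIV_divide vK_deriv g_deriv) auto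
    ultimately show "\<exists>y. ((\<lambda>x. - (e * (vK x / g x))) has_real_derivative y) (at x) \<and> 0 \<le> y" by blast
  next
    show "continuous_on {s..t} (\<lambda>x. - (e * (vK x / g x)))"
      using assms by (intro continuous_intros vK_continuous g_continuous) auto
  qed
  then show ?thesis by simp
qed

lemma quotient_limit: "((\<lambda>s. vK s / g s) \<longlongrightarrow> \<alpha>) (at z0)"
proof -
  have "((\<lambda>s. (vK s - vK z0) / (s - z0)) \<longlongrightarrow> vK1 z0) (at z0)"
    using vK_deriv[of z0] z0 by (simp add: has_field_derivative_iff)
  moreover have "((\<lambda>s. (g s - g z0) / (s - z0)) \<longlongrightarrow> g1 z0) (at z0)"
    using g_deriv[of z0] z0 by (simp add: has_field_derivative_iff)
  ultimately have "((\<lambda>s. ((vK s - vK z0) / (s - z0)) / ((g s - g z0) / (s - z0))) \<longlongrightarrow> \<alpha>) (at z0)"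
    unfolding \<alpha>_def using g1_z0 by (intro tendsto_divide) auto
  then show ?thesis
    by (rule Lim_transform_eventually) (simp add: eventually_at_filter vK_z0 z0)
qed

text \<open>On each side of \<open>z0\<close> the quotient \<open>e * (vK s / g s)\<close> is
  nonincreasing, with limit \<open>e * \<alpha>\<close> at \<open>z0\<close>. It is thus at least
  \<open>e * \<alpha>\<close> on the left and at most \<open>e * \<alpha>\<close> on the right; as
  \<open>g\<close> changes sign at \<open>z0\<close>, multiplying by \<open>g s\<close> gives the
  same inequality on both sides. The bound \<open>b\<close> marks an interval to the right of
  \<open>z0\<close> on which \<open>g > 0\<close> is known.\<close>

lemma majorant:
  obtains b where "z0 < b" "b < 1" "\<And>s. -1 \<le> s \<Longrightarrow> s \<le> b \<Longrightarrow> e * vK s \<le> e * (\<alpha> * g s)"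
proof -
  obtain h where h: "h > 0" "\<And>x. 0 < x \<Longrightarrow> x < h \<Longrightarrow> g z0 < g (z0 + x)"
    using DERIV_pos_inc_right[OF g_deriv g1_z0] z0 by auto
  define b where "b = (z0 + min 1 (z0 + h)) / 2"
  have b: "z0 < b" "b < 1" "b < z0 + h" using z0 h(1) by (auto simp: b_def min_def)
  have gpos: "0 < g x" if "z0 < x" "x \<le> b" for x
    using h(2)[of "x - z0"] that b z0 by simp
  have lim: "((\<lambda>s. e * (vK s / g s)) \<longlongrightarrow> e * \<alpha>) (at z0 within S)" for S
    by (intro tendsto_mult_left tendsto_within_subset[OF quotient_limit]) auto
  show ?thesis
  proof (rule that[OF b(1,2)])
    fix s assume s: "-1 \<le> s" "s \<le> b"
    consider "s < z0" | "s = z0" | "z0 < s" by linarith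
    then show "e * vK s \<le> e * (\<alpha> * g s)"
    proof cases
      case 1
      have gs: "g s < 0" using 1 s z0 by simp
      have "eventually (\<lambda>t. t \<in> {s<..<z0}) (at_left z0)"
        using 1 eventually_at_left_real by auto
      then have "\<forall>\<^sub>F t in at_left z0. e * (vK t / g t) \<le> e * (vK s / g s)"
      proof (rule eventually_mono)
        fix t assume t: "t \<in> {s<..<z0}"
        show "e * (vK t / g t) \<le> e * (vK s / g s)"
        proof (rule quotient_antimono)
          fix x assume "s \<le> x" "x \<le> t"
          then show "g x \<noteq> 0" using z0(4)[of x] s t by force
        qed (use s t z0 in \<open>auto intro!: wr_le_left\<close>)
      qed
      then have "e * \<alpha> \<le> e * (vK s / g s)"
        by (rule tendsto_upperbound[OF lim]) (simp add: trivial_limit_at_left_real)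
      then have "e * (vK s / g s) * g s \<le> e * \<alpha> * g s" using gs by (intro mult_right_mono_neg) auto
      then show ?thesis using gs by (simp add: mult.assoc)
    next
      case 2
      then show ?thesis by (simp add: vK_z0 z0)
    next
      case 3
      have gs: "g s > 0" using 3 s gpos by simp
      have "eventually (\<lambda>t. t \<in> {z0<..<s}) (at_right z0)"
        using 3 eventually_at_right_real by auto
      then have "\<forall>\<^sub>F t in at_right z0. e * (vK s / g s) \<le> e * (vK t / g t)"
      proof (rule eventually_mono)
        fix t assume t: "t \<in> {z0<..<s}"
        show "e * (vK s / g s) \<le> e * (vK t / g t)"
        proof (rule quotient_antimono)
          fix x assume "t \<le> x" "x \<le> s"
          then show "g x \<noteq> 0" using gpos[of x] s t by force
        next
          fix x assume "t < x" "x < s"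
          then show "e * wr x \<le> 0" using s t b gpos by (intro wr_le_right) auto
        qed (use s t z0 b in auto)
      qed
      then have "e * (vK s / g s) \<le> e * \<alpha>"
        by (rule tendsto_lowerbound[OF lim]) (simp add: trivial_limit_at_right_real)
      then have "e * (vK s / g s) * g s \<le> e * \<alpha> * g s" using gs by (intro mult_right_mono) auto
      then show ?thesis using gs by (simp add: mult.assoc)
    qed
  qed
qed

definition gam where "gam s = (if s \<le> z0 then \<alpha> * g s else vK s)"

lemma gam_majorizes: "-1 \<le> s \<Longrightarrow> e * vK s \<le> e * gam s"
  using majorant z0 by (metis gam_def less_eq_real_def order.trans order_refl)

text \<open>This replaces twice differentiability at \<open>z0\<close>: the \<open>g\<close> branch
  remains, with the sign \<open>e\<close>, above the glued profile a little beyond the seam, so it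
  can serve as touching function at the seam.\<close>

lemma gam_le_near:
  obtains b where "z0 < b" "b < 1" "\<And>s. -1 \<le> s \<Longrightarrow> s < b \<Longrightarrow> e * gam s \<le> e * (\<alpha> * g s)"
proof -
  obtain b where b: "z0 < b" "b < 1" "\<And>s. -1 \<le> s \<Longrightarrow> s \<le> b \<Longrightarrow> e * vK s \<le> e * (\<alpha> * g s)"
    by (rule majorant) blast
  show ?thesis by (rule that[of b]) (use b in \<open>auto simp: gam_def\<close>)
qed

lemma gam_continuous: "continuous_on {-1..1} gam"
proof -
  have eq: "{-1..1} = {-1..z0} \<union> {z0..1}" using z0 by auto
  have "continuous_on ({-1..z0} \<union> {z0..1}) (\<lambda>s. if s \<le> z0 then \<alpha> * g s else vK s)"
  proof (rule continuous_on_cases)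
    show "continuous_on {-1..z0} (\<lambda>s. \<alpha> * g s)" "continuous_on {z0..1} vK"
      using z0 by (auto intro!: continuous_intros g_continuous vK_continuous)
    show "\<forall>s. s \<in> {-1..z0} \<and> \<not> s \<le> z0 \<or> s \<in> {z0..1} \<and> s \<le> z0 \<longrightarrow> \<alpha> * g s = vK s"
    proof (intro allI impI)
      fix s assume "s \<in> {-1..z0} \<and> \<not> s \<le> z0 \<or> s \<in> {z0..1} \<and> s \<le> z0"
      then have "s = z0" by auto
      then show "\<alpha> * g s = vK s" by (simp add: vK_z0 z0)
    qed
  qed auto
  then show ?thesis by (simp add: eq gam_def[abs_def])
qed

end

section \<open>The special function\<close>

lemma jet_powr:
  assumes "0 < r"
  shows "jet (\<lambda>t. t powr p) r (p * r powr (p - 1)) (p * (p - 1) * r powr (p - 2))"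
proof (rule jet_real_taylor)
  have D: "((\<lambda>t. t powr c) has_real_derivative c * y powr (c - 1)) (at y)" if "0 < y" for y c :: real
    using DERIV_fun_powr[of "\<lambda>t. t" 1 y c] that by simp
  show "\<forall>\<^sub>F y in nhds r. ((\<lambda>t. t powr p) has_real_derivative p * y powr (p - 1)) (at y)"
    using eventually_nhds_in_open[of "{0<..}" r] assms D by (auto elim: eventually_mono)
  show "((\<lambda>y. p * y powr (p - 1)) has_real_derivative p * (p - 1) * r powr (p - 2)) (at r)"
    using DERIV_cmult[OF D[OF assms, of "p - 1"], of p] by (simp add: algebra_simps)
qed

lemma jet_inverse:
  fixes r :: real
  assumes "0 < r"
  shows "jet inverse r (- (1 / r\<^sup>2)) (2 / r ^ 3)"
proof (rule jet_real_taylor)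
  show "\<forall>\<^sub>F y in nhds r. (inverse has_real_derivative - (1 / y\<^sup>2)) (at y)"
    using eventually_nhds_in_open[of "{0<..}" r] assms
    by (auto elim!: eventually_mono intro!: derivative_eq_intros simp: power2_eq_square divide_simps)
  show "((\<lambda>y. - (1 / y\<^sup>2)) has_real_derivative 2 / r ^ 3) (at r)"
    using assms by (auto intro!: derivative_eq_intros simp: divide_simps power2_eq_square power3_eq_cube)
qed

lemma jet_ratio:
  fixes u v :: "'a::euclidean_space \<Rightarrow> real"
  assumes u: "jet u x a lu" and v: "jet v x b lv"
    and R: "R = u x + v x" "0 < R" and s: "s = (v x - u x) / R"
  shows "jet (\<lambda>y. (v y - u y) / (u y + v y)) x ((1 / R) *\<^sub>R ((1 - s) *\<^sub>R b - (1 + s) *\<^sub>R a))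
    ((lv - lu - s * (lu + lv)) / R + 2 * (s * (a \<bullet> a + b \<bullet> b + 2 * (a \<bullet> b)) - (b \<bullet> b - a \<bullet> a)) / R\<^sup>2)"
proof -
  have i: "jet (\<lambda>y. inverse (u y + v y)) x ((- (1 / R\<^sup>2)) *\<^sub>R (a + b))
      (- (1 / R\<^sup>2) * (lu + lv) + 2 / R ^ 3 * ((a + b) \<bullet> (a + b)))"
    using R by (intro jet_compose[of "\<lambda>y. u y + v y" x "a + b" "lu + lv" inverse] jet_add u v) (auto intro: jet_inverse)
  have S: "jet (\<lambda>y. v y + (-1) * u y) x (b + (-1) *\<^sub>R a) (lv + (-1) * lu)"
    by (intro jet_add jet_scale u v)
  have vu: "v x + (-1) * u x = s * R" "u x + v x = R" using s R by auto
  have R0: "R \<noteq> 0" using R by simp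
  have "jet (\<lambda>y. (v y + (-1) * u y) * inverse (u y + v y)) x
    ((s * R) *\<^sub>R ((- (1 / R\<^sup>2)) *\<^sub>R (a + b)) + inverse R *\<^sub>R (b + (-1) *\<^sub>R a))
    ((s * R) * (- (1 / R\<^sup>2) * (lu + lv) + 2 / R ^ 3 * ((a + b) \<bullet> (a + b))) + inverse R * (lv + (-1) * lu)
      + 2 * ((b + (-1) *\<^sub>R a) \<bullet> ((- (1 / R\<^sup>2)) *\<^sub>R (a + b))))"
    using jet_mult[OF S i] by (simp only: vu)
  moreover have "(\<lambda>y. (v y + (-1) * u y) * inverse (u y + v y)) = (\<lambda>y. (v y - u y) / (u y + v y))"
    by (simp add: divide_inverse)
  moreover have "(s * R) *\<^sub>R ((- (1 / R\<^sup>2)) *\<^sub>R (a + b)) + inverse R *\<^sub>R (b + (-1) *\<^sub>R a)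
    = (1 / R) *\<^sub>R ((1 - s) *\<^sub>R b - (1 + s) *\<^sub>R a)"
  proof -
    have "(s * R) * (- (1 / R\<^sup>2)) = - (s / R)" using R0 by (simp add: power2_eq_square)
    then have "(s * R) *\<^sub>R ((- (1 / R\<^sup>2)) *\<^sub>R (a + b)) = (- (s / R)) *\<^sub>R (a + b)"
      by (simp only: scaleR_scaleR)
    then show ?thesis by (simp only:) (simp add: divide_inverse algebra_simps)
  qed
  moreover have "(s * R) * (- (1 / R\<^sup>2) * (lu + lv) + 2 / R ^ 3 * ((a + b) \<bullet> (a + b))) + inverse R * (lv + (-1) * lu)
      + 2 * ((b + (-1) *\<^sub>R a) \<bullet> ((- (1 / R\<^sup>2)) *\<^sub>R (a + b)))
    = (lv - lu - s * (lu + lv)) / R + 2 * (s * (a \<bullet> a + b \<bullet> b + 2 * (a \<bullet> b)) - (b \<bullet> b - a \<bullet> a)) / R\<^sup>2"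
  proof -
    have "(a + b) \<bullet> (a + b) = a \<bullet> a + b \<bullet> b + 2 * (a \<bullet> b)"
      by (simp add: inner_add_left inner_add_right inner_commute)
    moreover have "(b + (-1) *\<^sub>R a) \<bullet> ((- (1 / R\<^sup>2)) *\<^sub>R (a + b)) = - (1 / R\<^sup>2) * (b \<bullet> b - a \<bullet> a)"
      by (simp add: inner_add_left inner_diff_left inner_add_right inner_diff_right inner_commute)
    ultimately show ?thesis
      using R0 by (simp only:) (simp add: field_simps power2_eq_square power3_eq_cube)
  qed
  ultimately show ?thesis by simp
qed

text \<open>With \<Phi> the homogeneous extension
  \<open>(x + y) powr p * \<psi> ((y - x) / (x + y))\<close>, the five brackets are, up to powers of
  \<open>R\<close>, its derivatives in \<open>x\<close>, \<open>y\<close>, \<open>xx\<close>,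
  \<open>yy\<close> and \<open>xy\<close>, in this order.\<close>

lemma jet_homogeneous:
  fixes u v :: "'a::euclidean_space \<Rightarrow> real"
  assumes u: "jet u x a lu" and v: "jet v x b lv"
    and R: "R = u x + v x" "0 < R" and s: "s = (v x - u x) / R" and \<psi>: "jet \<psi> s \<psi>1 \<psi>2"
  shows "\<exists>c. jet (\<lambda>y. (u y + v y) powr p * \<psi> ((v y - u y) / (u y + v y))) x c
    (R powr (p - 2) *
      (R * lu * (p * \<psi> s - (1 + s) * \<psi>1) + R * lv * (p * \<psi> s + (1 - s) * \<psi>1)
       + (a \<bullet> a) * (p * (p - 1) * \<psi> s - 2 * (p - 1) * (1 + s) * \<psi>1 + (1 + s)\<^sup>2 * \<psi>2)
       + (b \<bullet> b) * (p * (p - 1) * \<psi> s + 2 * (p - 1) * (1 - s) * \<psi>1 + (1 - s)\<^sup>2 * \<psi>2)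
       + 2 * (a \<bullet> b) * (p * (p - 1) * \<psi> s - 2 * (p - 1) * s * \<psi>1 - (1 - s\<^sup>2) * \<psi>2)))"
proof -
  define A B C where "A = a \<bullet> a" and "B = b \<bullet> b" and "C = a \<bullet> b"
  define c where "c = (1 / R) *\<^sub>R ((1 - s) *\<^sub>R b - (1 + s) *\<^sub>R a)"
  define W where "W = R powr (p - 2)"
  have pw: "R powr (p - 1) = R * W" "R powr p = R * (R * W)"
    unfolding W_def using powr_add[of R 1 "p - 2"] powr_add[of R 2 "p - 2"] R by (simp_all add: power2_eq_square)
  have ratio: "jet (\<lambda>y. (v y - u y) / (u y + v y)) x c
    ((lv - lu - s * (lu + lv)) / R + 2 * (s * (A + B + 2 * C) - (B - A)) / R\<^sup>2)"
    unfolding A_def B_def C_def c_def using u v R s by (rule jet_ratio)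
  have T: "jet (\<lambda>y. \<psi> ((v y - u y) / (u y + v y))) x (\<psi>1 *\<^sub>R c)
    (\<psi>1 * ((lv - lu - s * (lu + lv)) / R + 2 * (s * (A + B + 2 * C) - (B - A)) / R\<^sup>2) + \<psi>2 * (c \<bullet> c))"
    using ratio \<psi> s R by (intro jet_compose) auto
  have P: "jet (\<lambda>y. (u y + v y) powr p) x ((p * R powr (p - 1)) *\<^sub>R (a + b))
    (p * R powr (p - 1) * (lu + lv) + p * (p - 1) * R powr (p - 2) * ((a + b) \<bullet> (a + b)))"
    using R by (intro jet_compose[of "\<lambda>y. u y + v y" x "a + b" "lu + lv"] jet_add u v) (auto intro: jet_powr)
  have dots: "(a + b) \<bullet> (a + b) = A + B + 2 * C" "(a + b) \<bullet> c = ((1 - s) * (B + C) - (1 + s) * (A + C)) / R"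
    "c \<bullet> c = ((1 - s)\<^sup>2 * B - 2 * (1 - s\<^sup>2) * C + (1 + s)\<^sup>2 * A) / R\<^sup>2"
    unfolding A_def B_def C_def c_def
    by (simp_all add: inner_add_left inner_add_right inner_diff_left inner_diff_right inner_commute[of b a]
        power2_eq_square algebra_simps add_divide_distrib diff_divide_distrib)
  have "jet (\<lambda>y. (u y + v y) powr p * \<psi> ((v y - u y) / (u y + v y))) x
    ((R powr p) *\<^sub>R (\<psi>1 *\<^sub>R c) + \<psi> s *\<^sub>R ((p * R powr (p - 1)) *\<^sub>R (a + b)))
    (R powr p * (\<psi>1 * ((lv - lu - s * (lu + lv)) / R + 2 * (s * (A + B + 2 * C) - (B - A)) / R\<^sup>2) + \<psi>2 * (c \<bullet> c))
     + \<psi> s * (p * R powr (p - 1) * (lu + lv) + p * (p - 1) * R powr (p - 2) * ((a + b) \<bullet> (a + b)))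
     + 2 * (((p * R powr (p - 1)) *\<^sub>R (a + b)) \<bullet> (\<psi>1 *\<^sub>R c)))"
    using jet_mult[OF P T] by (simp only: R(1)[symmetric] s[symmetric])
  moreover have "(R powr p * (\<psi>1 * ((lv - lu - s * (lu + lv)) / R + 2 * (s * (A + B + 2 * C) - (B - A)) / R\<^sup>2) + \<psi>2 * (c \<bullet> c))
     + \<psi> s * (p * R powr (p - 1) * (lu + lv) + p * (p - 1) * R powr (p - 2) * ((a + b) \<bullet> (a + b)))
     + 2 * (((p * R powr (p - 1)) *\<^sub>R (a + b)) \<bullet> (\<psi>1 *\<^sub>R c))) =
    W * (R * lu * (p * \<psi> s - (1 + s) * \<psi>1) + R * lv * (p * \<psi> s + (1 - s) * \<psi>1)
       + A * (p * (p - 1) * \<psi> s - 2 * (p - 1) * (1 + s) * \<psi>1 + (1 + s)\<^sup>2 * \<psi>2)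
       + B * (p * (p - 1) * \<psi> s + 2 * (p - 1) * (1 - s) * \<psi>1 + (1 - s)\<^sup>2 * \<psi>2)
       + 2 * C * (p * (p - 1) * \<psi> s - 2 * (p - 1) * s * \<psi>1 - (1 - s\<^sup>2) * \<psi>2))"
    (is "?L = ?R")
  proof -
    have R0: "R \<noteq> 0" using R by simp
    have 1: "R powr p * (\<psi>1 * ((lv - lu - s * (lu + lv)) / R + 2 * (s * (A + B + 2 * C) - (B - A)) / R\<^sup>2) + \<psi>2 * (c \<bullet> c))
      = W * (\<psi>1 * (R * (lv - lu - s * (lu + lv)) + 2 * (s * (A + B + 2 * C) - (B - A))) + \<psi>2 * ((1 - s)\<^sup>2 * B - 2 * (1 - s\<^sup>2) * C + (1 + s)\<^sup>2 * A))"
      unfolding pw dots using R0 by (simp add: field_simps power2_eq_square)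
    have 2: "((p * R powr (p - 1)) *\<^sub>R (a + b)) \<bullet> (\<psi>1 *\<^sub>R c) = W * (p * \<psi>1 * ((1 - s) * (B + C) - (1 + s) * (A + C)))"
      unfolding pw inner_scaleR_left inner_scaleR_right dots using R0 by simp
    show ?thesis
      unfolding 1 2 dots(1) unfolding pw W_def[symmetric]
      by (simp add: power2_eq_square algebra_simps)
  qed
  ultimately show ?thesis by (auto simp: A_def B_def C_def W_def)
qed

text \<open>The form equals \<open>h * ((\<alpha> - \<beta>)\<^sup>2 + 2 * (c + \<alpha> * \<beta>))
  - 2 * n * \<psi>1 * (\<alpha>\<^sup>2 - \<beta>\<^sup>2)\<close>. It vanishes for
  \<open>\<beta> = \<alpha>\<close> and \<open>c = - (\<alpha> * \<beta>)\<close>, that is, for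
  opposite gradients of equal length.\<close>

lemma quadratic_form_nonpos:
  fixes \<alpha> \<beta> c h n \<psi>1 :: real
  assumes "0 \<le> \<beta>" "\<beta> \<le> \<alpha>" "\<bar>c\<bar> \<le> \<alpha> * \<beta>" "h \<le> 0" "0 \<le> n" "0 \<le> \<psi>1"
  shows "\<alpha>\<^sup>2 * (h - 2 * n * \<psi>1) + \<beta>\<^sup>2 * (h + 2 * n * \<psi>1) + 2 * c * h \<le> 0"
proof -
  have "0 \<le> (c + \<alpha> * \<beta>) * (- h)" using assms by (intro mult_nonneg_nonneg) auto
  moreover have "0 \<le> (- h) * (\<alpha> - \<beta>)\<^sup>2" using assms by (intro mult_nonneg_nonneg) auto
  moreover have "\<beta>\<^sup>2 \<le> \<alpha>\<^sup>2" using assms by (intro power_mono) auto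
  then have "0 \<le> (n * \<psi>1) * (\<alpha>\<^sup>2 - \<beta>\<^sup>2)" using assms by (intro mult_nonneg_nonneg) auto
  ultimately show ?thesis by (simp add: power2_eq_square algebra_simps)
qed

text \<open>Here \<open>R * (1 - s) / 2\<close> and \<open>R * (1 + s) / 2\<close> are the values of
  \<open>u\<close> and \<open>v\<close>. The signs of the first derivatives (\<open>du\<close>,
  \<open>dv\<close>) allow \<open>lu\<close> and \<open>lv\<close> to be replaced by their bounds.
  Then the equation turns the coefficients of the squared gradients into
  \<open>h - 2 * n * \<psi>1\<close> and \<open>h + 2 * n * \<psi>1\<close>, where \<open>h\<close>
  is the mixed derivative.\<close>

lemma homogeneous_operator_nonpos:
  fixes a b :: "'a::real_inner" and p d s R lu lv \<psi>0 \<psi>1 \<psi>2 :: real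
  assumes s: "-1 < s" "s < 1" and d: "1 < d" "2 \<le> p + d"
    and lu: "(d - 1) * (norm a)\<^sup>2 \<le> (R * (1 - s) / 2) * lu"
    and lv: "(R * (1 + s) / 2) * lv \<le> (d - 1) * (norm b)\<^sup>2"
    and ab: "norm b \<le> norm a"
    and ode: "(1 - s\<^sup>2) * \<psi>2 - 2 * (d - 1) * s * \<psi>1 + p * (d - 1) * \<psi>0 = 0"
    and \<psi>1: "0 \<le> \<psi>1" and cross: "p * \<psi>0 \<le> 2 * s * \<psi>1"
    and du: "p * \<psi>0 \<le> (1 + s) * \<psi>1" and dv: "0 \<le> p * \<psi>0 + (1 - s) * \<psi>1"
  shows "R * lu * (p * \<psi>0 - (1 + s) * \<psi>1) + R * lv * (p * \<psi>0 + (1 - s) * \<psi>1)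
       + (a \<bullet> a) * (p * (p - 1) * \<psi>0 - 2 * (p - 1) * (1 + s) * \<psi>1 + (1 + s)\<^sup>2 * \<psi>2)
       + (b \<bullet> b) * (p * (p - 1) * \<psi>0 + 2 * (p - 1) * (1 - s) * \<psi>1 + (1 - s)\<^sup>2 * \<psi>2)
       + 2 * (a \<bullet> b) * (p * (p - 1) * \<psi>0 - 2 * (p - 1) * s * \<psi>1 - (1 - s\<^sup>2) * \<psi>2) \<le> 0"
proof -
  define h n where "h = (p + d - 2) * (p * \<psi>0 - 2 * s * \<psi>1)" and "n = p + d - 2"
  define A0 where "A0 = p * (p - 1) * \<psi>0 - 2 * (p - 1) * (1 + s) * \<psi>1 + (1 + s)\<^sup>2 * \<psi>2"
  define B0 where "B0 = p * (p - 1) * \<psi>0 + 2 * (p - 1) * (1 - s) * \<psi>1 + (1 - s)\<^sup>2 * \<psi>2"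
  define U where "U = p * \<psi>0 - (1 + s) * \<psi>1"
  define V where "V = p * \<psi>0 + (1 - s) * \<psi>1"
  have pos: "0 < 1 - s" "0 < 1 + s" using s by auto
  have ode': "(1 - s) * (1 + s) * \<psi>2 = (d - 1) * (2 * s * \<psi>1 - p * \<psi>0)"
    using ode by (simp add: power2_eq_square algebra_simps)
  have H: "p * (p - 1) * \<psi>0 - 2 * (p - 1) * s * \<psi>1 - (1 - s\<^sup>2) * \<psi>2 = h"
    using ode by (simp add: h_def algebra_simps)
  have "(1 - s) * ((1 + s)\<^sup>2 * \<psi>2) = (1 + s) * ((1 - s) * (1 + s) * \<psi>2)"
    by (simp add: power2_eq_square)
  also have "\<dots> = (1 + s) * ((d - 1) * (2 * s * \<psi>1 - p * \<psi>0))" by (simp only: ode')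
  finally have A: "2 * (d - 1) * U + (1 - s) * A0 = (1 - s) * (h - 2 * n * \<psi>1)"
    by (simp add: U_def A0_def h_def n_def algebra_simps)
  have "(1 + s) * ((1 - s)\<^sup>2 * \<psi>2) = (1 - s) * ((1 - s) * (1 + s) * \<psi>2)"
    by (simp add: power2_eq_square)
  also have "\<dots> = (1 - s) * ((d - 1) * (2 * s * \<psi>1 - p * \<psi>0))" by (simp only: ode')
  finally have B: "2 * (d - 1) * V + (1 + s) * B0 = (1 + s) * (h + 2 * n * \<psi>1)"
    by (simp add: V_def B0_def h_def n_def algebra_simps)
  have "(1 - s) * (R * lu * U + (norm a)\<^sup>2 * A0) \<le> (1 - s) * ((norm a)\<^sup>2 * (h - 2 * n * \<psi>1))"
  proof -
    have "((R * (1 - s) / 2) * lu) * (2 * U) \<le> ((d - 1) * (norm a)\<^sup>2) * (2 * U)"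
      using lu du by (intro mult_right_mono_neg) (auto simp: U_def)
    moreover have "((R * (1 - s) / 2) * lu) * (2 * U) = (1 - s) * (R * lu * U)" by simp
    moreover have "((d - 1) * (norm a)\<^sup>2) * (2 * U) = (norm a)\<^sup>2 * (2 * (d - 1) * U)" by simp
    ultimately have "(1 - s) * (R * lu * U) \<le> (norm a)\<^sup>2 * (2 * (d - 1) * U)" by (simp only:)
    then have "(1 - s) * (R * lu * U + (norm a)\<^sup>2 * A0) \<le> (norm a)\<^sup>2 * (2 * (d - 1) * U + (1 - s) * A0)"
      by (simp add: algebra_simps)
    then show ?thesis unfolding A by (simp only: ac_simps)
  qed
  then have 1: "R * lu * U + (norm a)\<^sup>2 * A0 \<le> (norm a)\<^sup>2 * (h - 2 * n * \<psi>1)" using pos(1) by simp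
  have "(1 + s) * (R * lv * V + (norm b)\<^sup>2 * B0) \<le> (1 + s) * ((norm b)\<^sup>2 * (h + 2 * n * \<psi>1))"
  proof -
    have "((R * (1 + s) / 2) * lv) * (2 * V) \<le> ((d - 1) * (norm b)\<^sup>2) * (2 * V)"
      using lv dv by (intro mult_right_mono) (auto simp: V_def)
    moreover have "((R * (1 + s) / 2) * lv) * (2 * V) = (1 + s) * (R * lv * V)" by simp
    moreover have "((d - 1) * (norm b)\<^sup>2) * (2 * V) = (norm b)\<^sup>2 * (2 * (d - 1) * V)" by simp
    ultimately have "(1 + s) * (R * lv * V) \<le> (norm b)\<^sup>2 * (2 * (d - 1) * V)" by (simp only:)
    then have "(1 + s) * (R * lv * V + (norm b)\<^sup>2 * B0) \<le> (norm b)\<^sup>2 * (2 * (d - 1) * V + (1 + s) * B0)"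
      by (simp add: algebra_simps)
    then show ?thesis unfolding B by (simp only: ac_simps)
  qed
  then have 2: "R * lv * V + (norm b)\<^sup>2 * B0 \<le> (norm b)\<^sup>2 * (h + 2 * n * \<psi>1)" using pos(2) by simp
  have "h \<le> 0" unfolding h_def using d cross by (intro mult_nonneg_nonpos) auto
  then have "(norm a)\<^sup>2 * (h - 2 * n * \<psi>1) + (norm b)\<^sup>2 * (h + 2 * n * \<psi>1) + 2 * (a \<bullet> b) * h \<le> 0"
    using ab d \<psi>1 by (intro quadratic_form_nonpos) (auto simp: n_def Cauchy_Schwarz_ineq2)
  with 1 2 show ?thesis
    unfolding H A0_def[symmetric] B0_def[symmetric] U_def[symmetric] V_def[symmetric] dot_square_norm by linarith
qed

section \<open>Viscosity supersolutions built from powers\<close>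

lemma visc_super_cong:
  assumes "visc_super F x" "\<forall>\<^sub>F y in nhds x. G y = F y"
  shows "visc_super G x"
proof -
  obtain \<phi> b l where "jet \<phi> x b l" "\<phi> x = F x" "\<forall>\<^sub>F y in nhds x. F y \<le> \<phi> y" "l \<le> 0"
    using assms(1) unfolding visc_super_def by blast
  moreover have "G x = F x" using assms(2) by (rule eventually_nhds_x_imp_x)
  moreover have "\<forall>\<^sub>F y in nhds x. G y \<le> \<phi> y"
    using assms(2) calculation(3) by eventually_elim simp
  ultimately show ?thesis by (intro visc_superI[of \<phi> x b l]) auto
qed

lemma jet_eventually_pos:
  assumes "jet f x b l" "c < f x"
  shows "\<forall>\<^sub>F y in nhds x. c < f y"
proof -
  have "(f \<longlongrightarrow> f x) (nhds x)"
    using jet_continuous[OF assms(1)] by (simp add: isCont_def flip: tendsto_at_iff_tendsto_nhds)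
  then show ?thesis using assms(2) by (rule order_tendstoD(1))
qed

lemma jet_eventually_less:
  assumes "jet f x b l" "f x < c"
  shows "\<forall>\<^sub>F y in nhds x. f y < c"
proof -
  have "(f \<longlongrightarrow> f x) (nhds x)"
    using jet_continuous[OF assms(1)] by (simp add: isCont_def flip: tendsto_at_iff_tendsto_nhds)
  then show ?thesis using assms(2) by (rule order_tendstoD(2))
qed

text \<open>The right-hand side is the Laplacian of a power of \<open>u\<close> when
  \<open>A\<close> is the squared gradient. \<open>A\<close> may have either sign, so that negated
  data turn the statement into an upper bound for the power of \<open>v\<close>.\<close>

lemma powr_operator_ge:
  fixes p q u lu A :: real
  assumes "0 < u" "q * A \<le> u * lu" "0 \<le> p"
  shows "p * (p - 1 + q) * (u powr (p - 2) * A) \<le> p * u powr (p - 1) * lu + p * (p - 1) * u powr (p - 2) * A"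
proof -
  have "u powr (p - 1) = u * u powr (p - 2)" using powr_add[of u 1 "p - 2"] assms(1) by simp
  moreover have "(p * u powr (p - 2)) * (q * A) \<le> (p * u powr (p - 2)) * (u * lu)"
    using assms by (intro mult_left_mono) auto
  ultimately show ?thesis by (simp add: algebra_simps)
qed

lemma visc_super_powers:
  fixes u v :: "'a::euclidean_space \<Rightarrow> real"
  assumes u: "jet u x a lu" "0 < u x" and v: "jet v x b lv" "0 < v x"
    and cM: "0 \<le> c" "0 \<le> M" and p: "0 < p" "2 \<le> p + d" and ab: "norm b \<le> norm a"
    and lu: "(d - 1) * (norm a)\<^sup>2 \<le> u x * lu" and lv: "v x * lv \<le> (d - 1) * (norm b)\<^sup>2"
    and le: "v x powr (p - 2) \<le> c * u x powr (p - 2)"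
  shows "visc_super (\<lambda>y. M * (v y powr p - c * u y powr p)) x"
proof (rule visc_superI)
  define Lu where "Lu = p * u x powr (p - 1) * lu + p * (p - 1) * u x powr (p - 2) * (a \<bullet> a)"
  define Lv where "Lv = p * v x powr (p - 1) * lv + p * (p - 1) * v x powr (p - 2) * (b \<bullet> b)"
  show "jet (\<lambda>y. M * (v y powr p + (- c) * u y powr p)) x
      (M *\<^sub>R ((p * v x powr (p - 1)) *\<^sub>R b + (- c) *\<^sub>R ((p * u x powr (p - 1)) *\<^sub>R a)))
      (M * (Lv + (- c) * Lu))"
    unfolding Lu_def Lv_def using u v by (intro jet_scale jet_add jet_compose jet_powr)
  have 1: "p * (p - 1 + (d - 1)) * (u x powr (p - 2) * (norm a)\<^sup>2) \<le> Lu"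
    unfolding Lu_def dot_square_norm using u lu p by (intro powr_operator_ge) auto
  have "p * (p - 1 + (d - 1)) * (v x powr (p - 2) * - (norm b)\<^sup>2)
     \<le> p * v x powr (p - 1) * (- lv) + p * (p - 1) * v x powr (p - 2) * - (norm b)\<^sup>2"
    using v lv p by (intro powr_operator_ge) auto
  then have 2: "Lv \<le> p * (p - 1 + (d - 1)) * (v x powr (p - 2) * (norm b)\<^sup>2)"
    unfolding Lv_def dot_square_norm by simp
  have "v x powr (p - 2) * (norm b)\<^sup>2 \<le> c * u x powr (p - 2) * (norm a)\<^sup>2"
    using le ab cM by (intro mult_mono power_mono) auto
  then have "p * (p - 1 + (d - 1)) * (v x powr (p - 2) * (norm b)\<^sup>2) \<le> p * (p - 1 + (d - 1)) * (c * u x powr (p - 2) * (norm a)\<^sup>2)"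
    using p by (intro mult_left_mono) auto
  also have "\<dots> = c * (p * (p - 1 + (d - 1)) * (u x powr (p - 2) * (norm a)\<^sup>2))" by simp
  also have "\<dots> \<le> c * Lu" using 1 cM by (intro mult_left_mono)
  finally have "Lv \<le> c * Lu" using 2 by linarith
  then show "M * (Lv + (- c) * Lu) \<le> 0" using cM by (intro mult_nonneg_nonpos) auto
qed (auto intro: always_eventually)

text \<open>At a zero of \<open>v\<close> the power \<open>v powr p\<close> is replaced by the
  square of \<open>v\<close>, which dominates it while \<open>v \<le> 1\<close>. The zero is a
  minimum, so the gradient of \<open>v\<close> vanishes and the square has Laplacian
  \<open>0\<close> there.\<close>

lemma visc_super_powers_zero:
  fixes u v :: "'a::euclidean_space \<Rightarrow> real"
  assumes u: "jet u x a lu" "0 < u x" and v: "jet v x b lv" "v x = 0" "\<forall>\<^sub>F y in nhds x. 0 \<le> v y"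
    and cM: "0 \<le> c" "0 \<le> M" and p: "2 < p" and d: "1 < d"
    and lu: "(d - 1) * (norm a)\<^sup>2 \<le> u x * lu"
  shows "visc_super (\<lambda>y. M * (v y powr p - c * u y powr p)) x"
proof (rule visc_superI)
  define Lu where "Lu = p * u x powr (p - 1) * lu + p * (p - 1) * u x powr (p - 2) * (a \<bullet> a)"
  define Lv where "Lv = 2 * v x * lv + 2 * (b \<bullet> b)"
  have b: "b = 0" using jet_local_min(1)[OF v(1)] v(2,3) by simp
  show "jet (\<lambda>y. M * ((v y)\<^sup>2 + (- c) * u y powr p)) x
      (M *\<^sub>R ((2 * v x) *\<^sub>R b + (- c) *\<^sub>R ((p * u x powr (p - 1)) *\<^sub>R a)))
      (M * (Lv + (- c) * Lu))"
    unfolding Lu_def Lv_def using u v by (intro jet_scale jet_add jet_compose[where \<psi> = "\<lambda>t. t powr p"] jet_powr jet_power2)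
  have "p * (p - 1 + (d - 1)) * (u x powr (p - 2) * (norm a)\<^sup>2) \<le> Lu"
    unfolding Lu_def dot_square_norm using u lu p by (intro powr_operator_ge) auto
  moreover have "0 \<le> p * (p - 1 + (d - 1)) * (u x powr (p - 2) * (norm a)\<^sup>2)" using p d by simp
  ultimately have "0 \<le> c * Lu" using cM by simp
  moreover have "Lv = 0" using b v by (simp add: Lv_def)
  ultimately show "M * (Lv + (- c) * Lu) \<le> 0" using cM by (simp add: mult_nonneg_nonneg)
  have "\<forall>\<^sub>F y in nhds x. v y < 1" using v by (intro jet_eventually_less) auto
  with v(3) show "\<forall>\<^sub>F y in nhds x. M * (v y powr p - c * u y powr p) \<le> M * ((v y)\<^sup>2 + (- c) * u y powr p)"
  proof eventually_elim
    case (elim y)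
    have "v y powr p \<le> (v y)\<^sup>2"
    proof (cases "v y = 0")
      case False
      then have "v y powr p \<le> v y powr 2" using elim p by (intro powr_mono') auto
      then show ?thesis using elim False by simp
    qed simp
    then show ?case using cM by (intro mult_left_mono) auto
  qed
qed (use v p in auto)

section \<open>The glued homogeneous function\<close>

context bessel_ode
begin

definition hom where "hom s t = (s + t) powr p * gam ((t - s) / (s + t))"

lemma hom_powers:
  assumes "0 \<le> s" "0 \<le> t" "0 < s + t"
  shows "(s + t) powr p * vK ((t - s) / (s + t)) = 2 powr p * (t powr p - K powr p * s powr p)"
proof -
  have eq: "1 + (t - s) / (s + t) = 2 * t / (s + t)" "1 - (t - s) / (s + t) = 2 * s / (s + t)"
    using assms by (auto simp: field_simps)
  show ?thesis
    unfolding vK_def eq using assms by (simp add: powr_divide powr_mult right_diff_distrib)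
qed

lemma ratio_bounds:
  fixes s t :: real
  assumes "0 \<le> s" "0 \<le> t" "0 < s + t"
  shows "-1 \<le> (t - s) / (s + t)" "(t - s) / (s + t) \<le> 1" "0 < s \<Longrightarrow> (t - s) / (s + t) < 1" "0 < t \<Longrightarrow> -1 < (t - s) / (s + t)"
  using assms by (auto simp: field_simps)

lemma hom_majorizes:
  assumes "0 \<le> s" "0 \<le> t" "0 < s + t"
  shows "e * (2 powr p * (t powr p - K powr p * s powr p)) \<le> e * hom s t"
proof -
  have "(s + t) powr p * (e * vK ((t - s) / (s + t))) \<le> (s + t) powr p * (e * gam ((t - s) / (s + t)))"
    using ratio_bounds[OF assms] by (intro mult_left_mono gam_majorizes) auto
  then show ?thesis unfolding hom_def hom_powers[OF assms, symmetric] by (simp only: ac_simps)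
qed

lemma hom_continuous:
  assumes "continuous_on S u" "continuous_on S v" "\<And>x. x \<in> S \<Longrightarrow> 0 \<le> u x \<and> 0 \<le> v x \<and> 0 < u x + v x"
  shows "continuous_on S (\<lambda>x. hom (u x) (v x))"
proof -
  have "continuous_on S (\<lambda>x. gam ((v x - u x) / (u x + v x)))"
    using assms(3) ratio_bounds assms
    by (intro continuous_on_compose2[OF gam_continuous] continuous_intros) (force simp: add_pos_nonneg)+
  moreover have "continuous_on S (\<lambda>x. (u x + v x) powr p)"
    using assms p_pos by (intro continuous_on_powr' continuous_intros) force+
  ultimately show ?thesis unfolding hom_def by (intro continuous_on_mult)
qed

lemma ratio_gt_z0:
  assumes "0 \<le> s" "0 \<le> t" "0 < s + t"
  shows "z0 < (t - s) / (s + t) \<longleftrightarrow> K * s < t"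
  using assms z0 by (simp add: K_def field_simps)

text \<open>Because \<open>z0 \<ge> 0\<close> for \<open>p \<le> 2\<close>, the region
  \<open>t \<le> s\<close> lies in the \<open>g\<close> branch, where
  \<open>g \<le> 0\<close>.\<close>

lemma hom_nonpos:
  assumes "p \<le> 2" "0 < s" "0 \<le> t" "t \<le> s"
  shows "hom s t \<le> 0"
proof -
  have "(t - s) / (s + t) \<le> 0" using assms by (simp add: field_simps)
  then have le: "(t - s) / (s + t) \<le> z0" using z0_sign[of 1] assms by simp
  have "g ((t - s) / (s + t)) \<le> 0"
    using z0(3) z0(4)[of "(t - s) / (s + t)"] ratio_bounds[of s t] assms le by (cases "(t - s) / (s + t) = z0") auto
  then have "(s + t) powr p * (\<alpha> * g ((t - s) / (s + t))) \<le> 0"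
    using alpha_pos by (intro mult_nonneg_nonpos) auto
  then show ?thesis using le by (simp add: hom_def gam_def)
qed

text \<open>Because \<open>z0 \<le> 0\<close> for \<open>p > 2\<close>, the exchanged pair lies on
  the power branch or on the seam, and \<open>K \<le> 1\<close> gives the sign.\<close>

lemma hom_nonneg:
  assumes "2 < p" "0 < s" "0 \<le> t" "t \<le> s"
  shows "0 \<le> hom t s"
proof -
  have ge: "0 \<le> (s - t) / (t + s)" using assms by (simp add: field_simps)
  have K: "K \<le> 1" using K_le_1 assms by simp
  show ?thesis
  proof (cases "(s - t) / (t + s) \<le> z0")
    case True
    moreover have "z0 \<le> 0" using z0_sign[of "-1"] assms by simp
    ultimately have "(s - t) / (t + s) = z0" using ge by simp
    then show ?thesis by (simp add: hom_def gam_def z0)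
  next
    case False
    then have "hom t s = 2 powr p * (s powr p - K powr p * t powr p)"
      using hom_powers[of t s] assms by (simp add: hom_def gam_def)
    moreover have "K powr p * t powr p \<le> 1 powr p * s powr p"
      using K K_pos assms by (intro mult_mono powr_mono2) auto
    ultimately show ?thesis by simp
  qed
qed

context
  fixes u v :: "'a::euclidean_space \<Rightarrow> real" and x a b lu lv
  assumes u: "jet u x a lu" "0 < u x"
    and v: "jet v x b lv" "\<forall>\<^sub>F y in nhds x. 0 \<le> v y"
    and ab: "norm b \<le> norm a"
    and lu: "(d - 1) * (norm a)\<^sup>2 \<le> u x * lu" and lv: "v x * lv \<le> (d - 1) * (norm b)\<^sup>2"
begin

private definition "\<sigma> = (v x - u x) / (u x + v x)"

private lemma v_nonneg: "0 \<le> v x"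
  using v(2) by (rule eventually_nhds_x_imp_x)

private lemma \<sigma>_bounds: "-1 \<le> \<sigma>" "\<sigma> < 1"
  using ratio_bounds[of "u x" "v x"] u(2) v_nonneg by (auto simp: \<sigma>_def)

private lemma ratio_jet: "\<exists>c l. jet (\<lambda>y. (v y - u y) / (u y + v y)) x c l"
  using jet_ratio[OF u(1) v(1) refl _ refl] u(2) v_nonneg by fastforce

private lemma near: "\<forall>\<^sub>F y in nhds x. 0 < u y \<and> 0 \<le> v y"
  using jet_eventually_pos[OF u] v(2) by eventually_elim simp

text \<open>At \<open>\<sigma> = -1\<close> one has \<open>v x = 0\<close>, and the bound on
  \<open>v x * lv\<close> does not control \<open>lv\<close>. The assumption \<open>eq\<close> says
  that the derivative in the second variable vanishes there, which removes \<open>lv\<close>; the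
  gradient \<open>b\<close> vanishes because \<open>v\<close> has a minimum.\<close>

private lemma homogeneous_jet_nonpos:
  assumes \<psi>: "jet \<psi> \<sigma> \<psi>1 \<psi>2"
    and ode: "(1 - \<sigma>\<^sup>2) * \<psi>2 - 2 * (d - 1) * \<sigma> * \<psi>1 + p * (d - 1) * \<psi> \<sigma> = 0"
    and signs: "0 \<le> \<psi>1" "p * \<psi> \<sigma> \<le> 2 * \<sigma> * \<psi>1" "p * \<psi> \<sigma> \<le> (1 + \<sigma>) * \<psi>1" "0 \<le> p * \<psi> \<sigma> + (1 - \<sigma>) * \<psi>1"
    and eq: "\<sigma> = -1 \<Longrightarrow> 2 * \<psi>1 = - (p * \<psi> \<sigma>)"
  shows "\<exists>c l. jet (\<lambda>y. (u y + v y) powr p * \<psi> ((v y - u y) / (u y + v y))) x c l \<and> l \<le> 0"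
proof -
  define R where "R = u x + v x"
  define E where "E = R * lu * (p * \<psi> \<sigma> - (1 + \<sigma>) * \<psi>1) + R * lv * (p * \<psi> \<sigma> + (1 - \<sigma>) * \<psi>1)
       + (a \<bullet> a) * (p * (p - 1) * \<psi> \<sigma> - 2 * (p - 1) * (1 + \<sigma>) * \<psi>1 + (1 + \<sigma>)\<^sup>2 * \<psi>2)
       + (b \<bullet> b) * (p * (p - 1) * \<psi> \<sigma> + 2 * (p - 1) * (1 - \<sigma>) * \<psi>1 + (1 - \<sigma>)\<^sup>2 * \<psi>2)
       + 2 * (a \<bullet> b) * (p * (p - 1) * \<psi> \<sigma> - 2 * (p - 1) * \<sigma> * \<psi>1 - (1 - \<sigma>\<^sup>2) * \<psi>2)"
  have R: "0 < R" "\<sigma> = (v x - u x) / R" using u(2) v_nonneg by (auto simp: R_def \<sigma>_def)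
  have uv: "R * (1 - \<sigma>) / 2 = u x" "R * (1 + \<sigma>) / 2 = v x"
    using R by (simp_all add: field_simps) (simp_all add: R_def)
  have "E \<le> 0"
  proof (cases "\<sigma> = -1")
    case True
    then have vx: "v x = 0" "R = u x" using uv by (auto simp: R_def)
    have b: "b = 0" using jet_local_min(1)[OF v(1)] v(2) vx by simp
    have p\<psi>: "p * \<psi> \<sigma> \<le> 0" using signs(3) True by simp
    have "E = (p * \<psi> \<sigma>) * (u x * lu + (p - 1) * (norm a)\<^sup>2)"
      unfolding E_def b dot_square_norm using eq[OF True] True vx by (simp add: algebra_simps)
    moreover have "0 \<le> (p + d - 2) * (norm a)\<^sup>2" using pd by simp
    then have "0 \<le> u x * lu + (p - 1) * (norm a)\<^sup>2" using lu by (simp add: algebra_simps)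
    ultimately show ?thesis using p\<psi> by (simp add: mult_nonpos_nonneg)
  next
    case False
    then show ?thesis
      unfolding E_def using \<sigma>_bounds d_gt_1 pd lu lv ab ode signs
      by (intro homogeneous_operator_nonpos) (auto simp: uv)
  qed
  then have "R powr (p - 2) * E \<le> 0" by (intro mult_nonneg_nonpos) auto
  moreover have "\<exists>c. jet (\<lambda>y. (u y + v y) powr p * \<psi> ((v y - u y) / (u y + v y))) x c (R powr (p - 2) * E)"
    unfolding E_def by (rule jet_homogeneous[OF u(1) v(1) R_def R \<psi>])
  ultimately show ?thesis by blast
qed

text \<open>Up to and including the line \<open>v = K u\<close>, the homogeneous extension of
  \<open>\<alpha> * g\<close> touches from above. Beyond it the function is a difference of powers,
  and \<open>v > K u \<ge> u\<close> together with \<open>p \<le> 2\<close> gives the inequality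
  needed there.\<close>

lemma visc_super_hom:
  assumes p2: "p \<le> 2"
  shows "visc_super (\<lambda>y. hom (u y) (v y)) x"
proof (cases "\<sigma> \<le> z0")
  case True
  have neg: "g s < 0" if "-1 \<le> s" "s < \<sigma>" for s using z0(4) that True by simp
  define \<psi> where "\<psi> s = \<alpha> * g s" for s
  have "jet \<psi> \<sigma> (\<alpha> * g1 \<sigma>) (\<alpha> * g2 \<sigma>)"
  proof (rule jet_real_taylor[where f' = "\<lambda>s. \<alpha> * g1 s"])
    show "\<forall>\<^sub>F y in nhds \<sigma>. (\<psi> has_real_derivative \<alpha> * g1 y) (at y)"
      using eventually_nhds_in_open[of "{-3<..<1}" \<sigma>] \<sigma>_bounds unfolding \<psi>_def
      by (auto elim!: eventually_mono intro!: DERIV_cmult g_deriv)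
    show "((\<lambda>s. \<alpha> * g1 s) has_real_derivative \<alpha> * g2 \<sigma>) (at \<sigma>)"
      using \<sigma>_bounds by (intro DERIV_cmult g1_deriv) auto
  qed
  then have "\<exists>c l. jet (\<lambda>y. (u y + v y) powr p * \<psi> ((v y - u y) / (u y + v y))) x c l \<and> l \<le> 0"
  proof (rule homogeneous_jet_nonpos)
    have "\<alpha> * ((1 - \<sigma>\<^sup>2) * g2 \<sigma> - 2 * (d - 1) * \<sigma> * g1 \<sigma> + p * (d - 1) * g \<sigma>) = 0"
      using g_ode[of \<sigma>] \<sigma>_bounds by simp
    then show "(1 - \<sigma>\<^sup>2) * (\<alpha> * g2 \<sigma>) - 2 * (d - 1) * \<sigma> * (\<alpha> * g1 \<sigma>) + p * (d - 1) * \<psi> \<sigma> = 0"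
      unfolding \<psi>_def by (simp add: algebra_simps)
    have g1: "0 < g1 \<sigma>" using \<sigma>_bounds neg by (rule g1_pos)
    then show "0 \<le> \<alpha> * g1 \<sigma>" using alpha_pos by simp
    have "p * g \<sigma> \<le> 2 * \<sigma> * g1 \<sigma>" using g_cross_sign[OF \<sigma>_bounds neg, of 1] p2 by simp
    then show "p * \<psi> \<sigma> \<le> 2 * \<sigma> * (\<alpha> * g1 \<sigma>)"
      using mult_left_mono[of "p * g \<sigma>" "2 * \<sigma> * g1 \<sigma>" \<alpha>] alpha_pos by (simp add: \<psi>_def ac_simps)
    have "g \<sigma> \<le> 0" using z0(3) z0(4)[of \<sigma>] \<sigma>_bounds True by (cases "\<sigma> = z0") auto
    then have "p * (\<alpha> * g \<sigma>) \<le> 0" using alpha_pos p_pos by (intro mult_nonneg_nonpos) auto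
    also have "0 \<le> (1 + \<sigma>) * (\<alpha> * g1 \<sigma>)" using \<sigma>_bounds g1 alpha_pos by simp
    finally show "p * \<psi> \<sigma> \<le> (1 + \<sigma>) * (\<alpha> * g1 \<sigma>)" by (simp add: \<psi>_def)
    have "0 \<le> \<alpha> * (p * g \<sigma> + (1 - \<sigma>) * g1 \<sigma>)"
      using g_slope_nonneg[OF \<sigma>_bounds neg] alpha_pos by simp
    then show "0 \<le> p * \<psi> \<sigma> + (1 - \<sigma>) * (\<alpha> * g1 \<sigma>)" by (simp add: \<psi>_def algebra_simps)
    show "2 * (\<alpha> * g1 \<sigma>) = - (p * \<psi> \<sigma>)" if "\<sigma> = -1"
      unfolding \<psi>_def that by (simp add: g_at_m1)
  qed
  then obtain c l where cl: "jet (\<lambda>y. (u y + v y) powr p * \<psi> ((v y - u y) / (u y + v y))) x c l" "l \<le> 0"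
    by blast
  obtain b' where b': "z0 < b'" "\<And>s. -1 \<le> s \<Longrightarrow> s < b' \<Longrightarrow> gam s \<le> \<alpha> * g s"
    using gam_le_near p2 by (metis e_def mult_1)
  have "\<forall>\<^sub>F y in nhds x. (v y - u y) / (u y + v y) < b'"
    using ratio_jet True b' by (auto simp: \<sigma>_def intro!: jet_eventually_less)
  with near have "\<forall>\<^sub>F y in nhds x. hom (u y) (v y) \<le> (u y + v y) powr p * \<psi> ((v y - u y) / (u y + v y))"
  proof eventually_elim
    case (elim y)
    then show ?case unfolding hom_def \<psi>_def
      using ratio_bounds[of "u y" "v y"] by (intro mult_left_mono b') auto
  qed
  moreover have "(u x + v x) powr p * \<psi> ((v x - u x) / (u x + v x)) = hom (u x) (v x)"
    using True by (simp add: hom_def gam_def \<psi>_def \<sigma>_def)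
  ultimately show ?thesis using cl by (intro visc_superI[OF cl(1)]) auto
next
  case False
  then have Kuv: "K * u x < v x" using ratio_gt_z0[of "u x" "v x"] u(2) v_nonneg by (simp add: \<sigma>_def)
  have K: "1 \<le> K" using K_ge_1 p2 by simp
  have "u x \<le> K * u x" using K u(2) by simp
  with Kuv have uv: "u x < v x" by simp
  have "visc_super (\<lambda>y. 2 powr p * (v y powr p - K powr p * u y powr p)) x"
  proof (rule visc_super_powers[OF u v(1) _ _ _ p_pos _ ab lu lv])
    have "v x powr (p - 2) \<le> u x powr (p - 2)" using uv u(2) p2 by (intro powr_mono2') auto
    moreover have "1 \<le> K powr p" using K p_pos by (simp add: ge_one_powr_ge_zero)
    ultimately show "v x powr (p - 2) \<le> K powr p * u x powr (p - 2)"
      by (metis mult_1 mult_right_mono order_trans powr_ge_zero)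
  qed (use uv u pd in auto)
  moreover have "\<forall>\<^sub>F y in nhds x. z0 < (v y - u y) / (u y + v y)"
    using ratio_jet False by (auto simp: \<sigma>_def intro!: jet_eventually_pos)
  with near have "\<forall>\<^sub>F y in nhds x. hom (u y) (v y) = 2 powr p * (v y powr p - K powr p * u y powr p)"
  proof eventually_elim
    case (elim y)
    then show ?case using hom_powers[of "u y" "v y"] by (simp add: hom_def gam_def)
  qed
  ultimately show ?thesis by (rule visc_super_cong)
qed

text \<open>The equation is invariant under \<open>s \<mapsto> - s\<close> and under scaling, so
  \<open>- k * g (- s)\<close> solves it. The reflection exchanges the bounds on the two first
  derivatives, and \<open>g_cross_sign\<close> is used with \<open>-1\<close>. Zeros of
  \<open>v\<close> now lie on the power branch.\<close>

lemma visc_super_hom_swap: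
  assumes p2: "2 < p"
  shows "visc_super (\<lambda>y. - (K powr (- p)) * hom (v y) (u y)) x"
proof -
  define c where "c = K powr (- p)"
  have c: "c > 0" "c * K powr p = 1" using K_pos by (auto simp: c_def powr_minus)
  have K: "K \<le> 1" using K_le_1 p2 by simp
  have flip: "(s - t) / (t + s) = - ((t - s) / (s + t))" for s t :: real
    by (metis add.commute minus_diff_eq minus_divide_left)
  show ?thesis unfolding c_def[symmetric]
  proof (cases "- \<sigma> \<le> z0")
    case True
    have \<tau>: "-1 \<le> - \<sigma>" "- \<sigma> < 1" using \<sigma>_bounds True z0 by auto
    have neg: "g s < 0" if "-1 \<le> s" "s < - \<sigma>" for s using z0(4) that True by simp
    define k where "k = c * \<alpha>"
    have k: "k > 0" using c alpha_pos by (simp add: k_def)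
    define \<psi> where "\<psi> s = - k * g (- s)" for s
    have "jet \<psi> \<sigma> (k * g1 (- \<sigma>)) (- k * g2 (- \<sigma>))"
    proof (rule jet_real_taylor[where f' = "\<lambda>s. k * g1 (- s)"])
      have "(\<psi> has_real_derivative k * g1 (- y)) (at y)" if "y \<in> {-1<..<3}" for y
        unfolding \<psi>_def using that
        by (intro DERIV_cong[OF DERIV_cmult[OF DERIV_mirror[THEN iffD1, OF g_deriv]]]) auto
      then show "\<forall>\<^sub>F y in nhds \<sigma>. (\<psi> has_real_derivative k * g1 (- y)) (at y)"
        using eventually_nhds_in_open[of "{-1<..<3}" \<sigma>] \<sigma>_bounds \<tau>
        by (auto elim!: eventually_mono)
      show "((\<lambda>s. k * g1 (- s)) has_real_derivative - k * g2 (- \<sigma>)) (at \<sigma>)"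
        using \<sigma>_bounds \<tau>
        by (intro DERIV_cong[OF DERIV_cmult[OF DERIV_mirror[THEN iffD1, OF g1_deriv]]]) auto
    qed
    then have "\<exists>c l. jet (\<lambda>y. (u y + v y) powr p * \<psi> ((v y - u y) / (u y + v y))) x c l \<and> l \<le> 0"
    proof (rule homogeneous_jet_nonpos)
      have "- k * ((1 - (- \<sigma>)\<^sup>2) * g2 (- \<sigma>) - 2 * (d - 1) * (- \<sigma>) * g1 (- \<sigma>) + p * (d - 1) * g (- \<sigma>)) = 0"
        using g_ode[of "- \<sigma>"] \<tau> by simp
      then show "(1 - \<sigma>\<^sup>2) * (- k * g2 (- \<sigma>)) - 2 * (d - 1) * \<sigma> * (k * g1 (- \<sigma>)) + p * (d - 1) * \<psi> \<sigma> = 0"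
        unfolding \<psi>_def by (simp add: algebra_simps)
      have g1: "0 < g1 (- \<sigma>)" using \<tau> neg by (rule g1_pos)
      then show "0 \<le> k * g1 (- \<sigma>)" using k by simp
      have "0 \<le> k * (p * g (- \<sigma>) + 2 * \<sigma> * g1 (- \<sigma>))"
        using g_cross_sign[OF \<tau> neg, of "-1"] p2 k by simp
      then show "p * \<psi> \<sigma> \<le> 2 * \<sigma> * (k * g1 (- \<sigma>))"
        by (simp add: \<psi>_def algebra_simps)
      have "0 \<le> k * (p * g (- \<sigma>) + (1 + \<sigma>) * g1 (- \<sigma>))"
        using g_slope_nonneg[OF \<tau> neg] k by simp
      then show "p * \<psi> \<sigma> \<le> (1 + \<sigma>) * (k * g1 (- \<sigma>))" by (simp add: \<psi>_def algebra_simps)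
      have "g (- \<sigma>) \<le> 0" using z0(3) z0(4)[of "- \<sigma>"] \<tau> True by (cases "- \<sigma> = z0") auto
      then have "0 \<le> p * \<psi> \<sigma>" using k p_pos by (simp add: \<psi>_def mult_nonneg_nonpos)
      moreover have "0 \<le> (1 - \<sigma>) * (k * g1 (- \<sigma>))" using \<sigma>_bounds g1 k by simp
      ultimately show "0 \<le> p * \<psi> \<sigma> + (1 - \<sigma>) * (k * g1 (- \<sigma>))" by simp
      \<comment> \<open>Vacuous: \<open>- \<sigma> \<le> z0 < 1\<close> excludes
        \<open>\<sigma> = -1\<close> on this branch.\<close>
      show "2 * (k * g1 (- \<sigma>)) = - (p * \<psi> \<sigma>)" if "\<sigma> = -1"
        using \<tau> that by simp
    qed
    then obtain c' l where cl: "jet (\<lambda>y. (u y + v y) powr p * \<psi> ((v y - u y) / (u y + v y))) x c' l" "l \<le> 0"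
      by blast
    obtain b' where b': "z0 < b'" "\<And>s. -1 \<le> s \<Longrightarrow> s < b' \<Longrightarrow> - 1 * gam s \<le> - 1 * (\<alpha> * g s)"
      using gam_le_near p2 by (metis e_def not_less)
    have "\<forall>\<^sub>F y in nhds x. - b' < (v y - u y) / (u y + v y)"
      using ratio_jet True b' by (auto simp: \<sigma>_def intro!: jet_eventually_pos)
    with near have "\<forall>\<^sub>F y in nhds x. - c * hom (v y) (u y) \<le> (u y + v y) powr p * \<psi> ((v y - u y) / (u y + v y))"
    proof eventually_elim
      case (elim y)
      define r where "r = (u y - v y) / (v y + u y)"
      have r: "-1 \<le> r" "r < b'" using ratio_bounds[of "v y" "u y"] elim flip[of "u y" "v y"] by (auto simp: r_def)
      have "(c * (v y + u y) powr p) * (- 1 * gam r) \<le> (c * (v y + u y) powr p) * (- 1 * (\<alpha> * g r))"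
        using r c by (intro mult_left_mono b') auto
      moreover have "(v y - u y) / (u y + v y) = - r" unfolding r_def flip[of "u y" "v y"] by simp
      ultimately show ?case
        unfolding hom_def \<psi>_def k_def r_def[symmetric] by (simp add: algebra_simps)
    qed
    moreover have "(u x + v x) powr p * \<psi> ((v x - u x) / (u x + v x)) = - c * hom (v x) (u x)"
      using True unfolding hom_def gam_def flip[of "u x" "v x"] \<sigma>_def[symmetric] \<psi>_def k_def
      by (simp add: add.commute)
    ultimately show "visc_super (\<lambda>y. - c * hom (v y) (u y)) x" using cl by (intro visc_superI[OF cl(1)]) auto
  next
    case False
    then have "z0 < (u x - v x) / (v x + u x)" unfolding flip[of "u x" "v x"] by (simp add: \<sigma>_def)
    then have Kuv: "K * v x < u x" using ratio_gt_z0[of "v x" "u x"] u(2) v_nonneg by simp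
    have super: "visc_super (\<lambda>y. 2 powr p * (v y powr p - c * u y powr p)) x"
    proof (cases "v x = 0")
      case True
      then show ?thesis using u v c p2 d_gt_1 lu
        by (intro visc_super_powers_zero[where d = d]) auto
    next
      case False
      then have vx: "0 < v x" using v_nonneg by simp
      show ?thesis
      proof (rule visc_super_powers[OF u v(1) vx _ _ p_pos _ ab lu lv])
        \<comment> \<open>As \<open>K \<le> 1\<close>, lowering the exponent of \<open>K\<close> to
          \<open>p - 2\<close> only enlarges the left-hand side and produces a power of
          \<open>K * v x\<close>, which is below \<open>u x\<close> on this branch.\<close>
        have "K powr p * v x powr (p - 2) \<le> K powr (p - 2) * v x powr (p - 2)"
          using K K_pos p2 by (intro mult_right_mono powr_mono') auto
        also have "\<dots> = (K * v x) powr (p - 2)" using K_pos vx by (simp add: powr_mult)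
        also have "\<dots> \<le> u x powr (p - 2)" using Kuv K_pos vx p2 by (intro powr_mono2) auto
        finally have "c * (K powr p * v x powr (p - 2)) \<le> c * u x powr (p - 2)"
          using c by (intro mult_left_mono) auto
        then show "v x powr (p - 2) \<le> c * u x powr (p - 2)" using c(2) by (simp add: mult.assoc[symmetric])
      qed (use c pd in auto)
    qed
    have "\<forall>\<^sub>F y in nhds x. (v y - u y) / (u y + v y) < - z0"
      using ratio_jet False by (auto simp: \<sigma>_def intro!: jet_eventually_less)
    with near have "\<forall>\<^sub>F y in nhds x. - c * hom (v y) (u y) = 2 powr p * (v y powr p - c * u y powr p)"
    proof eventually_elim
      case (elim y)
      then have "z0 < (u y - v y) / (v y + u y)" unfolding flip[of "u y" "v y"] by simp
      then have "hom (v y) (u y) = 2 powr p * (u y powr p - K powr p * v y powr p)"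
        using hom_powers[of "v y" "u y"] elim by (simp add: hom_def gam_def)
      then have "- c * hom (v y) (u y) = 2 powr p * ((c * K powr p) * v y powr p - c * u y powr p)"
        by (simp only:) (simp add: algebra_simps)
      then show ?case using c(2) by simp
    qed
    with super show "visc_super (\<lambda>y. - c * hom (v y) (u y)) x" by (rule visc_super_cong)
  qed
qed

end

end

section \<open>Integration against harmonic measure\<close>

lemma harmonic_measure_integrable:
  fixes f :: "'a::euclidean_space \<Rightarrow> real"
  assumes \<mu>: "harmonic_measure U a \<mu>" and "bounded U" and f: "continuous_on (frontier U) f"
  shows "integrable \<mu> f"
proof -
  interpret prob_space \<mu> using \<mu> by (simp add: harmonic_measure_def)
  have sets: "sets \<mu> = sets (restrict_space borel (frontier U))"
    using \<mu> by (simp add: harmonic_measure_def)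
  have space: "space \<mu> = frontier U"
    using sets_eq_imp_space_eq[OF sets] by (simp add: space_restrict_space)
  have meas: "f \<in> borel_measurable \<mu>"
    using borel_measurable_continuous_on_restrict[OF f] measurable_cong_sets[OF sets refl] by blast
  have "compact (f ` frontier U)"
    using f assms(2) by (intro compact_continuous_image compact_frontier_bounded)
  then obtain B where B: "\<forall>x\<in>frontier U. \<bar>f x\<bar> \<le> B"
    by (metis bounded_real compact_imp_bounded imageI)
  show ?thesis
    by (rule integrable_const_bound[of _ B]) (use B meas space in \<open>auto intro!: AE_I2\<close>)
qed

lemma harmonic_measure_space: "harmonic_measure U a \<mu> \<Longrightarrow> space \<mu> = frontier U"
  using sets_eq_imp_space_eq[of \<mu> "restrict_space borel (frontier U)"]
  by (simp add: harmonic_measure_def space_restrict_space)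

text \<open>By definition harmonic measure integrates continuous boundary data to the Perron value,
  and that value is dominated by any supersolution with the same data.\<close>

lemma harmonic_measure_integral_le:
  fixes F :: "'a::euclidean_space \<Rightarrow> real"
  assumes "harmonic_measure U a \<mu>" "open U" "bounded U" "a \<in> U"
    and "continuous_on (closure U) F" "\<And>x. x \<in> U \<Longrightarrow> visc_super F x"
  shows "(\<integral>x. F x \<partial>\<mu>) \<le> F a"
proof -
  have "continuous_on (frontier U) F"
    using assms(5) by (rule continuous_on_subset) (auto simp: frontier_def)
  then have "(\<integral>x. F x \<partial>\<mu>) = perron_solution U F a"
    using assms(1) by (simp add: harmonic_measure_def)
  also have "\<dots> \<le> F a" using assms(2-) by (rule perron_solution_le)
  finally show ?thesis .
qed

context bessel_ode
begin

abbreviation "C \<equiv> C_const p d"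

text \<open>The function \<open>B\<close>. For \<open>p > 2\<close> the factor
  \<open>K powr (- p)\<close> normalises the coefficient of \<open>t powr p\<close>, and
  \<open>C = inverse K\<close> turns the other coefficient into \<open>C powr p\<close>.\<close>

definition burk where "burk s t = (if p \<le> 2 then hom s t else - (K powr (- p)) * hom t s)"

lemma C_eq: "C = (if p \<le> 2 then K else inverse K)"
  by (simp add: C_const_def K_def)

lemma C_pos: "0 < C"
  using K_pos by (simp add: C_eq)

lemma burk_majorizes:
  assumes "0 < s" "0 \<le> t"
  shows "2 powr p * (t powr p - C powr p * s powr p) \<le> burk s t"
proof (cases "p \<le> 2")
  case True
  then show ?thesis using hom_majorizes[of s t] assms by (simp add: C_eq burk_def e_def)
next
  case False
  have c: "C powr p = K powr (- p)" using False K_pos by (simp add: C_eq powr_minus inverse_powr)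
  have "K powr (- p) * hom t s \<le> K powr (- p) * (2 powr p * (s powr p - K powr p * t powr p))"
    using hom_majorizes[of t s] assms False by (intro mult_left_mono) (auto simp: e_def)
  also have "\<dots> = 2 powr p * (C powr p * s powr p - (K powr (- p) * K powr p) * t powr p)"
    unfolding c by (simp add: algebra_simps)
  also have "K powr (- p) * K powr p = 1" using K_pos by (simp add: powr_minus)
  finally show ?thesis using False by (simp add: burk_def algebra_simps)
qed

lemma burk_nonpos: "0 < s \<Longrightarrow> 0 \<le> t \<Longrightarrow> t \<le> s \<Longrightarrow> burk s t \<le> 0"
  using hom_nonpos[of s t] hom_nonneg[of s t] by (simp add: burk_def mult_nonneg_nonneg)

lemma burk_continuous:
  assumes "continuous_on S u" "continuous_on S v" "\<And>x. x \<in> S \<Longrightarrow> 0 < u x \<and> 0 \<le> v x"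
  shows "continuous_on S (\<lambda>x. burk (u x) (v x))"
proof (cases "p \<le> 2")
  case True
  then show ?thesis unfolding burk_def using assms
    by (auto intro!: hom_continuous simp: add_pos_nonneg less_imp_le)
next
  case False
  then show ?thesis unfolding burk_def using assms
    by (auto intro!: hom_continuous continuous_intros simp: add_nonneg_pos less_imp_le)
qed

lemma burk_visc_super:
  fixes u v :: "'a::euclidean_space \<Rightarrow> real"
  assumes "jet u x a lu" "0 < u x" "jet v x b lv" "\<forall>\<^sub>F y in nhds x. 0 \<le> v y" "norm b \<le> norm a"
    "(d - 1) * (norm a)\<^sup>2 \<le> u x * lu" "v x * lv \<le> (d - 1) * (norm b)\<^sup>2"
  shows "visc_super (\<lambda>y. burk (u y) (v y)) x"
  using visc_super_hom[OF assms] visc_super_hom_swap[OF assms] by (cases "p \<le> 2") (simp_all add: burk_def)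

lemma harmonic_measure_powr_le:
  fixes u v :: "'a::euclidean_space \<Rightarrow> real"
  assumes \<mu>: "harmonic_measure U a \<mu>" and U: "open U" "bounded U" "a \<in> U"
    and S: "open S" "closure U \<subseteq> S"
    and u: "C2_on S u" "\<And>x. x \<in> S \<Longrightarrow> 0 \<le> u x" and v: "C2_on S v" "\<And>x. x \<in> S \<Longrightarrow> 0 \<le> v x"
    and va: "v a \<le> u a"
    and grad: "\<And>x. x \<in> S \<Longrightarrow> norm (gradient v x) \<le> norm (gradient u x)"
    and lu: "\<And>x. x \<in> S \<Longrightarrow> (d - 1) * (norm (gradient u x))\<^sup>2 \<le> u x * laplacian u x"
    and lv: "\<And>x. x \<in> S \<Longrightarrow> v x * laplacian v x \<le> (d - 1) * (norm (gradient v x))\<^sup>2"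
  shows "(\<integral>x. v x powr p \<partial>\<mu>) \<le> C powr p * (\<integral>x. u x powr p \<partial>\<mu>)"
proof -
  interpret prob_space \<mu> using \<mu> by (simp add: harmonic_measure_def)
  have space: "space \<mu> = frontier U" using \<mu> by (rule harmonic_measure_space)
  have fr: "frontier U \<subseteq> closure U" "frontier U \<subseteq> S" "U \<subseteq> S"
    using S(2) closure_subset[of U] by (auto simp: frontier_def)
  have cont: "continuous_on S u" "continuous_on S v" using u(1) v(1) by (auto intro: C2_on_continuous)
  have cont_fr: "continuous_on (frontier U) u" "continuous_on (frontier U) v"
    using cont fr by (auto intro: continuous_on_subset)
  have int_v: "integrable \<mu> (\<lambda>x. v x powr p)"
    using cont_fr v(2) fr p_pos
    by (intro harmonic_measure_integrable[OF \<mu> U(2)] continuous_on_powr' continuous_intros) auto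
  have int_u: "integrable \<mu> (\<lambda>x. (u x + h) powr p)" if "0 \<le> h" for h
    using cont_fr u(2) fr p_pos that
    by (intro harmonic_measure_integrable[OF \<mu> U(2)] continuous_on_powr' continuous_intros) (auto simp: add_nonneg_nonneg)
  \<comment> \<open>Needed for the shift by \<open>h\<close>, which adds \<open>h\<close> times the
    Laplacian of \<open>u\<close> to the lower bound for \<open>u\<close>. At zeros of
    \<open>u\<close> its sign comes from the minimum, elsewhere from the differential
    inequality.\<close>
  have lap: "0 \<le> laplacian u x" if "x \<in> S" for x
  proof (cases "u x = 0")
    case True
    have "\<forall>\<^sub>F y in nhds x. u x \<le> u y"
      using eventually_nhds_in_open[OF S(1) that] u(2) True by (auto elim: eventually_mono)
    then show ?thesis using jet_local_min(2)[OF C2_on_jet[OF u(1) S(1) that]] by simp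
  next
    case False
    have "0 \<le> (d - 1) * (norm (gradient u x))\<^sup>2" using d_gt_1 by simp
    then have "0 \<le> u x * laplacian u x" using lu[OF that] by linarith
    then show ?thesis using False u(2)[OF that] by (simp add: zero_le_mult_iff)
  qed
  have shifted: "(\<integral>x. v x powr p \<partial>\<mu>) \<le> C powr p * (\<integral>x. (u x + h) powr p \<partial>\<mu>)" if h: "0 < h" for h
  proof -
    define F where "F x = burk (u x + h) (v x)" for x
    have cF: "continuous_on (closure U) F"
      unfolding F_def using cont S(2) u(2) v(2) h
      by (intro burk_continuous continuous_intros) (auto intro: continuous_on_subset simp: add_nonneg_pos)
    have "visc_super F x" if "x \<in> U" for x
    proof -
      have x: "x \<in> S" using that fr by blast
      have "jet (\<lambda>y. u y + h) x (gradient u x + 0) (laplacian u x + 0)"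
        by (intro jet_add jet_const C2_on_jet[OF u(1) S(1) x])
      then have ju: "jet (\<lambda>y. u y + h) x (gradient u x) (laplacian u x)" by simp
      have "0 \<le> h * laplacian u x" using h lap[OF x] by simp
      then have "(d - 1) * (norm (gradient u x))\<^sup>2 \<le> (u x + h) * laplacian u x"
        using lu[OF x] by (simp add: algebra_simps)
      moreover have "\<forall>\<^sub>F y in nhds x. 0 \<le> v y"
        using eventually_nhds_in_open[OF S(1) x] v(2) by (auto elim: eventually_mono)
      ultimately show ?thesis
        unfolding F_def using C2_on_jet[OF v(1) S(1) x] grad[OF x] lv[OF x] u(2)[OF x] h
        by (intro burk_visc_super[OF ju]) auto
    qed
    then have "(\<integral>x. F x \<partial>\<mu>) \<le> F a"
      using \<mu> U cF by (intro harmonic_measure_integral_le) auto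
    also have "\<dots> \<le> 0"
      unfolding F_def using U(3) fr u(2)[of a] v(2)[of a] va h by (intro burk_nonpos) auto
    finally have "(\<integral>x. F x \<partial>\<mu>) \<le> 0" .
    moreover have "(\<integral>x. 2 powr p * (v x powr p - C powr p * (u x + h) powr p) \<partial>\<mu>) \<le> (\<integral>x. F x \<partial>\<mu>)"
    proof (rule integral_mono)
      show "integrable \<mu> (\<lambda>x. 2 powr p * (v x powr p - C powr p * (u x + h) powr p))"
        using int_v int_u[of h] h by (intro integrable_mult_right Bochner_Integration.integrable_diff) auto
      show "integrable \<mu> F"
        using cF fr(1) by (intro harmonic_measure_integrable[OF \<mu> U(2)]) (auto intro: continuous_on_subset)
      show "2 powr p * (v x powr p - C powr p * (u x + h) powr p) \<le> F x" if "x \<in> space \<mu>" for x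
        unfolding F_def using that space fr u(2)[of x] v(2)[of x] h by (intro burk_majorizes) auto
    qed
    moreover have "(\<integral>x. 2 powr p * (v x powr p - C powr p * (u x + h) powr p) \<partial>\<mu>)
       = 2 powr p * ((\<integral>x. v x powr p \<partial>\<mu>) - C powr p * (\<integral>x. (u x + h) powr p \<partial>\<mu>))"
      using int_v int_u[of h] h by simp
    ultimately have "2 powr p * ((\<integral>x. v x powr p \<partial>\<mu>) - C powr p * (\<integral>x. (u x + h) powr p \<partial>\<mu>)) \<le> 0"
      by linarith
    then show ?thesis by (simp add: mult_le_0_iff)
  qed
  \<comment> \<open>Shifts in \<open>(0, 1]\<close>, so that \<open>(u x + 1) powr p\<close>
    dominates all the integrands.\<close>
  define h where "h n = inverse (real (Suc n))" for n
  have h: "0 < h n" "h n \<le> 1" for n by (auto simp: h_def field_simps)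
  have h_lim: "h \<longlonglongrightarrow> 0" unfolding h_def by (rule LIMSEQ_inverse_real_of_nat)
  have "(\<lambda>n. \<integral>x. (u x + h n) powr p \<partial>\<mu>) \<longlonglongrightarrow> (\<integral>x. u x powr p \<partial>\<mu>)"
  proof (rule integral_dominated_convergence)
    show "integrable \<mu> (\<lambda>x. (u x + 1) powr p)" by (rule int_u) simp
    show "(\<lambda>x. u x powr p) \<in> borel_measurable \<mu>"
      using int_u[of 0] by (simp add: borel_measurable_integrable)
    show "(\<lambda>x. (u x + h n) powr p) \<in> borel_measurable \<mu>" for n
      using int_u[of "h n"] h[of n] by (simp add: borel_measurable_integrable)
    show "AE x in \<mu>. (\<lambda>n. (u x + h n) powr p) \<longlonglongrightarrow> u x powr p"
    proof (rule AE_I2)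
      fix x assume "x \<in> space \<mu>"
      then have ux: "0 \<le> u x" using space fr u(2) by auto
      have "(\<lambda>n. u x + h n) \<longlonglongrightarrow> u x + 0" by (intro tendsto_intros h_lim)
      then show "(\<lambda>n. (u x + h n) powr p) \<longlonglongrightarrow> u x powr p"
        using ux h p_pos by (intro tendsto_powr2) (auto intro!: always_eventually add_nonneg_nonneg simp: less_imp_le add_nonneg_pos)
    qed
    show "AE x in \<mu>. norm ((u x + h n) powr p) \<le> (u x + 1) powr p" for n
    proof (rule AE_I2)
      fix x assume "x \<in> space \<mu>"
      then have "0 \<le> u x" using space fr u(2) by auto
      then show "norm ((u x + h n) powr p) \<le> (u x + 1) powr p"
        using h[of n] p_pos by (auto intro!: powr_mono2)
    qed
  qed
  then have "(\<lambda>n. C powr p * (\<integral>x. (u x + h n) powr p \<partial>\<mu>)) \<longlonglongrightarrow> C powr p * (\<integral>x. u x powr p \<partial>\<mu>)"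
    by (intro tendsto_intros)
  then show ?thesis
    by (rule LIMSEQ_le_const) (use shifted h in auto)
qed

end

theorem theorem4p2:
  fixes D :: "(real ^ 'n) set" and u v :: "real ^ 'n \<Rightarrow> real" and d p :: real
  assumes "open D" and "0 \<in> D"
    and "d > 1"
    and "C2_on D u" and "subharmonic_on D u" and "\<forall>x\<in>D. u x \<ge> 0"
    and "C2_on D v" and "subharmonic_on D v" and "\<forall>x\<in>D. v x \<ge> 0"
    and "\<bar>v 0\<bar> \<le> \<bar>u 0\<bar>"
    and "\<forall>x\<in>D. norm (gradient v x) \<le> norm (gradient u x)"
    and "\<forall>x\<in>D. u x * laplacian u x \<ge> (d - 1) * (norm (gradient u x))\<^sup>2"
    and "\<forall>x\<in>D. v x * laplacian v x \<le> (d - 1) * (norm (gradient v x))\<^sup>2"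
    and "max (2 - d) 0 < p"
  shows "harm_norm D p v \<le> ennreal (C_const p d) * harm_norm D p u"
proof -
  interpret bessel_ode p d using assms by unfold_locales auto
  have v0: "v 0 \<le> u 0" using assms(2,6,10) by (metis abs_ge_self abs_of_nonneg order_trans)
  define N where "N f \<mu> = (\<integral>x. \<bar>f x\<bar> powr p \<partial>\<mu>) powr (1 / p)" for f and \<mu> :: "(real ^ 'n) measure"
  have N: "N v \<mu> \<le> C * N u \<mu>" if D0: "admissible_subdomain D D0" and \<mu>: "harmonic_measure D0 0 \<mu>" for D0 \<mu>
  proof -
    have cl: "closure D0 \<subseteq> D"
      using D0 by (auto simp: admissible_subdomain_def closure_Un_frontier)
    have sp: "space \<mu> \<subseteq> D" using harmonic_measure_space[OF \<mu>] D0 by (simp add: admissible_subdomain_def)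
    have le: "(\<integral>x. v x powr p \<partial>\<mu>) \<le> C powr p * (\<integral>x. u x powr p \<partial>\<mu>)"
    proof (rule harmonic_measure_powr_le)
      show "harmonic_measure D0 0 \<mu>" "open D" "closure D0 \<subseteq> D" "C2_on D u" "C2_on D v" "v 0 \<le> u 0"
        by fact+
      show "open D0" "bounded D0" "0 \<in> D0" using D0 by (simp_all add: admissible_subdomain_def)
    qed (use assms(6,9,11-13) in blast)+
    have abs: "(\<integral>x. \<bar>f x\<bar> powr p \<partial>\<mu>) = (\<integral>x. f x powr p \<partial>\<mu>)" if "\<forall>x\<in>D. f x \<ge> 0" for f
      using that sp by (intro Bochner_Integration.integral_cong) auto
    from le have "(\<integral>x. \<bar>v x\<bar> powr p \<partial>\<mu>) \<le> C powr p * (\<integral>x. \<bar>u x\<bar> powr p \<partial>\<mu>)"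
      by (simp only: abs[OF assms(6)] abs[OF assms(9)])
    then have "N v \<mu> \<le> (C powr p * (\<integral>x. \<bar>u x\<bar> powr p \<partial>\<mu>)) powr (1 / p)"
      unfolding N_def using p_pos by (intro powr_mono2) auto
    also have "\<dots> = C * N u \<mu>"
      unfolding N_def using C_pos p_pos by (simp add: powr_mult powr_powr)
    finally show ?thesis .
  qed
  show ?thesis
    unfolding harm_norm_def N_def[symmetric]
  \<comment> \<open>The bound holds for each subdomain with its own measure, so it passes to the
    supremum in \<open>ennreal\<close> even when that is infinite.\<close>
  proof (rule SUP_least, clarify)
    fix D0 \<mu> assume *: "admissible_subdomain D D0" "harmonic_measure D0 0 \<mu>"
    have "ennreal (N v \<mu>) \<le> ennreal C * ennreal (N u \<mu>)"
      using N[OF *] C_pos by (simp add: ennreal_mult'[symmetric] ennreal_leI)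
    also have "\<dots> \<le> ennreal C * (SUP (D0, \<mu>) \<in> {(D0, \<mu>). admissible_subdomain D D0 \<and> harmonic_measure D0 0 \<mu>}. ennreal (N u \<mu>))"
      using * by (intro mult_left_mono SUP_upper2[of "(D0, \<mu>)"]) auto
    finally show "ennreal (N v \<mu>) \<le> ennreal C * (SUP (D0, \<mu>) \<in> {(D0, \<mu>). admissible_subdomain D D0 \<and> harmonic_measure D0 0 \<mu>}. ennreal (N u \<mu>))" .
  qed
qed

end
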